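(* Let $U^*\in (V_{N_g})^N\cap\mathcal M^N$ be such that the local minimizer $[U^*]$ of $E$ is the unique critical point in $B([U^*],\delta_1)$, and assume that $\nabla E$, as an operator from $(V_{N_g})^N$ to $(V_{N_g})^N$, is continuous in $B(U^*,\delta_1)$. For a fixed constant $\delta_2\in(0,\delta_1]$ define $$E_0=\min\{E(\tilde U): [\tilde U]\in\overline{B([U^*],\delta_1)\setminus B([U^*],\delta_2)}\}.$$ Let $U(t)\in (V_{N_g})^N$ be the solution of $\frac{\mathrm dU}{\mathrm dt}=-\nabla_G E(U)$, $0<t<\infty$, $U(0)=U_0$, where $U_0\in (V_{N_g})^N\cap\mathcal M^N$. If the initial value satisfies $$E(U_0)\le \frac{E_0+E(U^* )}{2}\equiv E_1,$$ then $$\lim_{t\to\infty}|||\nabla_G E(U(t))|||=0,\qquad \lim_{t\to\infty}E(U(t))=E(U^* ),\qquad \lim_{t\to\infty}\mathrm{dist}([U(t)],[U^*])=0 .$$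
   Context: Setting. $N\ge 1$; $V_{N_g}\subset H^1(\mathbb R^3)$ is a finite-dimensional space (dimension $N_g$) of real-valued functions. For $N$-tuples $\Psi,\Phi$ of functions, $\langle\Psi^\top\Phi\rangle=((\psi_i,\varphi_j)_{L^2(\mathbb R^3)})_{i,j=1}^N$, $(\Psi,\Phi)=\mathrm{tr}\langle\Psi^\top\Phi\rangle$, $|||\Psi|||=(\Psi,\Psi)^{1/2}$. For $P\in\mathbb R^{N\times N}$, $UP$ is the $N$-tuple with $i$-th entry $\sum_j p_{ji}u_j$. $\mathcal M^N=\{U\in (H^1(\mathbb R^3))^N:\langle U^\top U\rangle=I_N\}$; $\mathcal O^N$ is the group of orthogonal $N\times N$ matrices; $[U]=\{UP:P\in\mathcal O^N\}$ for $U\in\mathcal M^N$; $\mathrm{dist}([U],[\hat U])=\inf_{P\in\mathcal O^N}|||U-\hat UP|||$. Closed neighborhoods: $B(U,\delta)=\{\hat U\in (V_{N_g})^N:|||U-\hat U|||\le\delta\}$ and $B([U],\delta)=\{[\hat U]:\hat U\in (V_{N_g})^N\cap\mathcal M^N,\ \mathrm{dist}([U],[\hat U])\le\delta\}$. $\delta_1>0$ is a constant. Energy. $E$ is the Kohn-Sham energy $$E(U)=\sum_{i=1}^N\int_{\mathbb R^3}|\nabla u_i|^2\,dr+\int_{\mathbb R^3}V_{ext}\rho_U\,dr+\frac12\iint\frac{\rho_U(r)\rho_U(r')}{|r-r'|}\,dr\,dr'+\int_{\mathbb R^3}\varepsilon_{xc}(\rho_U)\rho_U\,dr,\qquad \rho_U=2\sum_{i=1}^N|u_i|^2,$$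 where $V_{ext}$ is the external potential (for full potential calculations $V_{ext}(r)=-\sum_{I=1}^M Z_I/|r-R_I|$). Standing assumptions: $E$ is bounded from below on $\mathcal M^N$; the exchange-correlation term is differentiable, with potential $v_{xc}(\rho)=\delta(\rho\,\varepsilon_{xc}(\rho))/\delta\rho$. $\nabla E(U)\in (V_{N_g})^N$ denotes the gradient of $E$ on $(V_{N_g})^N$ with respect to $(\cdot,\cdot)$, i.e. for every $v\in V_{N_g}$ $$((\nabla E(U))_i,v)_{L^2}=4\Big(\tfrac12(\nabla u_i,\nabla v)_{L^2}+(V_{ext}u_i,v)_{L^2}+\Big(\int\frac{\rho_U(r')}{|\cdot-r'|}dr'\,u_i,v\Big)_{L^2}+(v_{xc}(\rho_U)u_i,v)_{L^2}\Big).$$ One has $E(UP)=E(U)$ for $U\in\mathcal M^N$, $P\in\mathcal O^N$, and $\langle U^\top\nabla E(U)\rangle$ is symmetric. Extended Grassmann gradient. For $U\in (V_{N_g})^N$, $\nabla_G E(U)=\nabla E(U)\langle U^\top U\rangle-U\langle U^\top\nabla E(U)\rangle$. For $U\in (V_{N_g})^N\cap\mathcal M^N$, $[U]$ is a critical point if $\nabla_G E(U)=0$; $[U^*]$ is a local minimizer if $E(U^* )\le E(U)$ for all $[U]\in B([U^*],r)$, for some $r>0$.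
   Formalization: The formal theorem additionally assumes that [U_0] lies in B([U*],δ_2) and that E(U* ) ≤ E_0; without these the claim fails, e.g. if U_0 is another isolated minimizer far from [U*] with the same energy. *)

theory Defs
  imports "HOL-Analysis.Analysis" "HOL-Library.Function_Algebras"
begin

text \<open>
  Functions on \<open>\<real>\<^sup>3\<close> are honest functions, not classes modulo null sets. The space
  \<open>V\<close> below is spanned by finitely many functions that are linearly independent almost
  everywhere, so on \<open>V\<close> equality and equality almost everywhere coincide.
  Sums, differences and zero of functions and of tuples are the pointwise ones of
  \<^theory>\<open>HOL-Library.Function_Algebras\<close>.
\<close>

primrec C_k :: "nat \<Rightarrow> (real^3 \<Rightarrow> real) \<Rightarrow> bool" where
  "C_k 0 f \<longleftrightarrow> continuous_on UNIV f"
| "C_k (Suc k) f \<longleftrightarrow> (\<exists>g. (\<forall>x. GDERIV f x :> g x) \<and> (\<forall>i. C_k k (\<lambda>x. g x $ i)))"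

definition test_function :: "(real^3 \<Rightarrow> real) \<Rightarrow> bool" where
  "test_function \<phi> \<longleftrightarrow> (\<forall>k. C_k k \<phi>) \<and> (\<exists>K. compact K \<and> (\<forall>x. x \<notin> K \<longrightarrow> \<phi> x = 0))"

definition L2 :: "(real^3 \<Rightarrow> 'b::euclidean_space) set" where
  "L2 = {f \<in> borel_measurable lborel. integrable lborel (\<lambda>x. (norm (f x))\<^sup>2)}"

definition l2_inner :: "(real^3 \<Rightarrow> 'b::euclidean_space) \<Rightarrow> (real^3 \<Rightarrow> 'b) \<Rightarrow> real" where
  "l2_inner f g = (LINT x|lborel. f x \<bullet> g x)"

definition is_weak_gradient :: "(real^3 \<Rightarrow> real) \<Rightarrow> (real^3 \<Rightarrow> real^3) \<Rightarrow> bool" where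
  "is_weak_gradient u g \<longleftrightarrow>
     (\<forall>\<phi> d\<phi>. test_function \<phi> \<and> (\<forall>x. GDERIV \<phi> x :> d\<phi> x) \<longrightarrow>
        (LINT x|lborel. u x *\<^sub>R d\<phi> x) = - (LINT x|lborel. \<phi> x *\<^sub>R g x))"

definition H1 :: "(real^3 \<Rightarrow> real) set" where
  "H1 = {u \<in> L2. \<exists>g \<in> L2. is_weak_gradient u g}"

text \<open>Weak gradients are unique up to null sets, so the choice is immaterial under integrals.\<close>

definition weak_grad :: "(real^3 \<Rightarrow> real) \<Rightarrow> (real^3 \<Rightarrow> real^3)" where
  "weak_grad u = (SOME g. g \<in> L2 \<and> is_weak_gradient u g)"

type_synonym 'n orbitals = "'n \<Rightarrow> real^3 \<Rightarrow> real"

definition tuples :: "(real^3 \<Rightarrow> real) set \<Rightarrow> 'n::finite orbitals set" where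
  "tuples V = {U. \<forall>i. U i \<in> V}"

definition gram :: "'n::finite orbitals \<Rightarrow> 'n orbitals \<Rightarrow> real^'n^'n" where
  "gram \<Psi> \<Phi> = (\<chi> i j. l2_inner (\<Psi> i) (\<Phi> j))"

definition tinner :: "'n::finite orbitals \<Rightarrow> 'n orbitals \<Rightarrow> real" where
  "tinner \<Psi> \<Phi> = trace (gram \<Psi> \<Phi>)"

definition tnorm :: "'n::finite orbitals \<Rightarrow> real" where
  "tnorm \<Psi> = sqrt (tinner \<Psi> \<Psi>)"

text \<open>\<open>tmul U P\<close> is \<open>UP\<close>; here \<open>P $ j $ i\<close> is the entry \<open>p\<^sub>j\<^sub>i\<close> in row \<open>j\<close>, column \<open>i\<close>.\<close>

definition tmul :: "'n::finite orbitals \<Rightarrow> real^'n^'n \<Rightarrow> 'n orbitals" where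
  "tmul U P = (\<lambda>i r. \<Sum>j\<in>UNIV. P $ j $ i * U j r)"

definition stiefel :: "'n::finite orbitals set" where
  "stiefel = {U \<in> tuples H1. gram U U = mat 1}"

definition discrete_space :: "(real^3 \<Rightarrow> real) set \<Rightarrow> nat \<Rightarrow> bool" where
  "discrete_space V Ng \<longleftrightarrow>
     (\<exists>b :: nat \<Rightarrow> real^3 \<Rightarrow> real.
        (\<forall>k<Ng. b k \<in> H1) \<and>
        (\<forall>c :: nat \<Rightarrow> real. (AE r in lborel. (\<Sum>k<Ng. c k * b k r) = 0) \<longrightarrow> (\<forall>k<Ng. c k = 0)) \<and>
        V = {v. \<exists>c :: nat \<Rightarrow> real. v = (\<lambda>r. \<Sum>k<Ng. c k * b k r)})"

definition cls :: "'n::finite orbitals \<Rightarrow> 'n orbitals set" where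
  "cls U = {tmul U P | P. orthogonal_matrix P}"

definition cdist :: "'n::finite orbitals \<Rightarrow> 'n orbitals \<Rightarrow> real" where
  "cdist U W = (INF P\<in>{P. orthogonal_matrix P}. tnorm (U - tmul W P))"

definition tuple_ball ::
  "(real^3 \<Rightarrow> real) set \<Rightarrow> 'n::finite orbitals \<Rightarrow> real \<Rightarrow> 'n orbitals set" where
  "tuple_ball V U \<delta> = {W \<in> tuples V. tnorm (U - W) \<le> \<delta>}"

definition class_ball ::
  "(real^3 \<Rightarrow> real) set \<Rightarrow> 'n::finite orbitals \<Rightarrow> real \<Rightarrow> 'n orbitals set set" where
  "class_ball V U \<delta> = {cls W | W. W \<in> tuples V \<inter> stiefel \<and> cdist U W \<le> \<delta>}"

text \<open>Closure of a set of orbits in the discrete Grassmannian with the metric \<^const>\<open>cdist\<close>.\<close>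

definition class_closure ::
  "(real^3 \<Rightarrow> real) set \<Rightarrow> 'n::finite orbitals set set \<Rightarrow> 'n orbitals set set" where
  "class_closure V S = {cls W | W. W \<in> tuples V \<inter> stiefel \<and>
     (\<forall>\<epsilon>>0. \<exists>W' \<in> tuples V \<inter> stiefel. cls W' \<in> S \<and> cdist W W' < \<epsilon>)}"

definition electron_density :: "'n::finite orbitals \<Rightarrow> real^3 \<Rightarrow> real" where
  "electron_density U r = 2 * (\<Sum>i\<in>UNIV. (U i r)\<^sup>2)"

definition hartree_potential :: "(real^3 \<Rightarrow> real) \<Rightarrow> real^3 \<Rightarrow> real" where
  "hartree_potential \<rho> r = (LINT r'|lborel. \<rho> r' / dist r r')"

text \<open>
  The exchange-correlation energy per particle and its potential are arbitrary (possibly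
  nonlocal) maps from densities to functions. The local density approximation is the special
  case \<open>\<lambda>\<rho> r. \<epsilon> (\<rho> r)\<close> for a function \<open>\<epsilon> :: real \<Rightarrow> real\<close>.
\<close>

type_synonym density_map = "(real^3 \<Rightarrow> real) \<Rightarrow> (real^3 \<Rightarrow> real)"

definition xc_energy :: "density_map \<Rightarrow> (real^3 \<Rightarrow> real) \<Rightarrow> real" where
  "xc_energy exc \<rho> = (LINT r|lborel. exc \<rho> r * \<rho> r)"

definition energy ::
  "(real^3 \<Rightarrow> real) \<Rightarrow> density_map \<Rightarrow> 'n::finite orbitals \<Rightarrow> real" where
  "energy Vext exc U =
     (\<Sum>i\<in>UNIV. LINT r|lborel. (norm (weak_grad (U i) r))\<^sup>2)
     + (LINT r|lborel. Vext r * electron_density U r)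
     + 1/2 * (LINT r|lborel. LINT r'|lborel. electron_density U r * electron_density U r' / dist r r')
     + xc_energy exc (electron_density U)"

text \<open>
  \<open>vxc\<close> is the functional derivative of the exchange-correlation energy with respect to the
  density at \<open>\<rho>\<^sub>U\<close>, for the density variations produced by orbital variations in \<open>V\<close>.
\<close>

definition has_xc_potential ::
  "(real^3 \<Rightarrow> real) set \<Rightarrow> density_map \<Rightarrow> density_map \<Rightarrow> 'n::finite orbitals \<Rightarrow> bool" where
  "has_xc_potential V exc vxc U \<longleftrightarrow>
     (\<forall>v\<in>V. \<forall>w\<in>V. integrable lborel (\<lambda>r. vxc (electron_density U) r * v r * w r)) \<and>
     (\<forall>\<epsilon>>0. \<exists>\<delta>>0. \<forall>W\<in>tuples V. tnorm W < \<delta> \<longrightarrow>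
        \<bar>xc_energy exc (electron_density (U + W)) - xc_energy exc (electron_density U)
          - (LINT r|lborel. vxc (electron_density U) r * (electron_density (U + W) r - electron_density U r))\<bar>
        \<le> \<epsilon> * tnorm W)"

definition is_energy_gradient ::
  "(real^3 \<Rightarrow> real) set \<Rightarrow> (real^3 \<Rightarrow> real) \<Rightarrow> density_map \<Rightarrow>
     'n::finite orbitals \<Rightarrow> 'n orbitals \<Rightarrow> bool" where
  "is_energy_gradient V Vext vxc U G \<longleftrightarrow> G \<in> tuples V \<and>
     (\<forall>i. \<forall>v\<in>V. l2_inner (G i) v =
        4 * (1/2 * l2_inner (weak_grad (U i)) (weak_grad v)
             + l2_inner (\<lambda>r. Vext r * U i r) v
             + l2_inner (\<lambda>r. hartree_potential (electron_density U) r * U i r) v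
             + l2_inner (\<lambda>r. vxc (electron_density U) r * U i r) v))"

definition energy_gradient ::
  "(real^3 \<Rightarrow> real) set \<Rightarrow> (real^3 \<Rightarrow> real) \<Rightarrow> density_map \<Rightarrow>
     'n::finite orbitals \<Rightarrow> 'n orbitals" where
  "energy_gradient V Vext vxc U = (THE G. is_energy_gradient V Vext vxc U G)"

definition grassmann_gradient ::
  "(real^3 \<Rightarrow> real) set \<Rightarrow> (real^3 \<Rightarrow> real) \<Rightarrow> density_map \<Rightarrow>
     'n::finite orbitals \<Rightarrow> 'n orbitals" where
  "grassmann_gradient V Vext vxc U =
     tmul (energy_gradient V Vext vxc U) (gram U U)
     - tmul U (gram U (energy_gradient V Vext vxc U))"

definition critical_point ::
  "(real^3 \<Rightarrow> real) set \<Rightarrow> (real^3 \<Rightarrow> real) \<Rightarrow> density_map \<Rightarrow> 'n::finite orbitals \<Rightarrow> bool" where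
  "critical_point V Vext vxc U \<longleftrightarrow>
     U \<in> tuples V \<inter> stiefel \<and> grassmann_gradient V Vext vxc U = 0"

definition local_minimizer ::
  "(real^3 \<Rightarrow> real) set \<Rightarrow> (real^3 \<Rightarrow> real) \<Rightarrow> density_map \<Rightarrow> 'n::finite orbitals \<Rightarrow> bool" where
  "local_minimizer V Vext exc U \<longleftrightarrow>
     U \<in> tuples V \<inter> stiefel \<and>
     (\<exists>r>0. \<forall>W \<in> tuples V \<inter> stiefel. cls W \<in> class_ball V U r \<longrightarrow>
        energy Vext exc U \<le> energy Vext exc W)"

definition tcontinuous_on :: "'n::finite orbitals set \<Rightarrow> ('n orbitals \<Rightarrow> 'n orbitals) \<Rightarrow> bool" where
  "tcontinuous_on S F \<longleftrightarrow>
     (\<forall>U\<in>S. \<forall>\<epsilon>>0. \<exists>\<eta>>0. \<forall>W\<in>S. tnorm (W - U) < \<eta> \<longrightarrow> tnorm (F W - F U) < \<epsilon>)"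

definition gradient_flow ::
  "(real^3 \<Rightarrow> real) set \<Rightarrow> (real^3 \<Rightarrow> real) \<Rightarrow> density_map \<Rightarrow>
     'n::finite orbitals \<Rightarrow> (real \<Rightarrow> 'n orbitals) \<Rightarrow> bool" where
  "gradient_flow V Vext vxc U0 U \<longleftrightarrow>
     (\<forall>t\<ge>0. U t \<in> tuples V) \<and>
     U 0 = U0 \<and>
     ((\<lambda>t. tnorm (U t - U0)) \<longlongrightarrow> 0) (at_right 0) \<and>
     (\<forall>t>0. ((\<lambda>h. tnorm ((\<lambda>i r. (U (t + h) i r - U t i r) / h)
                          - (- grassmann_gradient V Vext vxc (U t)))) \<longlongrightarrow> 0) (at 0))"

end

theory Submission
  imports Defs
begin

text \<open>
  Along the flow the Gram matrix is constant: its derivative is, up to sign, \<open>K + K\<^sup>T\<close> for the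
  commutator \<open>K\<close> of two symmetric matrices, which is skew. So the flow stays on the Stiefel manifold,
  and there the energy has derivative \<open>- |||\<nabla>\<^sub>G E(U)|||\<^sup>2\<close>. An interior minimizer of the energy
  on the closed ball of radius \<open>\<delta>\<^sub>1\<close> is critical, hence equivalent to \<open>Ustar\<close>; with
  \<open>E(Ustar) \<le> E0\<close> this makes \<open>Ustar\<close> a global minimizer on that ball. The flow cannot leave the
  ball of radius \<open>\<delta>\<^sub>2\<close>: at the exit time its energy would be at least \<open>E0\<close> but also at most \<open>E1\<close>,
  so it would be an interior minimizer and lie at distance 0. Since the energy is bounded
  below, the gradient is arbitrarily small at arbitrarily late times, and by compactness a
  subsequence of such times converges to a critical point, that is to the class of \<open>Ustar\<close>. Hence
  the energy tends to \<open>E(Ustar)\<close>, every limit point of the flow is a minimizer, and the remaining two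
  limits follow by compactness and by the continuity of the Grassmann gradient, which the orthogonal
  invariance transports from the ball around \<open>Ustar\<close> to its whole orbit.
\<close>

section \<open>Uniqueness of weak gradients\<close>

text \<open>The main obstacle is analytic: the energy gradient is given by a formula, and everything
  rests on its being the Frechet gradient of the energy on V. The kinetic term is built on
  \<open>weak_grad\<close>, a choice, so even its quadratic character needs weak gradients to be
  unique, and uniqueness needs enough smooth compactly supported functions. These are built from
  one-dimensional functions of the type exp(-c/s). Equality almost everywhere is turned into
  equality by an orthonormal basis with a pointwise expansion; its coordinates supply compactness
  and bounds for bilinear forms. Near the minimizer a margin matters: the minimum \<open>E0\<close>
  is attained, so the annulus is nonempty and \<open>\<delta>\<^sub>2 < \<delta>\<^sub>1\<close>.
  This gap keeps the limit points of the flow away from the edge of the ball on which the gradient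
  is continuous. The case in which \<open>E0\<close> equals the energy of \<open>Ustar\<close> is
  allowed, so energy values alone do not forbid an exit; it is excluded because the exit point would
  be at distance 0 and at distance \<open>\<delta>\<^sub>2\<close> at once.\<close>

lemma C_k_add:
  "C_k k f \<Longrightarrow> C_k k g \<Longrightarrow> C_k k (\<lambda>x. f x + g x)"
proof (induction k arbitrary: f g)
  case 0
  then show ?case by (auto intro!: continuous_intros)
next
  case (Suc k)
  then obtain df dg where "\<And>x. GDERIV f x :> df x" "\<And>i. C_k k (\<lambda>x. df x $ i)"
    "\<And>x. GDERIV g x :> dg x" "\<And>i. C_k k (\<lambda>x. dg x $ i)" by auto
  then show ?case
    using Suc.IH by (auto intro!: exI[of _ "\<lambda>x. df x + dg x"] GDERIV_add)
qed

lemma C_k_const: "C_k k (\<lambda>x. c)"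
proof (induction k arbitrary: c)
  case (Suc k)
  then show ?case by (auto intro!: exI[of _ "\<lambda>x. 0"] GDERIV_const)
qed auto

lemma C_k_SucD: "C_k (Suc k) f \<Longrightarrow> C_k k f"
proof (induction k arbitrary: f)
  case 0
  then show ?case
    by (auto simp: gderiv_def continuous_on_eq_continuous_at intro: has_derivative_continuous)
next
  case (Suc k)
  from Suc.prems obtain df where "\<And>x. GDERIV f x :> df x" "\<And>i. C_k (Suc k) (\<lambda>x. df x $ i)"
    unfolding C_k.simps(2)[of "Suc k"] by blast
  moreover from this have "C_k k (\<lambda>x. df x $ i)" for i by (intro Suc.IH)
  ultimately show ?case unfolding C_k.simps by blast
qed

lemma C_k_mult:
  "C_k k f \<Longrightarrow> C_k k g \<Longrightarrow> C_k k (\<lambda>x. f x * g x)"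
proof (induction k arbitrary: f g)
  case 0
  then show ?case by (auto intro!: continuous_intros)
next
  case (Suc k)
  then obtain df dg where *: "\<And>x. GDERIV f x :> df x" "\<And>i. C_k k (\<lambda>x. df x $ i)"
    "\<And>x. GDERIV g x :> dg x" "\<And>i. C_k k (\<lambda>x. dg x $ i)" by auto
  \<comment> \<open>The product rule keeps one factor undifferentiated, so f and g themselves must
    have regularity k.\<close>
  moreover have "C_k k f" "C_k k g" using Suc.prems C_k_SucD by blast+
  ultimately show ?case
    using Suc.IH by (auto intro!: exI[of _ "\<lambda>x. f x *\<^sub>R dg x + g x *\<^sub>R df x"] GDERIV_mult C_k_add)
qed

lemma C_k_prod:
  "finite I \<Longrightarrow> (\<And>i. i \<in> I \<Longrightarrow> C_k k (f i)) \<Longrightarrow> C_k k (\<lambda>x. \<Prod>i\<in>I. f i x)"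
  by (induction I rule: finite_induct) (auto intro: C_k_const C_k_mult)

section \<open>Smooth flat functions and bumps on boxes\<close>

definition flat :: "real \<Rightarrow> nat \<Rightarrow> real \<Rightarrow> real" where
  "flat c m s = (if s > 0 then (1 / s) ^ m * exp (- (c / s)) else 0)"

text \<open>The substitution x = c / s turns this into the decay of x^m / exp x at infinity. It is
  the reason why all derivatives match at the junction point 0.\<close>

lemma flat_tendsto_0:
  assumes "c > 0"
  shows "(flat c m \<longlongrightarrow> 0) (at_right 0)"
proof -
  have "((\<lambda>x. x ^ m / exp x) \<longlongrightarrow> 0) (at_top :: real filter)"
    by (rule tendsto_power_div_exp_0)
  moreover have "filterlim (\<lambda>s. c / s) at_top (at_right 0)"
    using filterlim_tendsto_pos_mult_at_top[OF tendsto_const assms filterlim_inverse_at_top_right]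
    by (simp add: divide_inverse)
  ultimately have "((\<lambda>s. (c / s) ^ m / exp (c / s)) \<longlongrightarrow> 0) (at_right 0)"
    by (rule filterlim_compose)
  then have "((\<lambda>s. (1 / c ^ m) * ((c / s) ^ m / exp (c / s))) \<longlongrightarrow> (1 / c ^ m) * 0) (at_right 0)"
    by (intro tendsto_intros)
  then show ?thesis
    by (rule filterlim_cong[THEN iffD1, rotated -1])
       (use assms in \<open>auto intro!: eventually_mono[OF eventually_at_right_less] simp: flat_def exp_minus field_simps\<close>)
qed

text \<open>Differentiation raises the exponent of \<open>1 / s\<close> by 1 or 2, so the family
  over all m is closed under it; the parameter m exists for this purpose.\<close>

lemma flat_has_derivative:
  assumes c: "c > 0"
  shows "(flat c m has_real_derivative (- real m * flat c (m+1) s + c * flat c (m+2) s)) (at s)"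
proof -
  consider "s > 0" | "s < 0" | "s = 0" by linarith
  then show ?thesis
  proof cases
    case 1
    have "((\<lambda>s. (1 / s) ^ m * exp (- (c / s))) has_real_derivative
       (- real m * flat c (m+1) s + c * flat c (m+2) s)) (at s)"
    proof (cases m)
      case 0
      with 1 show ?thesis
        by (auto intro!: derivative_eq_intros simp: flat_def field_simps power2_eq_square)
    next
      case (Suc n)
      have "((\<lambda>s. (1 / s) ^ Suc n * exp (- (c / s))) has_real_derivative
        real (Suc n) * (1 / s) ^ n * (- 1 / s\<^sup>2) * exp (- (c / s)) + (1 / s) ^ Suc n * (exp (- (c / s)) * (c / s\<^sup>2))) (at s)"
      proof (rule DERIV_cong[OF DERIV_mult])
        show "((\<lambda>s. (1 / s) ^ Suc n) has_real_derivative real (Suc n) * (- 1 / s\<^sup>2 * (1 / s) ^ n)) (at s)"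
        proof -
          have "((\<lambda>s. 1 / s) has_real_derivative - 1 / s\<^sup>2) (at s)"
            using 1 by (auto intro!: derivative_eq_intros simp: power2_eq_square)
          from DERIV_power[OF this, of "Suc n"] show ?thesis by simp
        qed
        show "((\<lambda>s. exp (- (c / s))) has_real_derivative exp (- (c / s)) * (c / s\<^sup>2)) (at s)"
          using 1 by (auto intro!: derivative_eq_intros simp: power2_eq_square)
      qed (simp add: algebra_simps add_divide_distrib)
      with 1 Suc show ?thesis
        by (simp add: flat_def power2_eq_square field_simps)
    qed
    then show ?thesis
      by (rule has_field_derivative_transform_within_open[where S="{0<..}"]) (use 1 in \<open>auto simp: flat_def\<close>)
  next
    case 2
    have "((\<lambda>s::real. 0::real) has_real_derivative 0) (at s)" by simp
    then have "(flat c m has_real_derivative 0) (at s)"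
      by (rule has_field_derivative_transform_within_open[where S="{..<0}"]) (use 2 in \<open>auto simp: flat_def\<close>)
    with 2 show ?thesis by (simp add: flat_def)
  next
    case 3
    \<comment> \<open>To the right of 0 the difference quotient of \<open>flat c m\<close> is
      \<open>flat c (Suc m)\<close>.\<close>
    have r: "((\<lambda>h. flat c m h / h) \<longlongrightarrow> 0) (at_right 0)"
      by (rule Lim_transform_eventually[OF flat_tendsto_0[OF c, of "Suc m"]])
         (auto intro!: eventually_mono[OF eventually_at_right_less] simp: flat_def)
    have l: "((\<lambda>h. flat c m h / h) \<longlongrightarrow> 0) (at_left 0)"
      by (rule Lim_transform_eventually[OF tendsto_const])
         (auto simp: flat_def eventually_at_filter)
    have "((\<lambda>h. flat c m h / h) \<longlongrightarrow> 0) (at 0)"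
      using l r by (simp add: filterlim_at_split)
    then show ?thesis using 3 by (simp add: DERIV_def flat_def)
  qed
qed

text \<open>The gradient is a combination of members of the same family with larger m, so the
  induction must keep m arbitrary. The slope s will be 1 or -1, one for each of the two faces of a
  box orthogonal to axis i.\<close>

lemma C_k_flat:
  assumes c: "c > 0"
  shows "C_k k (\<lambda>x. flat c m (s * x $ i + d))"
proof (induction k arbitrary: m)
  case 0
  have "isCont (flat c m) y" for y using flat_has_derivative[OF c] by (rule DERIV_isCont)
  then have "continuous_on UNIV (flat c m)" by (simp add: continuous_on_eq_continuous_at)
  then show ?case by (auto intro!: continuous_on_compose2[of UNIV "flat c m"] continuous_intros)
next
  case (Suc k)
  have lin: "GDERIV (\<lambda>x::real^3. s * x $ i + d) x :> s *\<^sub>R axis i 1" for x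
    unfolding gderiv_def by (rule derivative_eq_intros bounded_linear.has_derivative[OF bounded_linear_vec_nth] refl)+ (simp add: inner_axis fun_eq_iff)
  let ?D = "\<lambda>x::real^3. - real m * flat c (m+1) (s * x $ i + d) + c * flat c (m+2) (s * x $ i + d)"
  have "GDERIV (\<lambda>x. flat c m (s * x $ i + d)) x :> ?D x *\<^sub>R (s *\<^sub>R axis i 1)" for x
    by (rule GDERIV_DERIV_compose[OF lin flat_has_derivative[OF c]])
  moreover have "C_k k (\<lambda>x. (?D x *\<^sub>R (s *\<^sub>R axis i 1)) $ j)" for j
    by (simp only: vector_scaleR_component real_scaleR_def)
       (intro C_k_mult C_k_add C_k_const Suc.IH)
  ultimately show ?case unfolding C_k.simps by (intro exI[of _ "\<lambda>x. ?D x *\<^sub>R (s *\<^sub>R axis i 1)"]) blast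
qed

text \<open>One flat factor per face, so the product is positive exactly on the open box. The terms
  \<open>1 *\<close>, \<open>(-1) *\<close> and \<open>+ (- (a $ i))\<close> give each factor the
  literal shape of \<open>C_k_flat\<close>.\<close>

definition box_bump :: "real \<Rightarrow> real^3 \<Rightarrow> real^3 \<Rightarrow> real^3 \<Rightarrow> real" where
  "box_bump c a b x = (\<Prod>i\<in>UNIV. flat c 0 (1 * x $ i + (- (a $ i))) * flat c 0 ((-1) * x $ i + b $ i))"

lemma box_bump_eq:
  "box_bump c a b x = (if x \<in> box a b then exp (- c * (\<Sum>i\<in>UNIV. 1 / (x $ i - a $ i) + 1 / (b $ i - x $ i))) else 0)"
proof (cases "x \<in> box a b")
  case True
  then show ?thesis
    by (auto simp: box_bump_def flat_def mem_box_cart exp_sum sum_distrib_left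
      exp_add[symmetric] algebra_simps simp flip: exp_minus intro!: prod.cong)
next
  case False
  then obtain i where "\<not> (a $ i < x $ i \<and> x $ i < b $ i)" by (auto simp: mem_box_cart)
  then have "flat c 0 (1 * x $ i + (- (a $ i))) * flat c 0 ((-1) * x $ i + b $ i) = 0"
    by (auto simp: flat_def)
  then have "box_bump c a b x = 0" unfolding box_bump_def by (intro prod_zero) auto
  with False show ?thesis by simp
qed

lemma test_function_box_bump:
  assumes "c > 0" shows "test_function (box_bump c a b)"
proof -
  have "C_k k (box_bump c a b)" for k
    unfolding box_bump_def using assms by (intro C_k_prod C_k_mult C_k_flat) auto
  moreover have "box_bump c a b x = 0" if "x \<notin> cbox a b" for x
    using that box_subset_cbox[of a b] by (auto simp: box_bump_eq)
  ultimately show ?thesis unfolding test_function_def by (meson compact_cbox)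
qed

text \<open>\<open>ennreal\<close> cuts off negative values, so the densities of g and of -g are the
  positive and the negative part of g. Vanishing box integrals make the two measures agree on boxes,
  which generate the Borel sets and are stable under intersection. Hence both parts agree almost
  everywhere, and at most one of them is nonzero at a point.\<close>

lemma AE_zero_if_box_integrals_zero:
  fixes g :: "'a::euclidean_space \<Rightarrow> real"
  assumes g: "g \<in> borel_measurable lborel"
    and int: "\<And>a b. integrable lborel (\<lambda>x. indicator (box a b) x * g x)"
    and zero: "\<And>a b. (LINT x|lborel. indicator (box a b) x * g x) = 0"
  shows "AE x in lborel. g x = 0"
proof -
  let ?N = "\<lambda>g. density lborel (\<lambda>x. ennreal (g x))"
  have em: "emeasure (?N f) (box a b) = (\<integral>\<^sup>+x. ennreal (indicator (box a b) x * f x) \<partial>lborel)"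
    if "f \<in> borel_measurable lborel" for f a b
    using that by (subst emeasure_density) (auto intro!: nn_integral_cong simp: indicator_def)
  have fin: "emeasure (?N f) (box a b) \<noteq> \<infinity>" if "f = g \<or> f = (\<lambda>x. - g x)" for f a b
  proof -
    have "integrable lborel (\<lambda>x. indicator (box a b) x * f x)"
      using that int[of a b] by auto
    then show ?thesis
      using that g by (subst em) (auto dest: integrableD(2) simp: real_integrable_def)
  qed
  have eq: "emeasure (?N g) (box a b) = emeasure (?N (\<lambda>x. - g x)) (box a b)" for a b
  proof -
    have "enn2real (emeasure (?N g) (box a b)) = enn2real (emeasure (?N (\<lambda>x. - g x)) (box a b))"
      using real_lebesgue_integral_def[OF int[of a b]] zero[of a b] g by (simp add: em)
    with fin[of g a b] fin[of "\<lambda>x. - g x" a b] show ?thesis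
      by (metis ennreal_enn2real infinity_ennreal_def less_top)
  qed
  have "?N g = ?N (\<lambda>x. - g x)"
  proof (rule measure_eqI_generator_eq[where E="range (\<lambda>(a, b). box a b)" and \<Omega>=UNIV
        and A="\<lambda>n. box (- (real n *\<^sub>R One)) (real n *\<^sub>R One)"])
    show "Int_stable (range (\<lambda>(a, b). box a b :: 'a set))"
      by (auto simp: Int_stable_def box_Int_box)
    show "\<And>X. X \<in> range (\<lambda>(a, b). box a b) \<Longrightarrow> emeasure (?N g) X = emeasure (?N (\<lambda>x. - g x)) X"
      using eq by auto
    show "sets (?N g) = sigma_sets UNIV (range (\<lambda>(a, b). box a b))"
      "sets (?N (\<lambda>x. - g x)) = sigma_sets UNIV (range (\<lambda>(a, b). box a b))"
      by (simp_all add: borel_eq_box)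
    show "(\<Union>n. box (- (real n *\<^sub>R One)) (real n *\<^sub>R One :: 'a)) = UNIV"
      by (rule UN_box_eq_UNIV)
  qed (use fin in auto)
  then have "AE x in lborel. ennreal (g x) = ennreal (- g x)"
    using g by (subst (asm) sigma_finite_measure.density_unique_iff) (auto intro: sigma_finite_lborel)
  then show ?thesis
    by eventually_elim (metis add.inverse_inverse ennreal_eq_0_iff ennreal_neg linorder_linear neg_0_le_iff_le order_antisym_conv)
qed

section \<open>Square-integrable functions\<close>

lemma L2_D:
  "f \<in> L2 \<Longrightarrow> f \<in> borel_measurable borel" "f \<in> L2 \<Longrightarrow> integrable lborel (\<lambda>x. (norm (f x))\<^sup>2)"
  by (auto simp: L2_def)

lemma integrable_norm_mult_L2:
  fixes f :: "real^3 \<Rightarrow> 'b::euclidean_space" and g :: "real^3 \<Rightarrow> 'c::euclidean_space"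
  assumes "f \<in> L2" "g \<in> L2"
  shows "integrable lborel (\<lambda>x. norm (f x) * norm (g x))"
proof (rule Bochner_Integration.integrable_bound)
  show "integrable lborel (\<lambda>x. (norm (f x))\<^sup>2 + (norm (g x))\<^sup>2)"
    using L2_D(2)[OF assms(1)] L2_D(2)[OF assms(2)] by simp
  have "norm a * norm b \<le> (norm a)\<^sup>2 + (norm b)\<^sup>2" for a :: 'b and b :: 'c
    using sum_squares_bound[of "norm a" "norm b"] mult_nonneg_nonneg[of "norm a" "norm b"]
    by (auto simp del: mult_nonneg_nonneg)
  then show "AE x in lborel. norm (norm (f x) * norm (g x)) \<le> norm ((norm (f x))\<^sup>2 + (norm (g x))\<^sup>2)"
    by (simp add: abs_mult)
  show "(\<lambda>x. norm (f x) * norm (g x)) \<in> borel_measurable lborel"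
    using L2_D(1)[OF assms(1)] L2_D(1)[OF assms(2)] by measurable
qed

lemma integrable_inner_L2:
  fixes f g :: "real^3 \<Rightarrow> 'b::euclidean_space"
  assumes "f \<in> L2" "g \<in> L2"
  shows "integrable lborel (\<lambda>x. f x \<bullet> g x)"
proof (rule Bochner_Integration.integrable_bound[OF integrable_norm_mult_L2[OF assms]])
  show "(\<lambda>x. f x \<bullet> g x) \<in> borel_measurable lborel"
    using L2_D(1)[OF assms(1)] L2_D(1)[OF assms(2)] by measurable
qed (auto simp: Cauchy_Schwarz_ineq2 abs_mult)

lemma integrable_scaleR_L2:
  fixes f :: "real^3 \<Rightarrow> real" and g :: "real^3 \<Rightarrow> 'b::euclidean_space"
  assumes "f \<in> L2" "g \<in> L2"
  shows "integrable lborel (\<lambda>x. f x *\<^sub>R g x)"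
proof (rule Bochner_Integration.integrable_bound[OF integrable_norm_mult_L2[OF assms]])
  show "(\<lambda>x. f x *\<^sub>R g x) \<in> borel_measurable lborel"
    using L2_D(1)[OF assms(1)] L2_D(1)[OF assms(2)] by measurable
qed (auto simp: abs_mult)

lemma L2_lincomb:
  fixes f g :: "real^3 \<Rightarrow> 'b::euclidean_space"
  assumes "f \<in> L2" "g \<in> L2"
  shows "(\<lambda>x. a *\<^sub>R f x + b *\<^sub>R g x) \<in> L2"
proof -
  have m: "(\<lambda>x. a *\<^sub>R f x + b *\<^sub>R g x) \<in> borel_measurable lborel"
    using L2_D(1)[OF assms(1)] L2_D(1)[OF assms(2)] by measurable
  have "(\<lambda>x. (norm (a *\<^sub>R f x + b *\<^sub>R g x))\<^sup>2) =
    (\<lambda>x. a\<^sup>2 * (norm (f x))\<^sup>2 + b\<^sup>2 * (norm (g x))\<^sup>2 + (2 * a * b) * (f x \<bullet> g x))"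
    unfolding power2_norm_eq_inner
    by (simp add: inner_add_left inner_add_right inner_commute power2_eq_square algebra_simps)
  moreover have "integrable lborel \<dots>"
    using L2_D(2)[OF assms(1)] L2_D(2)[OF assms(2)] integrable_inner_L2[OF assms] by simp
  ultimately show ?thesis using m by (simp add: L2_def)
qed

lemma compact_support_L2:
  fixes f :: "real^3 \<Rightarrow> 'b::euclidean_space"
  assumes "continuous_on UNIV f" and "compact K" and "\<And>x. x \<notin> K \<Longrightarrow> f x = 0"
  shows "f \<in> L2"
proof -
  have "integrable lborel (\<lambda>x. indicator K x *\<^sub>R (norm (f x))\<^sup>2)"
    using assms by (intro borel_integrable_compact continuous_intros) (auto intro: continuous_on_subset)
  also have "(\<lambda>x. indicator K x *\<^sub>R (norm (f x))\<^sup>2) = (\<lambda>x. (norm (f x))\<^sup>2)"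
    using assms(3) by (auto simp: indicator_def fun_eq_iff)
  finally show ?thesis
    using assms(1) by (auto simp: L2_def intro: borel_measurable_continuous_onI)
qed

lemma GDERIV_unique: "GDERIV f x :> D \<Longrightarrow> GDERIV f x :> D' \<Longrightarrow> D = D'"
  using has_derivative_unique[of f "\<lambda>h. h \<bullet> D" x "\<lambda>h. h \<bullet> D'"] vector_eq_ldot[of D D']
  by (auto simp: gderiv_def fun_eq_iff)

lemma test_function_L2:
  assumes "test_function \<phi>"
  shows "\<phi> \<in> L2" "(\<And>x. GDERIV \<phi> x :> d\<phi> x) \<Longrightarrow> d\<phi> \<in> L2"
proof -
  obtain K where C: "\<And>k. C_k k \<phi>" and K: "compact K" "\<And>x. x \<notin> K \<Longrightarrow> \<phi> x = 0"
    using assms by (auto simp: test_function_def)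
  show "\<phi> \<in> L2"
    using C[of 0] K compact_support_L2 by auto
  assume d: "\<And>x. GDERIV \<phi> x :> d\<phi> x"
  from C[of 1] obtain g where g: "\<And>x. GDERIV \<phi> x :> g x" "\<And>i. continuous_on UNIV (\<lambda>x. g x $ i)"
    by (auto simp: numeral_eq_Suc)
  have "g = d\<phi>" using d g(1) GDERIV_unique by blast
  have "continuous_on UNIV (\<lambda>x. \<chi> i. g x $ i)"
    by (intro continuous_on_vec_lambda g)
  then have "continuous_on UNIV d\<phi>" using \<open>g = d\<phi>\<close> by simp
  moreover have "d\<phi> x = 0" if "x \<notin> K" for x
  proof -
    have "GDERIV \<phi> x :> 0"
      unfolding gderiv_def
      by (rule has_derivative_transform_within_open[where s="- K" and f="\<lambda>x. 0"])
         (use that K in \<open>auto simp: compact_imp_closed open_Compl\<close>)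
    with d show ?thesis using GDERIV_unique by blast
  qed
  ultimately show "d\<phi> \<in> L2" using K(1) compact_support_L2 by blast
qed

section \<open>Weak gradients: linearity and uniqueness\<close>

lemma is_weak_gradient_lincomb:
  assumes "u \<in> L2" "v \<in> L2" "f \<in> L2" "g \<in> L2" "is_weak_gradient u f" "is_weak_gradient v g"
  shows "is_weak_gradient (\<lambda>x. a * u x + b * v x) (\<lambda>x. a *\<^sub>R f x + b *\<^sub>R g x)"
  unfolding is_weak_gradient_def
proof (intro allI impI, elim conjE)
  fix \<phi> d\<phi> assume \<phi>: "test_function \<phi>" "\<forall>x. GDERIV \<phi> x :> d\<phi> x"
  then have L: "\<phi> \<in> L2" "d\<phi> \<in> L2" using test_function_L2 by blast+
  have "(LINT x|lborel. (a * u x + b * v x) *\<^sub>R d\<phi> x) =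
      (LINT x|lborel. a *\<^sub>R (u x *\<^sub>R d\<phi> x) + b *\<^sub>R (v x *\<^sub>R d\<phi> x))"
    by (simp add: scaleR_add_left)
  also have "\<dots> = a *\<^sub>R (LINT x|lborel. u x *\<^sub>R d\<phi> x) + b *\<^sub>R (LINT x|lborel. v x *\<^sub>R d\<phi> x)"
    by (subst Bochner_Integration.integral_add)
       (use assms L in \<open>simp_all del: scaleR_scaleR add: integrable_scaleR_L2\<close>)
  also have "\<dots> = - (a *\<^sub>R (LINT x|lborel. \<phi> x *\<^sub>R f x) + b *\<^sub>R (LINT x|lborel. \<phi> x *\<^sub>R g x))"
    using assms(5,6) \<phi> by (auto simp: is_weak_gradient_def)
  also have "\<dots> = - (LINT x|lborel. a *\<^sub>R (\<phi> x *\<^sub>R f x) + b *\<^sub>R (\<phi> x *\<^sub>R g x))"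
    by (subst Bochner_Integration.integral_add)
       (use assms L in \<open>simp_all del: scaleR_scaleR add: integrable_scaleR_L2\<close>)
  also have "\<dots> = - (LINT x|lborel. \<phi> x *\<^sub>R (a *\<^sub>R f x + b *\<^sub>R g x))"
    by (simp add: scaleR_add_right mult.commute)
  finally show "(LINT x|lborel. (a * u x + b * v x) *\<^sub>R d\<phi> x) = - (LINT x|lborel. \<phi> x *\<^sub>R (a *\<^sub>R f x + b *\<^sub>R g x))" .
qed

lemma H1_lincomb:
  assumes "u \<in> H1" "v \<in> H1"
  shows "(\<lambda>x. a * u x + b * v x) \<in> H1"
proof -
  from assms obtain f g where "f \<in> L2" "g \<in> L2" "is_weak_gradient u f" "is_weak_gradient v g"
    "u \<in> L2" "v \<in> L2" by (auto simp: H1_def)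
  then show ?thesis
    using is_weak_gradient_lincomb[of u v f g a b] L2_lincomb[of f g a b] L2_lincomb[of u v a b]
    unfolding H1_def real_scaleR_def by blast
qed

lemma weak_grad:
  assumes "u \<in> H1" shows "weak_grad u \<in> L2" "is_weak_gradient u (weak_grad u)"
proof -
  have "\<exists>g. g \<in> L2 \<and> is_weak_gradient u g" using assms by (auto simp: H1_def)
  from someI_ex[OF this] show "weak_grad u \<in> L2" "is_weak_gradient u (weak_grad u)"
    by (auto simp: weak_grad_def)
qed

text \<open>As \<open>c\<close> decreases to 0, the bumps increase to the indicator of the box.\<close>

lemma AE_zero_if_orthogonal_test_functions:
  fixes g :: "real^3 \<Rightarrow> real"
  assumes g: "g \<in> L2" and zero: "\<And>\<phi>. test_function \<phi> \<Longrightarrow> (LINT x|lborel. \<phi> x * g x) = 0"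
  shows "AE x in lborel. g x = 0"
proof (rule AE_zero_if_box_integrals_zero)
  show gm: "g \<in> borel_measurable lborel" using L2_D(1)[OF g] by simp
  fix a b :: "real^3"
  have "(\<lambda>x. (norm (indicator (box a b) x :: real))\<^sup>2) = (indicator (box a b) :: real^3 \<Rightarrow> real)"
    by (auto simp: indicator_def)
  then have "(indicator (box a b) :: real^3 \<Rightarrow> real) \<in> L2"
    using emeasure_lborel_box_finite[of a b] by (simp add: L2_def)
  from integrable_scaleR_L2[OF this g]
  show int: "integrable lborel (\<lambda>x. indicator (box a b) x * g x)" by simp
  let ?\<phi> = "\<lambda>n. box_bump (1 / Suc n) a b"
  have "(\<lambda>n. LINT x|lborel. ?\<phi> n x * g x) \<longlonglongrightarrow> (LINT x|lborel. indicator (box a b) x * g x)"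
  proof (rule integral_dominated_convergence[where w="\<lambda>x. norm (indicator (box a b) x * g x)"])
    show "(\<lambda>x. ?\<phi> n x * g x) \<in> borel_measurable lborel" for n
      using gm L2_D(1)[OF test_function_L2(1)[OF test_function_box_bump, of "1 / Suc n" a b]] by simp
    show "AE x in lborel. (\<lambda>n. ?\<phi> n x * g x) \<longlonglongrightarrow> indicator (box a b) x * g x"
    proof (rule AE_I2)
      fix x
      have "(\<lambda>n. exp (- (1 / real (Suc n)) * s)) \<longlonglongrightarrow> exp (- 0 * s)" for s
        using LIMSEQ_inverse_real_of_nat by (intro tendsto_intros) (simp add: divide_inverse)
      then have "(\<lambda>n. ?\<phi> n x) \<longlonglongrightarrow> indicator (box a b) x"
        by (auto simp: box_bump_eq indicator_def)
      then show "(\<lambda>n. ?\<phi> n x * g x) \<longlonglongrightarrow> indicator (box a b) x * g x"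
        by (intro tendsto_intros)
    qed
    show "AE x in lborel. norm (?\<phi> n x * g x) \<le> norm (indicator (box a b) x * g x)" for n
    proof (rule AE_I2)
      fix x
      have "\<bar>?\<phi> n x\<bar> \<le> indicator (box a b) x"
      proof (cases "x \<in> box a b")
        case True
        then have "0 \<le> (\<Sum>i\<in>UNIV. 1 / (x $ i - a $ i) + 1 / (b $ i - x $ i))"
          by (intro sum_nonneg) (auto simp: mem_box_cart less_imp_le)
        with True show ?thesis by (simp add: box_bump_eq)
      qed (simp add: box_bump_eq)
      then show "norm (?\<phi> n x * g x) \<le> norm (indicator (box a b) x * g x)"
        by (simp add: abs_mult mult_right_mono)
    qed
    show "integrable lborel (\<lambda>x. norm (indicator (box a b) x * g x))" using int by auto
  qed (use gm in auto)
  then show "(LINT x|lborel. indicator (box a b) x * g x) = 0"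
    using zero[OF test_function_box_bump] by (simp add: LIMSEQ_const_iff)
qed

text \<open>Both candidates have the same integral against every test function, so each component of
  their difference is orthogonal to all test functions. Working with components reduces the claim to
  the scalar case.\<close>

lemma is_weak_gradient_unique:
  assumes "f \<in> L2" "g \<in> L2" "is_weak_gradient u f" "is_weak_gradient u g"
  shows "AE x in lborel. f x = g x"
proof -
  have comp: "AE x in lborel. (f x - g x) $ i = 0" for i
  proof (rule AE_zero_if_orthogonal_test_functions)
    have L: "(\<lambda>x. f x - g x) \<in> L2" using L2_lincomb[OF assms(1,2), of 1 "-1"] by simp
    have "(\<lambda>x. (f x - g x) $ i) \<in> borel_measurable lborel"
      using borel_measurable_inner[OF measurable_const L2_D(1)[OF L], of "axis i 1" ] by (simp add: inner_axis')
    moreover have "integrable lborel (\<lambda>x. (norm ((f x - g x) $ i))\<^sup>2)"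
    proof (rule Bochner_Integration.integrable_bound[OF L2_D(2)[OF L]])
      have "norm ((norm (y $ i))\<^sup>2) \<le> norm ((norm y)\<^sup>2)" for y :: "real^3"
        using power_mono[OF component_le_norm_cart[of y i], of 2] by simp
      then show "AE x in lborel. norm ((norm ((f x - g x) $ i))\<^sup>2) \<le> norm ((norm (f x - g x))\<^sup>2)"
        by blast
      show "(\<lambda>x. (norm ((f x - g x) $ i))\<^sup>2) \<in> borel_measurable lborel"
        using calculation by measurable
    qed
    ultimately show "(\<lambda>x. (f x - g x) $ i) \<in> L2" by (simp add: L2_def)
    fix \<phi> assume \<phi>: "test_function \<phi>"
    then have "C_k (Suc 0) \<phi>" by (simp only: test_function_def)
    then obtain d\<phi> where d: "\<forall>x. GDERIV \<phi> x :> d\<phi> x" unfolding C_k.simps(2) by metis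
    have i: "integrable lborel (\<lambda>x. \<phi> x *\<^sub>R f x)" "integrable lborel (\<lambda>x. \<phi> x *\<^sub>R g x)"
      using assms \<phi> test_function_L2 integrable_scaleR_L2 by blast+
    have "(LINT x|lborel. \<phi> x *\<^sub>R f x) = (LINT x|lborel. \<phi> x *\<^sub>R g x)"
      using assms(3,4)[unfolded is_weak_gradient_def, rule_format, OF conjI, OF \<phi> d] by simp
    then have "(LINT x|lborel. \<phi> x *\<^sub>R f x - \<phi> x *\<^sub>R g x) = 0" using i by simp
    then have "axis i 1 \<bullet> (LINT x|lborel. \<phi> x *\<^sub>R f x - \<phi> x *\<^sub>R g x) = 0" by simp
    then show "(LINT x|lborel. \<phi> x * (f x - g x) $ i) = 0"
      using i by (subst (asm) integral_inner_right[symmetric]) (auto simp: inner_axis' algebra_simps)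
  qed
  have "AE x in lborel. \<forall>i. (f x - g x) $ i = 0" using comp by (simp add: AE_all_countable)
  then show ?thesis by eventually_elim (auto simp: vec_eq_iff)
qed

text \<open>Since \<open>weak_grad\<close> is a choice, linearity comes from uniqueness and holds
  almost everywhere, which is enough under integrals. This makes the kinetic energy a quadratic
  form.\<close>

lemma weak_grad_lincomb:
  assumes "u \<in> H1" "v \<in> H1"
  shows "AE x in lborel. weak_grad (\<lambda>x. a * u x + b * v x) x = a *\<^sub>R weak_grad u x + b *\<^sub>R weak_grad v x"
proof (rule is_weak_gradient_unique)
  have "u \<in> L2" "v \<in> L2" using assms by (auto simp: H1_def)
  then show "is_weak_gradient (\<lambda>x. a * u x + b * v x) (\<lambda>x. a *\<^sub>R weak_grad u x + b *\<^sub>R weak_grad v x)"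
    using assms weak_grad by (intro is_weak_gradient_lincomb) auto
qed (use assms weak_grad H1_lincomb in \<open>auto intro: L2_lincomb\<close>)

section \<open>Orthonormal bases\<close>

lemma lincomb_L2:
  fixes f g :: "real^3 \<Rightarrow> real"
  shows "f \<in> L2 \<Longrightarrow> g \<in> L2 \<Longrightarrow> (\<lambda>x. a * f x + b * g x) \<in> L2"
  using L2_lincomb[of f g a b] by simp

lemma zero_L2: "(\<lambda>x. 0 :: real) \<in> L2"
  by (simp add: L2_def)

lemma l2_inner_commute: "l2_inner f g = l2_inner g f"
  by (simp add: l2_inner_def inner_commute)

lemma l2_inner_add_left:
  assumes "f \<in> L2" "g \<in> L2" "h \<in> L2"
  shows "l2_inner (\<lambda>x. a *\<^sub>R f x + b *\<^sub>R g x) h = a * l2_inner f h + b * l2_inner g h"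
proof -
  have "l2_inner (\<lambda>x. a *\<^sub>R f x + b *\<^sub>R g x) h = (LINT x|lborel. a * (f x \<bullet> h x) + b * (g x \<bullet> h x))"
    by (simp add: l2_inner_def inner_add_left)
  also have "\<dots> = a * l2_inner f h + b * l2_inner g h"
    unfolding l2_inner_def using assms integrable_inner_L2
    by (subst Bochner_Integration.integral_add) auto
  finally show ?thesis .
qed

lemma l2_inner_lincomb_left:
  fixes f g :: "real^3 \<Rightarrow> real"
  assumes "f \<in> L2" "g \<in> L2" "h \<in> L2"
  shows "l2_inner (\<lambda>x. a * f x + b * g x) h = a * l2_inner f h + b * l2_inner g h"
  using l2_inner_add_left[OF assms, of a b] by simp

lemma l2_inner_self_nonneg: "0 \<le> l2_inner f f"
  by (simp add: l2_inner_def)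

lemma l2_inner_self_eq_0:
  fixes f :: "real^3 \<Rightarrow> real"
  assumes "f \<in> L2" "l2_inner f f = 0" shows "AE x in lborel. f x = 0"
proof -
  have "AE x in lborel. f x \<bullet> f x = 0"
    using assms integrable_inner_L2[OF assms(1,1)]
    by (subst integral_nonneg_eq_0_iff_AE[symmetric]) (auto simp: l2_inner_def)
  then show ?thesis by simp
qed

lemma L2_sum:
  fixes f :: "'k \<Rightarrow> real^3 \<Rightarrow> real"
  assumes "finite K" "\<And>k. k \<in> K \<Longrightarrow> f k \<in> L2"
  shows "(\<lambda>x. \<Sum>k\<in>K. c k * f k x) \<in> L2"
  using assms
proof (induction K rule: finite_induct)
  case (insert k K)
  then show ?case using lincomb_L2[of "f k" "\<lambda>x. \<Sum>k\<in>K. c k * f k x" "c k" 1] by simp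
qed (simp add: zero_L2)

lemma l2_inner_sum_left:
  fixes f :: "'k \<Rightarrow> real^3 \<Rightarrow> real"
  assumes "finite K" "\<And>k. k \<in> K \<Longrightarrow> f k \<in> L2" "g \<in> L2"
  shows "l2_inner (\<lambda>x. \<Sum>k\<in>K. c k * f k x) g = (\<Sum>k\<in>K. c k * l2_inner (f k) g)"
  using assms
proof (induction K rule: finite_induct)
  case (insert k K)
  then show ?case
    using l2_inner_lincomb_left[of "f k" "\<lambda>x. \<Sum>k\<in>K. c k * f k x" g "c k" 1] L2_sum[of K f c] by simp
qed (simp add: l2_inner_def)

definition lin_span :: "(nat \<Rightarrow> real^3 \<Rightarrow> real) \<Rightarrow> nat \<Rightarrow> (real^3 \<Rightarrow> real) set" where
  "lin_span b n = {v. \<exists>c. v = (\<lambda>x. \<Sum>k<n. c k * b k x)}"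

lemma lin_span_lincomb:
  assumes "u \<in> lin_span b n" "v \<in> lin_span b n"
  shows "(\<lambda>x. \<alpha> * u x + \<beta> * v x) \<in> lin_span b n"
proof -
  from assms obtain c d where "u = (\<lambda>x. \<Sum>k<n. c k * b k x)" "v = (\<lambda>x. \<Sum>k<n. d k * b k x)"
    by (auto simp: lin_span_def)
  then show ?thesis unfolding lin_span_def
    by (auto intro!: exI[of _ "\<lambda>k. \<alpha> * c k + \<beta> * d k"]
        simp: sum_distrib_left sum.distrib algebra_simps)
qed

lemma lin_span_zero: "(\<lambda>x. 0) \<in> lin_span b n"
  unfolding lin_span_def by (auto intro!: exI[of _ "\<lambda>k. 0"])

lemma lin_span_sum:
  assumes "finite K" "\<And>k. k \<in> K \<Longrightarrow> f k \<in> lin_span b n"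
  shows "(\<lambda>x. \<Sum>k\<in>K. c k * f k x) \<in> lin_span b n"
  using assms
proof (induction K rule: finite_induct)
  case (insert k K)
  then show ?case
    using lin_span_lincomb[of "f k" b n "\<lambda>x. \<Sum>k\<in>K. c k * f k x" "c k" 1] by simp
qed (simp add: lin_span_zero)

lemma lin_span_mono: "lin_span b n \<subseteq> lin_span b (Suc n)"
proof
  fix v assume "v \<in> lin_span b n"
  then obtain c where "v = (\<lambda>x. \<Sum>k<n. c k * b k x)" by (auto simp: lin_span_def)
  then have "v = (\<lambda>x. \<Sum>k<Suc n. (if k < n then c k else 0) * b k x)" by auto
  then show "v \<in> lin_span b (Suc n)"
    unfolding lin_span_def by (intro CollectI exI[of _ "\<lambda>k. if k < n then c k else 0"])
qed

text \<open>Independence is stated almost everywhere because the norm of a residual sees no null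
  sets. The expansion nevertheless holds at every point: v is a pointwise combination of the b k,
  and so is each new basis function.\<close>

lemma gram_schmidt:
  assumes "\<And>k. k < n \<Longrightarrow> b k \<in> L2"
    and "\<And>c. (AE x in lborel. (\<Sum>k<n. c k * b k x) = 0) \<Longrightarrow> \<forall>k<n. c k = 0"
  shows "\<exists>e. (\<forall>k<n. e k \<in> lin_span b n) \<and>
    (\<forall>j<n. \<forall>k<n. l2_inner (e j) (e k) = (if j = k then 1 else 0)) \<and>
    (\<forall>v \<in> lin_span b n. v = (\<lambda>x. \<Sum>k<n. l2_inner v (e k) * e k x))"
  using assms
proof (induction n)
  case 0
  then show ?case by (auto simp: lin_span_def)
next
  case (Suc n)
  have ind: "\<forall>k<n. c k = 0" if "AE x in lborel. (\<Sum>k<n. c k * b k x) = 0" for c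
    using Suc.prems(2)[of "\<lambda>k. if k < n then c k else 0"] that by (auto split: if_splits)
  have bk: "b k \<in> L2" if "k < n" for k using that Suc.prems(1) by simp
  from Suc.IH[OF bk ind] obtain e where e: "\<And>k. k < n \<Longrightarrow> e k \<in> lin_span b n"
    and on: "\<And>j k. j < n \<Longrightarrow> k < n \<Longrightarrow> l2_inner (e j) (e k) = (if j = k then 1 else 0)"
    and ex: "\<And>v. v \<in> lin_span b n \<Longrightarrow> v = (\<lambda>x. \<Sum>k<n. l2_inner v (e k) * e k x)"
    by blast
  have L2: "v \<in> L2" if "v \<in> lin_span b n" for v
    using that Suc.prems(1) unfolding lin_span_def by (auto intro!: L2_sum)
  have eL2: "e k \<in> L2" if "k < n" for k using that e L2 by blast
  have bL2: "b n \<in> L2" using Suc.prems by blast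
  define p where "p = (\<lambda>x. \<Sum>j<n. l2_inner (b n) (e j) * e j x)"
  have p: "p \<in> lin_span b n" unfolding p_def using e by (auto intro!: lin_span_sum)
  define r where "r = (\<lambda>x. b n x - p x)"
  have rL2: "r \<in> L2" using lincomb_L2[OF bL2 L2[OF p], of 1 "-1"] by (simp add: r_def)
  have re: "l2_inner r (e j) = 0" if j: "j < n" for j
  proof -
    have "l2_inner p (e j) = (\<Sum>k<n. l2_inner (b n) (e k) * l2_inner (e k) (e j))"
      unfolding p_def using eL2 j by (intro l2_inner_sum_left) auto
    also have "\<dots> = (\<Sum>k<n. if k = j then l2_inner (b n) (e k) else 0)"
      using on j by (intro sum.cong) auto
    also have "\<dots> = l2_inner (b n) (e j)" using j by simp
    finally show ?thesis
      using l2_inner_lincomb_left[OF bL2 L2[OF p] eL2[OF j], of 1 "-1"] by (simp add: r_def)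
  qed
  have rw: "l2_inner w r = 0" if w: "w \<in> lin_span b n" for w
  proof -
    have "l2_inner w r = l2_inner (\<lambda>x. \<Sum>k<n. l2_inner w (e k) * e k x) r"
      using ex[OF w] by simp
    also have "\<dots> = (\<Sum>k<n. l2_inner w (e k) * l2_inner (e k) r)"
      using eL2 rL2 by (intro l2_inner_sum_left) auto
    also have "\<dots> = 0" using re by (simp add: l2_inner_commute)
    finally show ?thesis .
  qed
  define s where "s = sqrt (l2_inner r r)"
  \<comment> \<open>A residual of norm 0 would be an almost everywhere vanishing combination of the
    b k in which b n has coefficient 1.\<close>
  have r0: "l2_inner r r \<noteq> 0"
  proof
    assume "l2_inner r r = 0"
    then have "AE x in lborel. r x = 0" using rL2 l2_inner_self_eq_0 by blast
    moreover obtain c where "p = (\<lambda>x. \<Sum>k<n. c k * b k x)" using p by (auto simp: lin_span_def)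
    then have "r = (\<lambda>x. \<Sum>k<Suc n. (if k < n then - c k else 1) * b k x)"
      by (auto simp: r_def sum_negf)
    ultimately have "AE x in lborel. (\<Sum>k<Suc n. (if k < n then - c k else 1) * b k x) = 0" by metis
    from Suc.prems(2)[OF this] show False by auto
  qed
  then have s: "s > 0" "s * s = l2_inner r r"
    using l2_inner_self_nonneg[of r] by (auto simp: s_def)
  \<comment> \<open>The term \<open>0 * r x\<close> gives the normalized residual the shape of a
    two-term combination, to which the linearity lemmas apply directly.\<close>
  define e' where "e' = e(n := (\<lambda>x. (1 / s) * r x + 0 * r x))"
  have e'L: "e' k = e k" if "k < n" for k using that by (simp add: e'_def)
  have e'n: "e' n = (\<lambda>x. (1 / s) * r x + 0 * r x)" by (simp add: e'_def)
  have e'nL2: "e' n \<in> L2" unfolding e'n by (rule lincomb_L2[OF rL2 rL2])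
  have in_e'n: "l2_inner w (e' n) = (1 / s) * l2_inner w r" if "w \<in> L2" for w
    unfolding e'n using l2_inner_lincomb_left[OF rL2 rL2 that, of "1/s" 0] by (simp add: l2_inner_commute)
  have sub: "lin_span b n \<subseteq> lin_span b (Suc n)" by (rule lin_span_mono)
  have "b n = (\<lambda>x. \<Sum>k<Suc n. (if k = n then 1 else 0) * b k x)" by auto
  then have bn: "b n \<in> lin_span b (Suc n)"
    unfolding lin_span_def by (intro CollectI exI[of _ "\<lambda>k. if k = n then 1 else 0"])
  have rS: "r \<in> lin_span b (Suc n)"
    using lin_span_lincomb[OF bn subsetD[OF sub p], of 1 "-1"] by (simp add: r_def)
  show ?case
  proof (intro exI[of _ e'] conjI allI impI ballI)
    fix k assume "k < Suc n"
    then show "e' k \<in> lin_span b (Suc n)"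
      using e e'L sub lin_span_lincomb[OF rS rS, of "1/s" 0] by (cases "k = n") (auto simp: e'n)
  next
    fix j k assume jk: "j < Suc n" "k < Suc n"
    have nn: "l2_inner (e' n) (e' n) = 1"
      using in_e'n[OF e'nL2] in_e'n[OF rL2] s r0 by (simp add: l2_inner_commute[of "e' n" r] field_simps)
    have jn: "l2_inner (e j) (e' n) = 0" if "j < n" for j
      using in_e'n[OF eL2[OF that]] rw[OF e[OF that]] by simp
    show "l2_inner (e' j) (e' k) = (if j = k then 1 else 0)"
      using jk nn jn[of j] jn[of k] on[of j k] e'L[of j] e'L[of k]
      by (cases "j = n"; cases "k = n") (auto simp: l2_inner_commute less_Suc_eq)
  next
    fix v assume "v \<in> lin_span b (Suc n)"
    then obtain c where c: "v = (\<lambda>x. \<Sum>k<Suc n. c k * b k x)" by (auto simp: lin_span_def)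
    \<comment> \<open>Substituting b n = p + r splits v into a part w in the old span and the
      multiple c n of r.\<close>
    define w where "w = (\<lambda>x. 1 * (\<Sum>k<n. c k * b k x) + c n * p x)"
    have w: "w \<in> lin_span b n"
      unfolding w_def by (rule lin_span_lincomb[OF _ p]) (auto simp: lin_span_def)
    have v: "v = (\<lambda>x. 1 * w x + c n * r x)"
      unfolding c w_def r_def by (auto simp: algebra_simps)
    have wL2: "w \<in> L2" using L2[OF w] .
    have "l2_inner v (e' k) = l2_inner w (e k)" if "k < n" for k
      using l2_inner_lincomb_left[OF wL2 rL2 eL2[OF that], of 1 "c n"] re[OF that] e'L[OF that] v by simp
    moreover have "l2_inner v (e' n) = c n * s"
    proof -
      have "l2_inner r (e' n) = s" using in_e'n[OF rL2] s(1) unfolding s(2)[symmetric] by simp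
      then show ?thesis
        using l2_inner_lincomb_left[OF wL2 rL2 e'nL2, of 1 "c n"] in_e'n[OF wL2] rw[OF w]
        unfolding v by simp
    qed
    ultimately have "(\<Sum>k<Suc n. l2_inner v (e' k) * e' k x) = (\<Sum>k<n. l2_inner w (e k) * e k x) + c n * r x" for x
      using e'L s by (simp add: e'n)
    then show "v = (\<lambda>x. \<Sum>k<Suc n. l2_inner v (e' k) * e' k x)"
      using fun_cong[OF ex[OF w]] v by simp
  qed
qed

locale orthonormal_space =
  fixes V :: "(real^3 \<Rightarrow> real) set" and e :: "nat \<Rightarrow> real^3 \<Rightarrow> real" and m :: nat
  assumes V_H1: "V \<subseteq> H1"
    and V_lincomb: "\<And>u v a b. u \<in> V \<Longrightarrow> v \<in> V \<Longrightarrow> (\<lambda>x. a * u x + b * v x) \<in> V"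
    and V_zero: "(\<lambda>x. 0) \<in> V"
    and e_in: "\<And>k. k < m \<Longrightarrow> e k \<in> V"
    and orthonormal: "\<And>j k. j < m \<Longrightarrow> k < m \<Longrightarrow> l2_inner (e j) (e k) = (if j = k then 1 else 0)"
    and expand: "\<And>v. v \<in> V \<Longrightarrow> v = (\<lambda>x. \<Sum>k<m. l2_inner v (e k) * e k x)"

lemma discrete_space_orthonormal:
  assumes "discrete_space V Ng"
  obtains e where "orthonormal_space V e Ng"
proof -
  from assms obtain b where b: "\<And>k. k < Ng \<Longrightarrow> b k \<in> H1"
    and ind: "\<And>c. (AE x in lborel. (\<Sum>k<Ng. c k * b k x) = 0) \<Longrightarrow> \<forall>k<Ng. c k = 0"
    and V: "V = lin_span b Ng"
    unfolding discrete_space_def lin_span_def by blast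
  from b have bL2: "b k \<in> L2" if "k < Ng" for k using that by (auto simp: H1_def)
  from gram_schmidt[where b=b and n=Ng, OF bL2 ind] obtain e where e: "\<forall>k<Ng. e k \<in> V"
    "\<forall>j<Ng. \<forall>k<Ng. l2_inner (e j) (e k) = (if j = k then 1 else 0)"
    "\<forall>v \<in> V. v = (\<lambda>x. \<Sum>k<Ng. l2_inner v (e k) * e k x)"
    unfolding V by blast
  have zero: "(\<lambda>x. 0) \<in> H1"
  proof -
    have "(\<lambda>x::real^3. 0::real^3) \<in> L2" by (simp add: L2_def)
    moreover have "is_weak_gradient (\<lambda>x. 0) (\<lambda>x. 0)" by (simp add: is_weak_gradient_def)
    ultimately show ?thesis using zero_L2 unfolding H1_def by blast
  qed
  have "(\<lambda>x. \<Sum>k\<in>K. c k * b k x) \<in> H1" if "finite K" "\<forall>k\<in>K. b k \<in> H1" for K c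
    using that
  proof (induction K rule: finite_induct)
    case (insert k K)
    then show ?case using H1_lincomb[of "b k" "\<lambda>x. \<Sum>k\<in>K. c k * b k x" "c k" 1] by simp
  qed (simp add: zero)
  then have "V \<subseteq> H1" using b by (auto simp: V lin_span_def)
  with e have "orthonormal_space V e Ng"
    by unfold_locales (auto simp: V intro: lin_span_lincomb lin_span_zero)
  then show thesis by (rule that)
qed

section \<open>Tuples of orbitals\<close>

lemma tinner_eq: "tinner U W = (\<Sum>i\<in>UNIV. l2_inner (U i) (W i))"
  by (simp add: tinner_def gram_def trace_def)

lemma tinner_commute: "tinner U W = tinner W U"
  by (simp add: tinner_eq l2_inner_commute)

lemma tinner_self_nonneg: "0 \<le> tinner U U"
  by (simp add: tinner_eq l2_inner_self_nonneg sum_nonneg)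

lemma tnorm_nonneg: "0 \<le> tnorm U"
  by (simp add: tnorm_def tinner_self_nonneg)

lemma tnorm_power2: "(tnorm U)\<^sup>2 = tinner U U"
  by (simp add: tnorm_def tinner_self_nonneg)

lemma tnorm_zero [simp]: "tnorm 0 = 0"
  by (simp add: tnorm_def tinner_eq l2_inner_def zero_fun_def)

text \<open>Sums, differences and negatives of tuples are all instances of this shape, so linearity
  is proved for it alone.\<close>

abbreviation tcomb :: "real \<Rightarrow> 'n orbitals \<Rightarrow> real \<Rightarrow> 'n orbitals \<Rightarrow> 'n orbitals" where
  "tcomb a U b W \<equiv> (\<lambda>i x. a * U i x + b * W i x)"

lemma tuple_add_eq: "U + W = tcomb 1 U 1 W"
  and tuple_diff_eq: "U - W = tcomb 1 U (-1) W"
  and tuple_uminus_eq: "- U = tcomb (-1) U 0 U" for U W :: "'n orbitals"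
  by (simp_all add: fun_eq_iff)

lemma tnorm_uminus: "tnorm (- U) = tnorm U"
  by (simp add: tnorm_def tinner_eq l2_inner_def)

lemma tnorm_minus_commute: "tnorm (U - W) = tnorm (W - U)"
  using tnorm_uminus[of "U - W"] by simp

context orthonormal_space
begin

lemma V_L2: "v \<in> V \<Longrightarrow> v \<in> L2"
  using V_H1 by (auto simp: H1_def)

lemma V_sum: "finite K \<Longrightarrow> (\<And>k. k \<in> K \<Longrightarrow> f k \<in> V) \<Longrightarrow> (\<lambda>x. \<Sum>k\<in>K. c k * f k x) \<in> V"
proof (induction K rule: finite_induct)
  case (insert k K)
  then show ?case using V_lincomb[of "f k" "\<lambda>x. \<Sum>k\<in>K. c k * f k x" "c k" 1] by simp
qed (simp add: V_zero)

text \<open>Norm 0 gives v = 0 only almost everywhere, but then all coordinates of v vanish, and the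
  pointwise expansion yields v = 0 everywhere. So the L2 norm is a genuine norm on V.\<close>

lemma V_eq_0:
  assumes "v \<in> V" "l2_inner v v = 0" shows "v = 0"
proof -
  have v0: "AE x in lborel. v x = 0" using assms V_L2 l2_inner_self_eq_0 by blast
  have "l2_inner v w = 0" for w
    unfolding l2_inner_def using v0 by (subst integral_eq_zero_AE) auto
  then show ?thesis using expand[OF assms(1)] by (simp add: zero_fun_def)
qed

lemma parseval:
  assumes "u \<in> V" "v \<in> V"
  shows "l2_inner u v = (\<Sum>k<m. l2_inner u (e k) * l2_inner v (e k))"
proof -
  have "l2_inner u v = l2_inner (\<lambda>x. \<Sum>k<m. l2_inner u (e k) * e k x) v" using expand[OF assms(1)] by simp
  also have "\<dots> = (\<Sum>k<m. l2_inner u (e k) * l2_inner (e k) v)"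
    using V_L2 assms e_in by (intro l2_inner_sum_left) auto
  finally show ?thesis by (simp add: l2_inner_commute)
qed

section \<open>Coordinates and the norm of tuples\<close>

definition coord :: "'n::finite orbitals \<Rightarrow> 'n \<times> nat \<Rightarrow> real" where
  "coord U = (\<lambda>(i, k). l2_inner (U i) (e k))"

abbreviation coord_set :: "('n::finite \<times> nat) set" where
  "coord_set \<equiv> UNIV \<times> {..<m}"

lemma tinner_coord:
  "U \<in> tuples V \<Longrightarrow> W \<in> tuples V \<Longrightarrow> tinner U W = (\<Sum>p\<in>coord_set. coord U p * coord W p)"
  by (simp add: tinner_eq tuples_def parseval coord_def sum.cartesian_product case_prod_unfold)

lemma tnorm_coord: "U \<in> tuples V \<Longrightarrow> tnorm U = L2_set (coord U) coord_set"
  by (simp add: tnorm_def tinner_coord L2_set_def power2_eq_square)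

lemma tuples_tcomb: "U \<in> tuples V \<Longrightarrow> W \<in> tuples V \<Longrightarrow> tcomb a U b W \<in> tuples V"
  by (simp add: tuples_def V_lincomb)

lemma tuples_add: "U \<in> tuples V \<Longrightarrow> W \<in> tuples V \<Longrightarrow> U + W \<in> tuples V"
  and tuples_diff: "U \<in> tuples V \<Longrightarrow> W \<in> tuples V \<Longrightarrow> U - W \<in> tuples V"
  and tuples_uminus: "U \<in> tuples V \<Longrightarrow> - U \<in> tuples V"
  by (simp_all only: tuple_add_eq tuple_diff_eq tuple_uminus_eq[of U] tuples_tcomb)

lemma tuples_zero: "0 \<in> tuples V"
  using V_zero by (simp add: tuples_def zero_fun_def)

lemma tuples_tmul: "U \<in> tuples V \<Longrightarrow> tmul U P \<in> tuples V"
  by (auto simp: tuples_def tmul_def intro!: V_sum)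

lemma coord_tcomb:
  "U \<in> tuples V \<Longrightarrow> W \<in> tuples V \<Longrightarrow> p \<in> coord_set \<Longrightarrow>
    coord (tcomb a U b W) p = a * coord U p + b * coord W p"
  by (auto simp: coord_def tuples_def V_L2 e_in intro!: l2_inner_lincomb_left)

lemma tinner_tcomb_left:
  "U \<in> tuples V \<Longrightarrow> W \<in> tuples V \<Longrightarrow> X \<in> tuples V \<Longrightarrow>
    tinner (tcomb a U b W) X = a * tinner U X + b * tinner W X"
  by (simp add: tinner_coord tuples_tcomb coord_tcomb sum_distrib_left sum.distrib algebra_simps)

lemma tinner_tcomb_right:
  "U \<in> tuples V \<Longrightarrow> W \<in> tuples V \<Longrightarrow> X \<in> tuples V \<Longrightarrow>
    tinner X (tcomb a U b W) = a * tinner X U + b * tinner X W"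
  by (simp add: tinner_commute[of X] tinner_tcomb_left)

lemma tnorm_eq_0: "U \<in> tuples V \<Longrightarrow> tnorm U = 0 \<Longrightarrow> U = 0"
proof -
  assume U: "U \<in> tuples V" "tnorm U = 0"
  then have "U i = 0" for i
    by (intro V_eq_0) (auto simp: tnorm_def tinner_eq l2_inner_self_nonneg sum_nonneg_eq_0_iff tuples_def)
  then show "U = 0" by (simp add: fun_eq_iff)
qed

lemma tnorm_triangle:
  assumes "U \<in> tuples V" "W \<in> tuples V"
  shows "tnorm (U + W) \<le> tnorm U + tnorm W"
proof -
  have "tnorm (U + W) = L2_set (\<lambda>p. coord U p + coord W p) coord_set"
    unfolding tnorm_coord[OF tuples_add[OF assms]] unfolding tuple_add_eq
    using coord_tcomb[OF assms, where a=1 and b=1] by (intro L2_set_cong refl) simp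
  also have "\<dots> \<le> tnorm U + tnorm W"
    using assms by (simp add: tnorm_coord L2_set_triangle_ineq)
  finally show ?thesis .
qed

lemma tnorm_triangle_diff:
  assumes "U \<in> tuples V" "W \<in> tuples V" "X \<in> tuples V"
  shows "tnorm (U - X) \<le> tnorm (U - W) + tnorm (W - X)"
  using tnorm_triangle[of "U - W" "W - X"] assms by (simp add: tuples_diff)

lemma tnorm_scale:
  assumes "U \<in> tuples V"
  shows "tnorm (\<lambda>i x. c * U i x) = \<bar>c\<bar> * tnorm U"
proof -
  have "tinner (tcomb c U 0 U) (tcomb c U 0 U) = c\<^sup>2 * tinner U U"
    using assms unfolding tinner_tcomb_left[OF assms assms tuples_tcomb[OF assms assms]]
      tinner_tcomb_right[OF assms assms assms] by (simp add: power2_eq_square)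
  then show ?thesis by (simp add: tnorm_def real_sqrt_mult)
qed

section \<open>Norms and bilinear forms on single orbitals\<close>

definition vnorm :: "(real^3 \<Rightarrow> real) \<Rightarrow> real" where
  "vnorm v = sqrt (l2_inner v v)"

lemma vnorm_nonneg: "0 \<le> vnorm v"
  by (simp add: vnorm_def l2_inner_self_nonneg)

lemma vnorm_le_tnorm: "vnorm (U i) \<le> tnorm U"
  unfolding vnorm_def tnorm_def tinner_eq
  by (intro real_sqrt_le_mono member_le_sum) (auto simp: l2_inner_self_nonneg)

lemma vnorm_coord_le:
  assumes "v \<in> V" "k < m" shows "\<bar>l2_inner v (e k)\<bar> \<le> vnorm v"
proof -
  have "(l2_inner v (e k))\<^sup>2 \<le> (\<Sum>k<m. (l2_inner v (e k))\<^sup>2)"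
    using assms by (intro member_le_sum) auto
  also have "\<dots> = l2_inner v v" using parseval[OF assms(1,1)] by (simp add: power2_eq_square)
  finally show ?thesis unfolding vnorm_def by (metis real_sqrt_abs real_sqrt_le_mono)
qed

definition bilinear_on_V :: "((real^3 \<Rightarrow> real) \<Rightarrow> (real^3 \<Rightarrow> real) \<Rightarrow> real) \<Rightarrow> bool" where
  "bilinear_on_V B \<longleftrightarrow> (\<forall>u\<in>V. \<forall>v\<in>V. \<forall>w\<in>V. \<forall>a b.
     B (\<lambda>x. a * u x + b * v x) w = a * B u w + b * B v w \<and>
     B w (\<lambda>x. a * u x + b * v x) = a * B w u + b * B w v)"

lemma bilinear_left:
  "bilinear_on_V B \<Longrightarrow> u \<in> V \<Longrightarrow> v \<in> V \<Longrightarrow> w \<in> V \<Longrightarrow>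
    B (\<lambda>x. a * u x + b * v x) w = a * B u w + b * B v w"
  and bilinear_right:
  "bilinear_on_V B \<Longrightarrow> u \<in> V \<Longrightarrow> v \<in> V \<Longrightarrow> w \<in> V \<Longrightarrow>
    B w (\<lambda>x. a * u x + b * v x) = a * B w u + b * B w v"
  by (auto simp: bilinear_on_V_def)

lemma bilinear_zero:
  assumes "bilinear_on_V B" "w \<in> V"
  shows "B (\<lambda>x. 0) w = 0" "B w (\<lambda>x. 0) = 0"
  using bilinear_left[OF assms(1) V_zero V_zero assms(2), of 0 0]
    bilinear_right[OF assms(1) V_zero V_zero assms(2), of 0 0] by simp_all

lemma bilinear_sum_left:
  assumes B: "bilinear_on_V B" and "finite K" "\<And>k. k \<in> K \<Longrightarrow> f k \<in> V" "w \<in> V"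
  shows "B (\<lambda>x. \<Sum>k\<in>K. c k * f k x) w = (\<Sum>k\<in>K. c k * B (f k) w)"
  using assms(2-4)
proof (induction K rule: finite_induct)
  case (insert k K)
  then show ?case
    using bilinear_left[OF B, of "f k" "\<lambda>x. \<Sum>k\<in>K. c k * f k x" w "c k" 1] V_sum[of K f c] by simp
qed (simp add: bilinear_zero[OF B])

lemma bilinear_sum_right:
  assumes B: "bilinear_on_V B" and "finite K" "\<And>k. k \<in> K \<Longrightarrow> f k \<in> V" "w \<in> V"
  shows "B w (\<lambda>x. \<Sum>k\<in>K. c k * f k x) = (\<Sum>k\<in>K. c k * B w (f k))"
  using assms(2-4)
proof (induction K rule: finite_induct)
  case (insert k K)
  then show ?case
    using bilinear_right[OF B, of "f k" "\<lambda>x. \<Sum>k\<in>K. c k * f k x" w "c k" 1] V_sum[of K f c] by simp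
qed (simp add: bilinear_zero[OF B])

text \<open>On a finite-dimensional space every bilinear form is bounded: expand both arguments in
  the basis. One bound thus serves the kinetic, external, Hartree and exchange-correlation
  forms.\<close>

lemma bilinear_bound:
  assumes B: "bilinear_on_V B" and u: "u \<in> V" and v: "v \<in> V"
  shows "\<bar>B u v\<bar> \<le> (\<Sum>j<m. \<Sum>k<m. \<bar>B (e j) (e k)\<bar>) * vnorm u * vnorm v"
proof -
  have "B u v = B (\<lambda>x. \<Sum>j<m. l2_inner u (e j) * e j x) v" using expand[OF u] by simp
  also have "\<dots> = (\<Sum>j<m. l2_inner u (e j) * B (e j) v)"
    using B v e_in by (intro bilinear_sum_left) auto
  also have "\<dots> = (\<Sum>j<m. \<Sum>k<m. l2_inner u (e j) * (l2_inner v (e k) * B (e j) (e k)))"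
  proof (intro sum.cong refl)
    fix j assume "j \<in> {..<m}"
    then have "B (e j) (\<lambda>x. \<Sum>k<m. l2_inner v (e k) * e k x) = (\<Sum>k<m. l2_inner v (e k) * B (e j) (e k))"
      using B e_in by (intro bilinear_sum_right) auto
    then show "l2_inner u (e j) * B (e j) v = (\<Sum>k<m. l2_inner u (e j) * (l2_inner v (e k) * B (e j) (e k)))"
      using expand[OF v] by (simp add: sum_distrib_left)
  qed
  also have "\<bar>\<dots>\<bar> \<le> (\<Sum>j<m. \<Sum>k<m. \<bar>B (e j) (e k)\<bar> * (vnorm u * vnorm v))"
  proof (intro order_trans[OF sum_abs] sum_mono)
    fix j k assume "j \<in> {..<m}" "k \<in> {..<m}"
    then have "\<bar>l2_inner u (e j)\<bar> * \<bar>l2_inner v (e k)\<bar> \<le> vnorm u * vnorm v"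
      using u v vnorm_coord_le vnorm_nonneg by (intro mult_mono) auto
    from mult_right_mono[OF this, of "\<bar>B (e j) (e k)\<bar>"]
    show "\<bar>l2_inner u (e j) * (l2_inner v (e k) * B (e j) (e k))\<bar> \<le> \<bar>B (e j) (e k)\<bar> * (vnorm u * vnorm v)"
      by (simp add: abs_mult algebra_simps)
  qed
  finally show ?thesis by (simp only: sum_distrib_right[symmetric] mult.assoc)
qed

section \<open>Convergence and compactness of tuples\<close>

definition tlim :: "(nat \<Rightarrow> 'n::finite orbitals) \<Rightarrow> 'n orbitals \<Rightarrow> bool" where
  "tlim W L \<longleftrightarrow> (\<forall>k. W k \<in> tuples V) \<and> L \<in> tuples V \<and> (\<lambda>k. tnorm (W k - L)) \<longlonglongrightarrow> 0"

text \<open>Bolzano-Weierstrass in coordinates: finitely many bounded real sequences converge along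
  a common subsequence, and the basis assembles the limits into a tuple.\<close>

lemma bounded_tuples_convergent_subseq:
  fixes W :: "nat \<Rightarrow> 'n::finite orbitals"
  assumes W: "\<And>k. W k \<in> tuples V" and bd: "\<And>k. tnorm (W k) \<le> C"
  obtains r L where "strict_mono r" "tlim (W \<circ> r) L"
proof -
  \<comment> \<open>The default 0 outside \<open>coord_set\<close> makes every coordinate sequence
    bounded, whatever its index.\<close>
  define f where "f k = (\<lambda>p. if p \<in> coord_set then coord (W k) p else 0)" for k
  have bounded: "bounded (range (\<lambda>k. f k p))" for p
  proof -
    have "\<bar>f k p\<bar> \<le> \<bar>C\<bar>" for k
    proof (cases "p \<in> coord_set")
      case True
      then have "\<bar>coord (W k) p\<bar> \<le> tnorm (W k)"
        using W member_le_L2_set[of coord_set p "\<lambda>p. \<bar>coord (W k) p\<bar>"] by (simp add: tnorm_coord L2_set_def)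
      with True show ?thesis using bd[of k] by (simp add: f_def)
    qed (simp add: f_def)
    then show ?thesis by (auto simp: bounded_iff)
  qed
  have "\<exists>l r. strict_mono r \<and> (\<forall>\<epsilon>>0. eventually (\<lambda>n. \<forall>i\<in>coord_set. dist (f (r n) i) (l i) < \<epsilon>) sequentially)"
    using compact_lemma_general[of coord_set "\<lambda>x p. x p" f "\<lambda>x. x"] bounded
    by (simp only: image_image finite_SigmaI[OF finite_class.finite_UNIV finite_lessThan] simp_thms subset_refl)
  then obtain l r where r: "strict_mono r"
    and l: "\<And>\<epsilon>. \<epsilon> > 0 \<Longrightarrow> eventually (\<lambda>n. \<forall>p\<in>coord_set. dist (f (r n) p) (l p) < \<epsilon>) sequentially"
    by blast
  define L :: "'n orbitals" where "L = (\<lambda>i x. \<Sum>k<m. l (i, k) * e k x)"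
  have L: "L \<in> tuples V" unfolding tuples_def L_def using e_in by (auto intro!: V_sum)
  have cL: "coord L (i, k) = l (i, k)" if "k < m" for i k
  proof -
    have "coord L (i, k) = (\<Sum>j<m. l (i, j) * l2_inner (e j) (e k))"
      unfolding coord_def L_def prod.case using e_in V_L2 that by (intro l2_inner_sum_left) auto
    also have "\<dots> = (\<Sum>j<m. if j = k then l (i, k) else 0)"
      using orthonormal that by (intro sum.cong) auto
    finally show ?thesis using that by simp
  qed
  have "(\<lambda>n. tnorm (W (r n) - L)) \<longlonglongrightarrow> 0"
  proof -
    have "tnorm (W (r n) - L) = L2_set (\<lambda>p. coord (W (r n)) p - l p) coord_set" for n
      unfolding tnorm_coord[OF tuples_diff[OF W L]] unfolding tuple_diff_eq
      using coord_tcomb[OF W L, where a=1 and b="-1"] cL by (intro L2_set_cong refl) auto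
    moreover have "(\<lambda>n. coord (W (r n)) p) \<longlonglongrightarrow> l p" if p: "p \<in> coord_set" for p
      unfolding tendsto_iff
    proof (intro allI impI)
      fix \<epsilon> :: real assume "\<epsilon> > 0"
      from l[OF this] show "\<forall>\<^sub>F n in sequentially. dist (coord (W (r n)) p) (l p) < \<epsilon>"
        by eventually_elim (use p in \<open>auto simp: f_def\<close>)
    qed
    then have "(\<lambda>n. L2_set (\<lambda>p. coord (W (r n)) p - l p) coord_set) \<longlonglongrightarrow> L2_set (\<lambda>p. l p - l p) coord_set"
      unfolding L2_set_def by (intro tendsto_intros) auto
    ultimately show ?thesis by (simp add: L2_set_def)
  qed
  then have "tlim (W \<circ> r) L" using W L by (simp add: tlim_def)
  with r show thesis by (rule that)
qed

section \<open>Frechet derivatives for the norm \<open>tnorm\<close>, and a chain rule along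
  curves\<close>

definition frechet ::
  "('n::finite orbitals \<Rightarrow> real) \<Rightarrow> ('n orbitals \<Rightarrow> real) \<Rightarrow> 'n orbitals \<Rightarrow> bool" where
  "frechet F L U \<longleftrightarrow>
     (\<forall>W\<in>tuples V. \<forall>X\<in>tuples V. \<forall>a b. L (tcomb a W b X) = a * L W + b * L X) \<and>
     (\<exists>C. \<forall>W\<in>tuples V. \<bar>L W\<bar> \<le> C * tnorm W) \<and>
     (\<forall>\<epsilon>>0. \<exists>\<delta>>0. \<forall>W\<in>tuples V. tnorm W < \<delta> \<longrightarrow> \<bar>F (U + W) - F U - L W\<bar> \<le> \<epsilon> * tnorm W)"

lemma frechet_bound:
  assumes "frechet F L U"
  obtains C where "C \<ge> 0" "\<And>W. W \<in> tuples V \<Longrightarrow> \<bar>L W\<bar> \<le> C * tnorm W"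
proof -
  from assms obtain C where "\<forall>W\<in>tuples V. \<bar>L W\<bar> \<le> C * tnorm W" by (auto simp: frechet_def)
  then have "\<bar>L W\<bar> \<le> \<bar>C\<bar> * tnorm W" if "W \<in> tuples V" for W
    using that mult_right_mono[OF abs_ge_self[of C] tnorm_nonneg[of W]] by fastforce
  then show thesis using that[of "\<bar>C\<bar>"] by simp
qed

lemma frechet_remainder:
  assumes "frechet F L U" "\<epsilon> > 0"
  obtains \<delta> where "\<delta> > 0" "\<And>W. W \<in> tuples V \<Longrightarrow> tnorm W < \<delta> \<Longrightarrow> \<bar>F (U + W) - F U - L W\<bar> \<le> \<epsilon> * tnorm W"
  using assms unfolding frechet_def by blast

lemma frechet_add:
  assumes "frechet F L U" "frechet G M U"
  shows "frechet (\<lambda>W. F W + G W) (\<lambda>W. L W + M W) U"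
  unfolding frechet_def
proof (intro conjI allI impI ballI)
  fix W X :: "'a orbitals" and a b :: real assume "W \<in> tuples V" "X \<in> tuples V"
  then show "L (tcomb a W b X) + M (tcomb a W b X) = a * (L W + M W) + b * (L X + M X)"
    using assms unfolding frechet_def by (simp add: algebra_simps)
next
  obtain C where C: "\<And>W. W \<in> tuples V \<Longrightarrow> \<bar>L W\<bar> \<le> C * tnorm W" using frechet_bound[OF assms(1)] by blast
  obtain D where D: "\<And>W. W \<in> tuples V \<Longrightarrow> \<bar>M W\<bar> \<le> D * tnorm W" using frechet_bound[OF assms(2)] by blast
  have "\<bar>L W + M W\<bar> \<le> (C + D) * tnorm W" if "W \<in> tuples V" for W
    using C[OF that] D[OF that] by (simp add: distrib_right)
  then show "\<exists>C. \<forall>W\<in>tuples V. \<bar>L W + M W\<bar> \<le> C * tnorm W" by blast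
next
  fix \<epsilon> :: real assume "\<epsilon> > 0"
  then have "\<epsilon> / 2 > 0" by simp
  from frechet_remainder[OF assms(1) this] obtain \<delta> where \<delta>: "\<delta> > 0"
    "\<And>W. W \<in> tuples V \<Longrightarrow> tnorm W < \<delta> \<Longrightarrow> \<bar>F (U + W) - F U - L W\<bar> \<le> \<epsilon>/2 * tnorm W" by blast
  from frechet_remainder[OF assms(2) \<open>\<epsilon>/2 > 0\<close>] obtain \<eta> where \<eta>: "\<eta> > 0"
    "\<And>W. W \<in> tuples V \<Longrightarrow> tnorm W < \<eta> \<Longrightarrow> \<bar>G (U + W) - G U - M W\<bar> \<le> \<epsilon>/2 * tnorm W" by blast
  have "\<bar>F (U + W) + G (U + W) - (F U + G U) - (L W + M W)\<bar> \<le> \<epsilon> * tnorm W"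
    if "W \<in> tuples V" "tnorm W < min \<delta> \<eta>" for W
  proof -
    have "\<bar>F (U + W) - F U - L W\<bar> \<le> \<epsilon>/2 * tnorm W" "\<bar>G (U + W) - G U - M W\<bar> \<le> \<epsilon>/2 * tnorm W"
      using \<delta>(2)[of W] \<eta>(2)[of W] that by auto
    then show ?thesis by linarith
  qed
  then show "\<exists>\<delta>>0. \<forall>W\<in>tuples V. tnorm W < \<delta> \<longrightarrow>
      \<bar>F (U + W) + G (U + W) - (F U + G U) - (L W + M W)\<bar> \<le> \<epsilon> * tnorm W"
    using \<delta>(1) \<eta>(1) by (intro exI[of _ "min \<delta> \<eta>"]) auto
qed

lemma frechet_scale:
  assumes "frechet F L U" shows "frechet (\<lambda>W. c * F W) (\<lambda>W. c * L W) U"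
proof -
  obtain C where C: "\<And>W. W \<in> tuples V \<Longrightarrow> \<bar>L W\<bar> \<le> C * tnorm W" using frechet_bound[OF assms] by blast
  show ?thesis
    unfolding frechet_def
  proof (intro conjI allI impI ballI)
    fix W X :: "'a orbitals" and a b :: real assume "W \<in> tuples V" "X \<in> tuples V"
    then show "c * L (tcomb a W b X) = a * (c * L W) + b * (c * L X)"
      using assms unfolding frechet_def by (simp add: algebra_simps)
  next
    show "\<exists>C. \<forall>W\<in>tuples V. \<bar>c * L W\<bar> \<le> C * tnorm W"
      using C by (intro exI[of _ "\<bar>c\<bar> * C"]) (auto simp: abs_mult mult.assoc intro: mult_left_mono)
  next
    fix \<epsilon> :: real assume "\<epsilon> > 0"
    \<comment> \<open>The summand 1 covers c = 0.\<close>
    then have "\<epsilon> / (\<bar>c\<bar> + 1) > 0" by simp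
    from frechet_remainder[OF assms this] obtain \<delta> where \<delta>: "\<delta> > 0"
      "\<And>W. W \<in> tuples V \<Longrightarrow> tnorm W < \<delta> \<Longrightarrow> \<bar>F (U + W) - F U - L W\<bar> \<le> \<epsilon> / (\<bar>c\<bar> + 1) * tnorm W" by blast
    have "\<bar>c * F (U + W) - c * F U - c * L W\<bar> \<le> \<epsilon> * tnorm W" if "W \<in> tuples V" "tnorm W < \<delta>" for W
    proof -
      have "\<bar>c * F (U + W) - c * F U - c * L W\<bar> = \<bar>c\<bar> * \<bar>F (U + W) - F U - L W\<bar>"
        by (simp add: abs_mult[symmetric] algebra_simps)
      also have "\<dots> \<le> (\<bar>c\<bar> + 1) * (\<epsilon> / (\<bar>c\<bar> + 1) * tnorm W)"
        using \<delta>(2)[OF that] by (intro mult_mono) auto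
      finally show ?thesis by simp
    qed
    then show "\<exists>\<delta>>0. \<forall>W\<in>tuples V. tnorm W < \<delta> \<longrightarrow> \<bar>c * F (U + W) - c * F U - c * L W\<bar> \<le> \<epsilon> * tnorm W"
      using \<delta>(1) by blast
  qed
qed

text \<open>A remainder of second order is of smaller order than the norm. Restricting q to norm at
  most 1 lets cubic and quartic terms, as in the Hartree energy, be absorbed into the
  square.\<close>

lemma frechet_quadratic:
  assumes lin: "\<And>W X a b. W \<in> tuples V \<Longrightarrow> X \<in> tuples V \<Longrightarrow> L (tcomb a W b X) = a * L W + b * L X"
    and bd: "\<And>W. W \<in> tuples V \<Longrightarrow> \<bar>L W\<bar> \<le> C * tnorm W"
    and q: "\<And>W. W \<in> tuples V \<Longrightarrow> tnorm W \<le> 1 \<Longrightarrow> \<bar>F (U + W) - F U - L W\<bar> \<le> D * (tnorm W)\<^sup>2"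
  shows "frechet F L U"
  unfolding frechet_def
proof (intro conjI allI impI ballI)
  fix \<epsilon> :: real assume \<epsilon>: "\<epsilon> > 0"
  \<comment> \<open>The minimum with 1 keeps W in the range of q; the denominator is positive
    whatever the sign of D.\<close>
  define \<delta> where "\<delta> = min 1 (\<epsilon> / (\<bar>D\<bar> + 1))"
  have "\<delta> > 0" using \<epsilon> by (simp add: \<delta>_def)
  moreover have "\<bar>F (U + W) - F U - L W\<bar> \<le> \<epsilon> * tnorm W" if W: "W \<in> tuples V" "tnorm W < \<delta>" for W
  proof -
    have "\<bar>F (U + W) - F U - L W\<bar> \<le> D * (tnorm W)\<^sup>2" using W q by (simp add: \<delta>_def)
    also have "\<dots> \<le> (\<bar>D\<bar> + 1) * (tnorm W)\<^sup>2" by (intro mult_right_mono) auto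
    also have "\<dots> = ((\<bar>D\<bar> + 1) * tnorm W) * tnorm W" by (simp add: power2_eq_square)
    also have "\<dots> \<le> \<epsilon> * tnorm W"
    proof (intro mult_right_mono tnorm_nonneg)
      have "tnorm W \<le> \<epsilon> / (\<bar>D\<bar> + 1)" using W(2) by (simp add: \<delta>_def)
      then show "(\<bar>D\<bar> + 1) * tnorm W \<le> \<epsilon>" by (simp add: pos_le_divide_eq mult.commute)
    qed
    finally show ?thesis .
  qed
  ultimately show "\<exists>\<delta>>0. \<forall>W\<in>tuples V. tnorm W < \<delta> \<longrightarrow> \<bar>F (U + W) - F U - L W\<bar> \<le> \<epsilon> * tnorm W"
    by blast
qed (use lin bd in blast)+

text \<open>With tolerance 1 in the remainder, increments of F near U are at most C + 1 times the
  norm of the increment.\<close>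

lemma frechet_continuous:
  assumes F: "frechet F L U" and lim: "((\<lambda>s. tnorm (W s - U)) \<longlongrightarrow> 0) G"
    and W: "eventually (\<lambda>s. W s \<in> tuples V) G" and U: "U \<in> tuples V"
  shows "((\<lambda>s. F (W s)) \<longlongrightarrow> F U) G"
proof -
  obtain C where C: "C \<ge> 0" "\<And>W. W \<in> tuples V \<Longrightarrow> \<bar>L W\<bar> \<le> C * tnorm W" using frechet_bound[OF F] by blast
  obtain \<delta> where \<delta>: "\<delta> > 0"
    "\<And>W. W \<in> tuples V \<Longrightarrow> tnorm W < \<delta> \<Longrightarrow> \<bar>F (U + W) - F U - L W\<bar> \<le> 1 * tnorm W"
    using frechet_remainder[OF F, of 1] by auto
  have "eventually (\<lambda>s. tnorm (W s - U) < \<delta>) G" using lim \<delta>(1) by (rule order_tendstoD)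
  with W have "eventually (\<lambda>s. norm (F (W s) - F U) \<le> (C + 1) * tnorm (W s - U)) G"
  proof eventually_elim
    case (elim s)
    then have d: "W s - U \<in> tuples V" using U by (simp add: tuples_diff)
    show ?case using C(2)[OF d] \<delta>(2)[OF d] elim by (simp add: abs_le_iff algebra_simps)
  qed
  moreover have "((\<lambda>s. (C + 1) * tnorm (W s - U)) \<longlongrightarrow> 0) G"
    using tendsto_mult_left[OF lim, of "C + 1"] by simp
  ultimately have "((\<lambda>s. F (W s) - F U) \<longlongrightarrow> 0) G" by (rule Lim_null_comparison)
  then show ?thesis using Lim_null by blast
qed

text \<open>Membership in V is required of nearby times only, since the flow is known to lie in V
  for nonnegative times.\<close>

definition tderiv :: "(real \<Rightarrow> 'n::finite orbitals) \<Rightarrow> 'n orbitals \<Rightarrow> real \<Rightarrow> bool" where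
  "tderiv U D t \<longleftrightarrow> eventually (\<lambda>h. U (t + h) \<in> tuples V) (at 0) \<and> U t \<in> tuples V \<and> D \<in> tuples V \<and>
     ((\<lambda>h. tnorm ((\<lambda>i r. (U (t + h) i r - U t i r) / h) - D)) \<longlongrightarrow> 0) (at 0)"

text \<open>The reverse triangle inequality carries convergence of the quotient over to its norm;
  multiplying by \<open>\<bar>h\<bar>\<close> then gives continuity.\<close>

lemma tderiv_increment:
  assumes "tderiv U D t"
  shows "((\<lambda>h. tnorm (U (t + h) - U t) / \<bar>h\<bar>) \<longlongrightarrow> tnorm D) (at 0)"
    and "((\<lambda>h. tnorm (U (t + h) - U t)) \<longlongrightarrow> 0) (at 0)"
proof -
  let ?q = "\<lambda>h. (\<lambda>i r. (U (t + h) i r - U t i r) / h) :: 'a orbitals"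
  have ev: "eventually (\<lambda>h. U (t + h) \<in> tuples V) (at 0)" and t: "U t \<in> tuples V" "D \<in> tuples V"
    and lim: "((\<lambda>h. tnorm (?q h - D)) \<longlongrightarrow> 0) (at 0)" using assms by (auto simp: tderiv_def)
  have "eventually (\<lambda>h. norm (tnorm (U (t + h) - U t) / \<bar>h\<bar> - tnorm D) \<le> tnorm (?q h - D)) (at 0)"
    using ev
  proof eventually_elim
    case (elim h)
    have q: "?q h = (\<lambda>i x. (1 / h) * (U (t + h) - U t) i x)" by (simp add: fun_eq_iff)
    have d: "U (t + h) - U t \<in> tuples V" using elim t by (intro tuples_diff)
    have q': "?q h \<in> tuples V"
      using tuples_tcomb[OF d d, of "1/h" 0] unfolding q mult_zero_left add_0_right .
    have "tnorm (?q h) = tnorm (U (t + h) - U t) / \<bar>h\<bar>"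
      unfolding q tnorm_scale[OF d] by simp
    moreover have "tnorm (?q h) \<le> tnorm (?q h - D) + tnorm D"
      using tnorm_triangle_diff[OF q' t(2) tuples_zero] by simp
    moreover have "tnorm D \<le> tnorm (?q h - D) + tnorm (?q h)"
      using tnorm_triangle_diff[OF t(2) q' tuples_zero] by (simp add: tnorm_minus_commute)
    ultimately show ?case by simp
  qed
  from Lim_null_comparison[OF this lim]
  show 1: "((\<lambda>h. tnorm (U (t + h) - U t) / \<bar>h\<bar>) \<longlongrightarrow> tnorm D) (at 0)" using Lim_null by blast
  have "((\<lambda>h::real. \<bar>h\<bar>) \<longlongrightarrow> 0) (at 0)" using tendsto_rabs[OF tendsto_ident_at, of 0 UNIV] by simp
  from tendsto_mult[OF 1 this]
  have "((\<lambda>h. tnorm (U (t + h) - U t) / \<bar>h\<bar> * \<bar>h\<bar>) \<longlongrightarrow> 0) (at 0)" by simp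
  then show "((\<lambda>h. tnorm (U (t + h) - U t)) \<longlongrightarrow> 0) (at 0)"
    by (rule Lim_transform_eventually) (auto simp: eventually_at_filter)
qed

lemma frechet_chain:
  assumes F: "frechet F L (U t)" and d: "tderiv U D t"
  shows "((\<lambda>s. F (U s)) has_real_derivative L D) (at t)"
proof -
  let ?q = "\<lambda>h. (\<lambda>i r. (U (t + h) i r - U t i r) / h) :: 'a orbitals"
  have ev: "eventually (\<lambda>h. U (t + h) \<in> tuples V) (at 0)" and t: "U t \<in> tuples V" "D \<in> tuples V"
    and lim: "((\<lambda>h. tnorm (?q h - D)) \<longlongrightarrow> 0) (at 0)" using d by (auto simp: tderiv_def)
  note inc = tderiv_increment[OF d]
  obtain C where C: "C \<ge> 0" "\<And>W. W \<in> tuples V \<Longrightarrow> \<bar>L W\<bar> \<le> C * tnorm W" using frechet_bound[OF F] by blast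
  have "((\<lambda>h. (F (U (t + h)) - F (U t)) / h - L D) \<longlongrightarrow> 0) (at 0)"
  proof (rule tendstoI)
    fix \<epsilon> :: real assume "\<epsilon> > 0"
    \<comment> \<open>The norm of the increment divided by \<open>\<bar>h\<bar>\<close> is
      eventually below \<open>tnorm D + 1\<close>, so with this tolerance the remainder contributes
      less than half of \<epsilon>.\<close>
    define \<kappa> where "\<kappa> = \<epsilon> / (2 * (tnorm D + 1))"
    have k: "\<kappa> > 0" using \<open>\<epsilon> > 0\<close> tnorm_nonneg[of D] by (simp add: \<kappa>_def)
    obtain \<delta> where \<delta>: "\<delta> > 0"
      "\<And>W. W \<in> tuples V \<Longrightarrow> tnorm W < \<delta> \<Longrightarrow> \<bar>F (U t + W) - F (U t) - L W\<bar> \<le> \<kappa> * tnorm W"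
      using frechet_remainder[OF F k] by blast
    have e1: "eventually (\<lambda>h. tnorm (U (t + h) - U t) < \<delta>) (at 0)"
      using inc(2) \<delta>(1) by (rule order_tendstoD)
    have e2: "eventually (\<lambda>h. tnorm (U (t + h) - U t) / \<bar>h\<bar> < tnorm D + 1) (at 0)"
      using inc(1) by (rule order_tendstoD) simp
    have "((\<lambda>h. C * tnorm (?q h - D)) \<longlongrightarrow> 0) (at 0)" using tendsto_mult_left[OF lim, of C] by simp
    then have e3: "eventually (\<lambda>h. C * tnorm (?q h - D) < \<epsilon> / 2) (at 0)"
      using \<open>\<epsilon> > 0\<close> by (intro order_tendstoD) auto
    have e4: "eventually (\<lambda>h::real. h \<noteq> 0) (at 0)" by (simp add: eventually_at_filter)
    from ev e1 e2 e3 e4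
    show "eventually (\<lambda>h. dist ((F (U (t + h)) - F (U t)) / h - L D) 0 < \<epsilon>) (at 0)"
    proof eventually_elim
      case (elim h)
      let ?W = "U (t + h) - U t"
      have W: "?W \<in> tuples V" using elim t by (simp add: tuples_diff)
      have qD: "?q h - D = tcomb (1/h) ?W (-1) D" by (simp add: fun_eq_iff)
      have "L (?q h - D) = (1/h) * L ?W + (-1) * L D"
        unfolding qD using F W t(2) unfolding frechet_def by blast
      then have Lq: "L ?W / h - L D = L (?q h - D)" by simp
      have "\<bar>F (U (t + h)) - F (U t) - L ?W\<bar> \<le> \<kappa> * tnorm ?W" using \<delta>(2)[OF W] elim by simp
      from divide_right_mono[OF this, of "\<bar>h\<bar>"]
      have "\<bar>(F (U (t + h)) - F (U t)) / h - L ?W / h\<bar> \<le> \<kappa> * (tnorm ?W / \<bar>h\<bar>)"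
        by (simp add: abs_divide[symmetric] diff_divide_distrib del: abs_divide)
      also have "\<dots> < \<kappa> * (tnorm D + 1)" using elim k by (intro mult_strict_left_mono)
      also have "\<dots> = \<epsilon> / 2" using tnorm_nonneg[of D] by (simp add: \<kappa>_def field_simps)
      finally have "\<bar>(F (U (t + h)) - F (U t)) / h - L ?W / h\<bar> < \<epsilon> / 2" .
      moreover have "\<bar>L (?q h - D)\<bar> < \<epsilon> / 2"
      proof -
        have "?q h - D \<in> tuples V" unfolding qD by (rule tuples_tcomb[OF W t(2)])
        from C(2)[OF this] show ?thesis using elim(4) by linarith
      qed
      ultimately show ?case using Lq unfolding dist_real_def by linarith
    qed
  qed
  then show ?thesis unfolding DERIV_def using Lim_null by blast
qed

end

section \<open>Differentiability of the energy\<close>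

lemma sum_rotate:
  fixes f :: "'i \<Rightarrow> 'j \<Rightarrow> 'k \<Rightarrow> 'b::comm_monoid_add"
  shows "(\<Sum>i\<in>A. \<Sum>j\<in>B. \<Sum>k\<in>C. f i j k) = (\<Sum>j\<in>B. \<Sum>k\<in>C. \<Sum>i\<in>A. f i j k)"
proof -
  have "(\<Sum>i\<in>A. \<Sum>j\<in>B. \<Sum>k\<in>C. f i j k) = (\<Sum>j\<in>B. \<Sum>i\<in>A. \<Sum>k\<in>C. f i j k)" by (rule sum.swap)
  also have "\<dots> = (\<Sum>j\<in>B. \<Sum>k\<in>C. \<Sum>i\<in>A. f i j k)" by (intro sum.cong refl) (rule sum.swap)
  finally show ?thesis .
qed

lemma orthogonal_matrix_rows:
  fixes P :: "real^'n^'n"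
  assumes "orthogonal_matrix P"
  shows "(\<Sum>i\<in>UNIV. P $ j $ i * P $ k $ i) = (if j = k then 1 else 0)"
proof -
  have "P ** transpose P = mat 1" using assms by (simp add: orthogonal_matrix_def)
  then have "(P ** transpose P) $ j $ k = mat 1 $ j $ k" by simp
  then show ?thesis by (simp add: matrix_matrix_mult_def transpose_def mat_def)
qed

lemma l2_inner_weight: "l2_inner (\<lambda>r. w r * u r) v = (LINT r|lborel. w r * u r * v r)"
  by (simp add: l2_inner_def)

context orthonormal_space
begin

lemma bilinear_symI:
  assumes "\<And>u v w a b. u \<in> V \<Longrightarrow> v \<in> V \<Longrightarrow> w \<in> V \<Longrightarrow> B (\<lambda>x. a * u x + b * v x) w = a * B u w + b * B v w"
    and "\<And>u v. B u v = B v u"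
  shows "bilinear_on_V B"
  unfolding bilinear_on_V_def
proof (intro ballI allI conjI)
  fix u v w a b assume "u \<in> V" "v \<in> V" "w \<in> V"
  then show l: "B (\<lambda>x. a * u x + b * v x) w = a * B u w + b * B v w" by (rule assms(1))
  show "B w (\<lambda>x. a * u x + b * v x) = a * B w u + b * B w v"
    using l assms(2)[of w] by simp
qed

lemma bilinear_add:
  "bilinear_on_V B \<Longrightarrow> bilinear_on_V C \<Longrightarrow> bilinear_on_V (\<lambda>u v. B u v + C u v)"
  by (simp add: bilinear_on_V_def algebra_simps)

lemma bilinear_scale: "bilinear_on_V B \<Longrightarrow> bilinear_on_V (\<lambda>u v. c * B u v)"
  by (simp add: bilinear_on_V_def algebra_simps)

lemma bilinear_l2_inner: "bilinear_on_V l2_inner"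
  using l2_inner_lincomb_left V_L2 l2_inner_commute by (intro bilinear_symI) blast+

lemma bilinear_weak_grad: "bilinear_on_V (\<lambda>u v. l2_inner (weak_grad u) (weak_grad v))"
proof -
  have left: "l2_inner (weak_grad (\<lambda>x. a * u x + b * v x)) (weak_grad w)
      = a * l2_inner (weak_grad u) (weak_grad w) + b * l2_inner (weak_grad v) (weak_grad w)"
    if "u \<in> V" "v \<in> V" "w \<in> V" for u v w a b
  proof -
    have H: "u \<in> H1" "v \<in> H1" "w \<in> H1" using that V_H1 by auto
    note L = H[THEN weak_grad(1)] weak_grad(1)[OF H1_lincomb[OF H(1,2)]]
    have "l2_inner (weak_grad (\<lambda>x. a * u x + b * v x)) (weak_grad w)
       = l2_inner (\<lambda>x. a *\<^sub>R weak_grad u x + b *\<^sub>R weak_grad v x) (weak_grad w)"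
      unfolding l2_inner_def
    proof (rule integral_cong_AE)
      show "AE x in lborel. weak_grad (\<lambda>x. a * u x + b * v x) x \<bullet> weak_grad w x =
          (a *\<^sub>R weak_grad u x + b *\<^sub>R weak_grad v x) \<bullet> weak_grad w x"
        using weak_grad_lincomb[OF H(1,2), of a b] by eventually_elim simp
    qed (use L integrable_inner_L2 L2_lincomb in blast)+
    then show ?thesis using l2_inner_add_left[OF L(1,2,3)] by simp
  qed
  then show ?thesis by (rule bilinear_symI) (assumption | rule l2_inner_commute)+
qed

lemma bilinear_weight:
  assumes "\<And>u v. u \<in> V \<Longrightarrow> v \<in> V \<Longrightarrow> integrable lborel (\<lambda>r. w r * u r * v r)"
  shows "bilinear_on_V (\<lambda>u v. l2_inner (\<lambda>r. w r * u r) v)"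
proof -
  have sym: "l2_inner (\<lambda>r. w r * u r) v = l2_inner (\<lambda>r. w r * v r) u" for u v
    unfolding l2_inner_weight by (simp add: mult.commute mult.left_commute)
  have left: "l2_inner (\<lambda>r. w r * (a * u r + b * v r)) x = a * l2_inner (\<lambda>r. w r * u r) x + b * l2_inner (\<lambda>r. w r * v r) x"
    if "u \<in> V" "v \<in> V" "x \<in> V" for u v x a b
  proof -
    have "(\<lambda>r. w r * (a * u r + b * v r) * x r) = (\<lambda>r. a * (w r * u r * x r) + b * (w r * v r * x r))"
      by (simp add: algebra_simps)
    then show ?thesis
      unfolding l2_inner_weight using assms that by simp
  qed
  then show ?thesis by (rule bilinear_symI) (assumption | rule sym)+
qed

lemma frechet_cong:
  assumes "frechet F L U" "U \<in> tuples V"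
    and "\<And>X. X \<in> tuples V \<Longrightarrow> F' X = F X" "\<And>X. X \<in> tuples V \<Longrightarrow> L' X = L X"
  shows "frechet F' L' U"
  using assms unfolding frechet_def by (simp add: tuples_add tuples_tcomb)

lemma frechet_const: "frechet (\<lambda>W. c) (\<lambda>W. 0) U"
  by (rule frechet_quadratic[where C=0 and D=0]) auto

lemma frechet_sum:
  assumes "finite K" "\<And>k. k \<in> K \<Longrightarrow> frechet (F k) (L k) U"
  shows "frechet (\<lambda>W. \<Sum>k\<in>K. F k W) (\<lambda>W. \<Sum>k\<in>K. L k W) U"
  using assms by (induction K rule: finite_induct) (auto simp: frechet_const frechet_add)

text \<open>The remainder is the single term \<open>B (W i) (W j)\<close>, of second order by
  boundedness of B. Equal indices occur in the energy, arbitrary ones in the Gram entries along the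
  flow.\<close>

lemma frechet_bilinear:
  assumes B: "bilinear_on_V B" and U: "U \<in> tuples V"
  shows "frechet (\<lambda>U. B (U i) (U j)) (\<lambda>W. B (U i) (W j) + B (W i) (U j)) U"
proof -
  define K where "K = (\<Sum>j<m. \<Sum>k<m. \<bar>B (e j) (e k)\<bar>)"
  have K: "K \<ge> 0" by (simp add: K_def sum_nonneg)
  have V: "W \<in> tuples V \<Longrightarrow> W k \<in> V" for W k by (simp add: tuples_def)
  have bd: "\<bar>B (X i) (Y j)\<bar> \<le> K * tnorm X * tnorm Y" if "X \<in> tuples V" "Y \<in> tuples V" for X Y i j
  proof -
    have "\<bar>B (X i) (Y j)\<bar> \<le> K * vnorm (X i) * vnorm (Y j)"
      using bilinear_bound[OF B V[OF that(1)] V[OF that(2)]] by (simp add: K_def)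
    also have "\<dots> \<le> K * tnorm X * tnorm Y"
      using K by (intro mult_mono mult_nonneg_nonneg) (auto simp: vnorm_le_tnorm vnorm_nonneg tnorm_nonneg)
    finally show ?thesis .
  qed
  show ?thesis
  proof (rule frechet_quadratic[where C="2 * K * tnorm U" and D=K])
    fix W X :: "'a orbitals" and a b :: real assume "W \<in> tuples V" "X \<in> tuples V"
    then show "B (U i) (tcomb a W b X j) + B (tcomb a W b X i) (U j) =
        a * (B (U i) (W j) + B (W i) (U j)) + b * (B (U i) (X j) + B (X i) (U j))"
      using bilinear_left[OF B V[of W i] V[of X i] V[OF U, of j], of a b]
        bilinear_right[OF B V[of W j] V[of X j] V[OF U, of i], of a b]
      by (simp add: algebra_simps)
  next
    fix W :: "'a orbitals" assume W: "W \<in> tuples V"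
    show "\<bar>B (U i) (W j) + B (W i) (U j)\<bar> \<le> 2 * K * tnorm U * tnorm W"
      using bd[OF U W, of i j] bd[OF W U, of i j] by (simp add: algebra_simps)
    have "B ((U + W) i) ((U + W) j) = B (U i) (U j) + B (U i) (W j) + B (W i) (U j) + B (W i) (W j)"
      using bilinear_left[OF B V[OF U, of i] V[OF W, of i] V[OF tuples_add[OF U W], of j], of 1 1]
        bilinear_right[OF B V[OF U, of j] V[OF W, of j] V[OF U, of i], of 1 1]
        bilinear_right[OF B V[OF U, of j] V[OF W, of j] V[OF W, of i], of 1 1]
      by (simp add: plus_fun_def)
    then show "\<bar>B ((U + W) i) ((U + W) j) - B (U i) (U j) - (B (U i) (W j) + B (W i) (U j))\<bar> \<le> K * (tnorm W)\<^sup>2"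
      using bd[OF W W, of i j] by (simp add: power2_eq_square mult.assoc)
  qed
qed

text \<open>With M the matrix of the values \<open>B (U j) (W k)\<close>, the left side is the trace
  of P^T M P, and the trace is invariant under orthogonal conjugation.\<close>

lemma bilinear_orthogonal_invariant:
  assumes B: "bilinear_on_V B" and U: "U \<in> tuples V" and W: "W \<in> tuples V" and P: "orthogonal_matrix P"
  shows "(\<Sum>i\<in>UNIV. B (tmul U P i) (tmul W P i)) = (\<Sum>i\<in>UNIV. B (U i) (W i))"
proof -
  have V: "U k \<in> V" "W k \<in> V" for k using U W by (auto simp: tuples_def)
  note PP = orthogonal_matrix_rows[OF P]
  have "B (tmul U P i) (tmul W P i) = (\<Sum>j\<in>UNIV. \<Sum>k\<in>UNIV. P $ j $ i * P $ k $ i * B (U j) (W k))" for i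
  proof -
    have "B (tmul U P i) (tmul W P i) = (\<Sum>j\<in>UNIV. P $ j $ i * B (U j) (tmul W P i))"
      unfolding tmul_def[of U] using V tuples_tmul[OF W, of P]
      by (intro bilinear_sum_left[OF B]) (auto simp: tuples_def)
    also have "\<dots> = (\<Sum>j\<in>UNIV. P $ j $ i * (\<Sum>k\<in>UNIV. P $ k $ i * B (U j) (W k)))"
      unfolding tmul_def using V by (intro sum.cong refl arg_cong2[of _ _ _ _ "(*)"] bilinear_sum_right[OF B]) auto
    finally show ?thesis by (simp add: sum_distrib_left mult.assoc)
  qed
  then have "(\<Sum>i\<in>UNIV. B (tmul U P i) (tmul W P i)) =
      (\<Sum>i\<in>UNIV. \<Sum>j\<in>UNIV. \<Sum>k\<in>UNIV. P $ j $ i * P $ k $ i * B (U j) (W k))" by simp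
  also have "\<dots> = (\<Sum>j\<in>UNIV. \<Sum>k\<in>UNIV. \<Sum>i\<in>UNIV. P $ j $ i * P $ k $ i * B (U j) (W k))"
    by (rule sum_rotate)
  also have "\<dots> = (\<Sum>j\<in>UNIV. \<Sum>k\<in>UNIV. (if j = k then 1 else 0) * B (U j) (W k))"
    by (simp only: sum_distrib_right[symmetric] PP)
  also have "\<dots> = (\<Sum>i\<in>UNIV. B (U i) (W i))"
    by (simp add: if_distrib[of "\<lambda>x. x * _"] cong: if_cong)
  finally show ?thesis .
qed

lemma tinner_tmul:
  "U \<in> tuples V \<Longrightarrow> W \<in> tuples V \<Longrightarrow> orthogonal_matrix P \<Longrightarrow> tinner (tmul U P) (tmul W P) = tinner U W"
  unfolding tinner_eq by (rule bilinear_orthogonal_invariant[OF bilinear_l2_inner])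

lemma tnorm_tmul: "U \<in> tuples V \<Longrightarrow> orthogonal_matrix P \<Longrightarrow> tnorm (tmul U P) = tnorm U"
  by (simp add: tnorm_def tinner_tmul)

end

text \<open>At each point the vector of orbital values is multiplied by an orthogonal matrix, which
  preserves its length. Every quantity depending on the density alone is therefore constant on
  orbits.\<close>

lemma electron_density_tmul:
  assumes "orthogonal_matrix P" shows "electron_density (tmul U P) = electron_density U"
proof
  fix r
  note PP = orthogonal_matrix_rows[OF assms]
  have "(\<Sum>i\<in>UNIV. (tmul U P i r)\<^sup>2) = (\<Sum>i\<in>UNIV. \<Sum>j\<in>UNIV. \<Sum>k\<in>UNIV. P $ j $ i * P $ k $ i * (U j r * U k r))"
    by (simp add: tmul_def power2_eq_square sum_product algebra_simps)
  also have "\<dots> = (\<Sum>j\<in>UNIV. \<Sum>k\<in>UNIV. \<Sum>i\<in>UNIV. P $ j $ i * P $ k $ i * (U j r * U k r))"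
    by (rule sum_rotate)
  also have "\<dots> = (\<Sum>j\<in>UNIV. \<Sum>k\<in>UNIV. (if j = k then 1 else 0) * (U j r * U k r))"
    by (simp only: sum_distrib_right[symmetric] PP)
  also have "\<dots> = (\<Sum>i\<in>UNIV. (U i r)\<^sup>2)"
    by (simp add: if_distrib[of "\<lambda>x. x * _"] power2_eq_square cong: if_cong)
  finally show "electron_density (tmul U P) r = electron_density U r" by (simp add: electron_density_def)
qed

section \<open>The Hartree energy as a four-linear form\<close>

definition hart4 :: "(real^3 \<Rightarrow> real) \<Rightarrow> (real^3 \<Rightarrow> real) \<Rightarrow> (real^3 \<Rightarrow> real) \<Rightarrow> (real^3 \<Rightarrow> real) \<Rightarrow> real" where
  "hart4 a b c d = (LINT (r, r')|(lborel \<Otimes>\<^sub>M lborel). a r * b r * (c r' * d r') / dist r r')"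

locale energy_space = orthonormal_space V e m
  for V :: "(real^3 \<Rightarrow> real) set" and e :: "nat \<Rightarrow> real^3 \<Rightarrow> real" and m :: nat +
  fixes Vext :: "real^3 \<Rightarrow> real" and exc vxc :: density_map
  assumes ext_defined: "\<And>u. u \<in> H1 \<Longrightarrow> integrable lborel (\<lambda>r. Vext r * (u r)\<^sup>2)"
    and hartree_defined: "\<And>u v. u \<in> H1 \<Longrightarrow> v \<in> H1 \<Longrightarrow>
          integrable (lborel \<Otimes>\<^sub>M lborel) (\<lambda>(r, r'). (u r)\<^sup>2 * (v r')\<^sup>2 / dist r r')"
begin

lemma V_measurable: "v \<in> V \<Longrightarrow> v \<in> borel_measurable borel"
  using V_L2 L2_D(1) by blast

lemma hart4_measurable:
  assumes "a \<in> V" "b \<in> V" "c \<in> V" "d \<in> V"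
  shows "(\<lambda>(r, r'). a r * b r * (c r' * d r') / dist r r') \<in> borel_measurable (lborel \<Otimes>\<^sub>M lborel)"
proof -
  note [measurable] = assms[THEN V_measurable]
  show ?thesis unfolding case_prod_unfold by measurable
qed

text \<open>Integrability is assumed for products of squares. Bounding each of
  \<open>a r * b r\<close> and \<open>c r' * d r'\<close> by the sum of the two squares dominates
  the integrand by four such products.\<close>

lemma hart4_integrable:
  assumes "a \<in> V" "b \<in> V" "c \<in> V" "d \<in> V"
  shows "integrable (lborel \<Otimes>\<^sub>M lborel) (\<lambda>(r, r'). a r * b r * (c r' * d r') / dist r r')"
proof (rule Bochner_Integration.integrable_bound)
  let ?g = "\<lambda>u v z. (u (fst z))\<^sup>2 * (v (snd z))\<^sup>2 / dist (fst z) (snd z) :: real"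
  show "integrable (lborel \<Otimes>\<^sub>M lborel) (\<lambda>z. ?g a c z + ?g a d z + ?g b c z + ?g b d z)"
    using assms V_H1 by (intro Bochner_Integration.integrable_add hartree_defined[unfolded case_prod_unfold]) auto
  have "\<bar>x * y\<bar> \<le> x\<^sup>2 + y\<^sup>2" for x y :: real
    using sum_squares_bound[of "\<bar>x\<bar>" "\<bar>y\<bar>"] mult_nonneg_nonneg[of "\<bar>x\<bar>" "\<bar>y\<bar>"]
    unfolding abs_mult power2_abs by linarith
  then have "\<bar>a r * b r\<bar> * \<bar>c r' * d r'\<bar> \<le> ((a r)\<^sup>2 + (b r)\<^sup>2) * ((c r')\<^sup>2 + (d r')\<^sup>2)" for r r'
    by (intro mult_mono) auto
  then have "\<bar>a r * b r\<bar> * \<bar>c r' * d r'\<bar> / dist r r' \<le> ((a r)\<^sup>2 + (b r)\<^sup>2) * ((c r')\<^sup>2 + (d r')\<^sup>2) / dist r r'" for r r'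
    by (intro divide_right_mono) auto
  then have "norm (a r * b r * (c r' * d r') / dist r r')
      \<le> norm (?g a c (r, r') + ?g a d (r, r') + ?g b c (r, r') + ?g b d (r, r'))" for r r'
    by (simp add: abs_mult algebra_simps add_divide_distrib)
  from this[of "fst _" "snd _"] show "AE z in lborel \<Otimes>\<^sub>M lborel. norm (case z of (r, r') \<Rightarrow> a r * b r * (c r' * d r') / dist r r')
      \<le> norm (?g a c z + ?g a d z + ?g b c z + ?g b d z)"
    by (intro AE_I2) (simp add: case_prod_unfold)
qed (rule hart4_measurable[OF assms])

lemma hart4_commute: "hart4 a b c d = hart4 b a c d"
  by (simp add: hart4_def mult.commute)

lemma hart4_swap:
  assumes "a \<in> V" "b \<in> V" "c \<in> V" "d \<in> V"
  shows "hart4 a b c d = hart4 c d a b"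
  using lborel_pair.integral_product_swap[OF hart4_measurable[OF assms]]
  by (simp add: hart4_def case_prod_unfold dist_commute mult.commute)

lemma hart4_bilinear_left:
  assumes "c \<in> V" "d \<in> V" shows "bilinear_on_V (\<lambda>a b. hart4 a b c d)"
proof -
  have left: "hart4 (\<lambda>x. \<alpha> * u x + \<beta> * v x) w c d = \<alpha> * hart4 u w c d + \<beta> * hart4 v w c d"
    if "u \<in> V" "v \<in> V" "w \<in> V" for u v w \<alpha> \<beta>
  proof -
    have "hart4 (\<lambda>x. \<alpha> * u x + \<beta> * v x) w c d = (LINT z|(lborel \<Otimes>\<^sub>M lborel).
       \<alpha> * (case z of (r, r') \<Rightarrow> u r * w r * (c r' * d r') / dist r r') +
       \<beta> * (case z of (r, r') \<Rightarrow> v r * w r * (c r' * d r') / dist r r'))"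
      unfolding hart4_def by (intro Bochner_Integration.integral_cong refl) (auto simp: algebra_simps add_divide_distrib)
    also have "\<dots> = \<alpha> * hart4 u w c d + \<beta> * hart4 v w c d"
      unfolding hart4_def using hart4_integrable assms that
      by (subst Bochner_Integration.integral_add) auto
    finally show ?thesis .
  qed
  then show ?thesis by (rule bilinear_symI) (assumption | rule hart4_commute)+
qed

lemma hart4_bilinear_right:
  assumes "a \<in> V" "b \<in> V" shows "bilinear_on_V (\<lambda>c d. hart4 a b c d)"
  using hart4_bilinear_left[OF assms] hart4_swap[OF assms]
  by (simp add: bilinear_on_V_def V_lincomb)

text \<open>The bound for bilinear forms is applied twice, first to the last pair of arguments and
  then, at basis functions, to the first pair.\<close>

lemma hart4_bound:
  obtains K where "K \<ge> 0" "\<And>a b c d. a \<in> V \<Longrightarrow> b \<in> V \<Longrightarrow> c \<in> V \<Longrightarrow> d \<in> V \<Longrightarrow>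
    \<bar>hart4 a b c d\<bar> \<le> K * vnorm a * vnorm b * vnorm c * vnorm d"
proof
  let ?K = "\<Sum>j<m. \<Sum>k<m. \<Sum>p<m. \<Sum>q<m. \<bar>hart4 (e p) (e q) (e j) (e k)\<bar>"
  show "?K \<ge> 0" by (intro sum_nonneg) auto
  fix a b c d assume V: "a \<in> V" "b \<in> V" "c \<in> V" "d \<in> V"
  have "\<bar>hart4 a b c d\<bar> \<le> (\<Sum>j<m. \<Sum>k<m. \<bar>hart4 a b (e j) (e k)\<bar>) * vnorm c * vnorm d"
    by (rule bilinear_bound[OF hart4_bilinear_right[OF V(1,2)] V(3,4)])
  also have "\<dots> \<le> (\<Sum>j<m. \<Sum>k<m. (\<Sum>p<m. \<Sum>q<m. \<bar>hart4 (e p) (e q) (e j) (e k)\<bar>) * vnorm a * vnorm b) * vnorm c * vnorm d"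
    using e_in by (intro mult_right_mono vnorm_nonneg sum_mono bilinear_bound[OF hart4_bilinear_left _ _] V) auto
  also have "\<dots> = ?K * vnorm a * vnorm b * vnorm c * vnorm d"
    by (simp only: sum_distrib_right)
  finally show "\<bar>hart4 a b c d\<bar> \<le> ?K * vnorm a * vnorm b * vnorm c * vnorm d" .
qed

lemma frechet_hart4:
  assumes U: "U \<in> tuples V"
  shows "frechet (\<lambda>U. hart4 (U i) (U i) (U j) (U j))
    (\<lambda>W. 2 * hart4 (U i) (W i) (U j) (U j) + 2 * hart4 (U i) (U i) (U j) (W j)) U"
proof -
  obtain K where K: "K \<ge> 0" and bdK: "\<And>a b c d. a \<in> V \<Longrightarrow> b \<in> V \<Longrightarrow> c \<in> V \<Longrightarrow> d \<in> V \<Longrightarrow>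
    \<bar>hart4 a b c d\<bar> \<le> K * vnorm a * vnorm b * vnorm c * vnorm d" using hart4_bound by blast
  have V: "W \<in> tuples V \<Longrightarrow> W k \<in> V" for W k by (simp add: tuples_def)
  have bd: "\<bar>hart4 (A i) (B i) (C j) (D j)\<bar> \<le> K * tnorm A * tnorm B * tnorm C * tnorm D"
    if "A \<in> tuples V" "B \<in> tuples V" "C \<in> tuples V" "D \<in> tuples V" for A B C D
  proof -
    have "\<bar>hart4 (A i) (B i) (C j) (D j)\<bar> \<le> K * vnorm (A i) * vnorm (B i) * vnorm (C j) * vnorm (D j)"
      using bdK that V by blast
    also have "\<dots> \<le> K * tnorm A * tnorm B * tnorm C * tnorm D"
      using K by (intro mult_mono mult_nonneg_nonneg) (auto simp: vnorm_le_tnorm vnorm_nonneg tnorm_nonneg)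
    finally show ?thesis .
  qed
  let ?u = "tnorm U"
  have u: "?u \<ge> 0" by (rule tnorm_nonneg)
  show ?thesis
  \<comment> \<open>The constants are the binomial coefficients of a fourth power: 4 for the linear
    part, then 6, 4 and 1 for the terms with two, three and four factors W.\<close>
  proof (rule frechet_quadratic[where C="4 * K * ?u ^ 3" and D="K * (6 * ?u\<^sup>2 + 4 * ?u + 1)"])
    fix W X :: "'a orbitals" and a b :: real assume WX: "W \<in> tuples V" "X \<in> tuples V"
    show "2 * hart4 (U i) (tcomb a W b X i) (U j) (U j) + 2 * hart4 (U i) (U i) (U j) (tcomb a W b X j) =
       a * (2 * hart4 (U i) (W i) (U j) (U j) + 2 * hart4 (U i) (U i) (U j) (W j)) +
       b * (2 * hart4 (U i) (X i) (U j) (U j) + 2 * hart4 (U i) (U i) (U j) (X j))"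
      using bilinear_right[OF hart4_bilinear_left[OF V[OF U, of j] V[OF U, of j]]
            V[OF WX(1), of i] V[OF WX(2), of i] V[OF U, of i], of a b]
        bilinear_right[OF hart4_bilinear_right[OF V[OF U, of i] V[OF U, of i]]
            V[OF WX(1), of j] V[OF WX(2), of j] V[OF U, of j], of a b]
      by (simp add: algebra_simps)
  next
    fix W :: "'a orbitals" assume W: "W \<in> tuples V"
    show "\<bar>2 * hart4 (U i) (W i) (U j) (U j) + 2 * hart4 (U i) (U i) (U j) (W j)\<bar> \<le> 4 * K * ?u ^ 3 * tnorm W"
      using bd[OF U W U U] bd[OF U U U W] by (simp add: power3_eq_cube algebra_simps)
    assume W1: "tnorm W \<le> 1"
    let ?w = "tnorm W"
    have w: "?w \<ge> 0" by (rule tnorm_nonneg)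
    have l: "hart4 ((U + W) i) ((U + W) i) c d = hart4 (U i) (U i) c d + 2 * hart4 (U i) (W i) c d + hart4 (W i) (W i) c d"
      if "c \<in> V" "d \<in> V" for c d
    proof -
      note B = hart4_bilinear_left[OF that]
      show ?thesis
        using bilinear_left[OF B V[OF U, of i] V[OF W, of i] V[OF tuples_add[OF U W], of i], of 1 1]
          bilinear_right[OF B V[OF U, of i] V[OF W, of i] V[OF U, of i], of 1 1]
          bilinear_right[OF B V[OF U, of i] V[OF W, of i] V[OF W, of i], of 1 1] hart4_commute[of "W i" "U i"]
        by (simp add: plus_fun_def)
    qed
    have r: "hart4 a b ((U + W) j) ((U + W) j) = hart4 a b (U j) (U j) + 2 * hart4 a b (U j) (W j) + hart4 a b (W j) (W j)"
      if "a \<in> V" "b \<in> V" for a b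
    proof -
      note B = hart4_bilinear_right[OF that]
      have "hart4 a b (W j) (U j) = hart4 a b (U j) (W j)" by (simp add: hart4_def mult.commute)
      then show ?thesis
        using bilinear_left[OF B V[OF U, of j] V[OF W, of j] V[OF tuples_add[OF U W], of j], of 1 1]
          bilinear_right[OF B V[OF U, of j] V[OF W, of j] V[OF U, of j], of 1 1]
          bilinear_right[OF B V[OF U, of j] V[OF W, of j] V[OF W, of j], of 1 1]
        by (simp add: plus_fun_def)
    qed
    have "hart4 ((U + W) i) ((U + W) i) ((U + W) j) ((U + W) j) - hart4 (U i) (U i) (U j) (U j) -
        (2 * hart4 (U i) (W i) (U j) (U j) + 2 * hart4 (U i) (U i) (U j) (W j)) =
      hart4 (U i) (U i) (W j) (W j) + 4 * hart4 (U i) (W i) (U j) (W j) + 2 * hart4 (U i) (W i) (W j) (W j) +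
      hart4 (W i) (W i) (U j) (U j) + 2 * hart4 (W i) (W i) (U j) (W j) + hart4 (W i) (W i) (W j) (W j)"
      using l[OF V[OF tuples_add[OF U W], of j] V[OF tuples_add[OF U W], of j]]
        r[OF V[OF U, of i] V[OF U, of i]] r[OF V[OF U, of i] V[OF W, of i]] r[OF V[OF W, of i] V[OF W, of i]]
      by simp
    moreover have "\<bar>\<dots>\<bar> \<le> K * (6 * ?u\<^sup>2 * ?w\<^sup>2 + 4 * ?u * (?w * ?w\<^sup>2) + ?w\<^sup>2 * ?w\<^sup>2)"
      using bd[OF U U W W] bd[OF U W U W] bd[OF U W W W] bd[OF W W U U] bd[OF W W U W] bd[OF W W W W]
      by (simp add: power2_eq_square algebra_simps)
    moreover have "\<dots> \<le> K * (6 * ?u\<^sup>2 * ?w\<^sup>2 + 4 * ?u * (1 * ?w\<^sup>2) + 1 * ?w\<^sup>2)"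
      using K u w W1 by (intro mult_left_mono add_mono mult_right_mono order_refl) (auto simp: power_le_one)
    ultimately show "\<bar>hart4 ((U + W) i) ((U + W) i) ((U + W) j) ((U + W) j) - hart4 (U i) (U i) (U j) (U j) -
        (2 * hart4 (U i) (W i) (U j) (U j) + 2 * hart4 (U i) (U i) (U j) (W j))\<bar>
        \<le> K * (6 * ?u\<^sup>2 + 4 * ?u + 1) * ?w\<^sup>2"
      by (simp add: algebra_simps)
  qed
qed

end

section \<open>The terms of the energy, the Hamiltonian form and the gradient\<close>

context energy_space
begin

text \<open>Polarization: the product is a quarter of the difference of two squares, and squares of
  functions in \<open>H1\<close> are covered by the hypothesis.\<close>

lemma ext_integrable:
  assumes "u \<in> V" "v \<in> V"
  shows "integrable lborel (\<lambda>r. Vext r * u r * v r)"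
proof -
  have H: "u \<in> H1" "v \<in> H1" using assms V_H1 by auto
  have "integrable lborel (\<lambda>r. 1/4 * (Vext r * (1 * u r + 1 * v r)\<^sup>2 - Vext r * (1 * u r + (-1) * v r)\<^sup>2))"
    by (intro integrable_mult_right Bochner_Integration.integrable_diff ext_defined H1_lincomb H)
  moreover have "(\<lambda>r. 1/4 * (Vext r * (1 * u r + 1 * v r)\<^sup>2 - Vext r * (1 * u r + (-1) * v r)\<^sup>2)) = (\<lambda>r. Vext r * u r * v r)"
    by (simp add: power2_eq_square algebra_simps)
  ultimately show ?thesis by simp
qed

text \<open>The potential is the inner integral of a function integrable on the product space, so
  Fubini gives both the integrability in r and the value. The factor 2 is the one in the
  density.\<close>

lemma hartree_potential_l2:
  assumes U: "U \<in> tuples V" and uv: "u \<in> V" "v \<in> V"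
  shows "integrable lborel (\<lambda>r. hartree_potential (electron_density U) r * u r * v r)"
    and "l2_inner (\<lambda>r. hartree_potential (electron_density U) r * u r) v = (\<Sum>j\<in>UNIV. 2 * hart4 u v (U j) (U j))"
proof -
  define f where "f j = (\<lambda>(r, r'). u r * v r * (U j r' * U j r') / dist r r')" for j
  define g where "g = (\<lambda>z. \<Sum>j\<in>UNIV. 2 * f j z)"
  have f: "integrable (lborel \<Otimes>\<^sub>M lborel) (f j)" for j
    unfolding f_def using U uv by (intro hart4_integrable) (auto simp: tuples_def)
  then have g: "integrable (lborel \<Otimes>\<^sub>M lborel) g" unfolding g_def by auto
  have eq: "hartree_potential (electron_density U) r * u r * v r = (LINT r'|lborel. g (r, r'))" for r
  proof -
    have "hartree_potential (electron_density U) r * u r * v r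
        = (LINT r'|lborel. electron_density U r' / dist r r' * (u r * v r))"
      unfolding hartree_potential_def mult.assoc by (rule integral_mult_left_zero[symmetric])
    also have "\<dots> = (LINT r'|lborel. g (r, r'))"
      by (simp add: g_def f_def electron_density_def sum_distrib_left sum_distrib_right sum_divide_distrib
          power2_eq_square algebra_simps)
    finally show ?thesis .
  qed
  show "integrable lborel (\<lambda>r. hartree_potential (electron_density U) r * u r * v r)"
    unfolding eq by (rule lborel_pair.integrable_fst'[OF g])
  have "l2_inner (\<lambda>r. hartree_potential (electron_density U) r * u r) v = integral\<^sup>L (lborel \<Otimes>\<^sub>M lborel) g"
    unfolding l2_inner_weight eq by (rule lborel_pair.integral_fst'[OF g])
  also have "\<dots> = (\<Sum>j\<in>UNIV. 2 * hart4 u v (U j) (U j))"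
    unfolding g_def using f by (subst Bochner_Integration.integral_sum) (auto simp: hart4_def f_def)
  finally show "l2_inner (\<lambda>r. hartree_potential (electron_density U) r * u r) v
    = (\<Sum>j\<in>UNIV. 2 * hart4 u v (U j) (U j))" .
qed

lemma hartree_energy:
  assumes U: "U \<in> tuples V"
  shows "(LINT r|lborel. LINT r'|lborel. electron_density U r * electron_density U r' / dist r r')
    = (\<Sum>i\<in>UNIV. \<Sum>j\<in>UNIV. 4 * hart4 (U i) (U i) (U j) (U j))"
proof -
  define f where "f i j = (\<lambda>(r, r'). U i r * U i r * (U j r' * U j r') / dist r r')" for i j
  define g where "g = (\<lambda>z. \<Sum>i\<in>UNIV. \<Sum>j\<in>UNIV. 4 * f i j z)"
  have f: "integrable (lborel \<Otimes>\<^sub>M lborel) (f i j)" for i j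
    unfolding f_def using U by (intro hart4_integrable) (auto simp: tuples_def)
  then have g: "integrable (lborel \<Otimes>\<^sub>M lborel) g" unfolding g_def by auto
  have "electron_density U r * electron_density U r' / dist r r' = g (r, r')" for r r'
    by (simp add: g_def f_def electron_density_def sum_product sum_divide_distrib sum_distrib_left
        power2_eq_square algebra_simps)
  then have "(LINT r|lborel. LINT r'|lborel. electron_density U r * electron_density U r' / dist r r')
      = integral\<^sup>L (lborel \<Otimes>\<^sub>M lborel) g"
    using lborel_pair.integral_fst'[OF g] by simp
  also have "\<dots> = (\<Sum>i\<in>UNIV. \<Sum>j\<in>UNIV. 4 * hart4 (U i) (U i) (U j) (U j))"
    unfolding g_def using f by (simp add: Bochner_Integration.integral_sum hart4_def f_def)
  finally show ?thesis .
qed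

lemma density_weight:
  assumes "\<And>i. integrable lborel (\<lambda>r. w r * U i r * U i r)"
  shows "(LINT r|lborel. w r * electron_density U r) = (\<Sum>i\<in>UNIV. 2 * l2_inner (\<lambda>r. w r * U i r) (U i))"
    and "integrable lborel (\<lambda>r. w r * electron_density U r)"
proof -
  have eq: "(\<lambda>r. w r * electron_density U r) = (\<lambda>r. \<Sum>i\<in>UNIV. 2 * (w r * U i r * U i r))"
    by (simp add: electron_density_def sum_distrib_left power2_eq_square algebra_simps)
  show "integrable lborel (\<lambda>r. w r * electron_density U r)"
    unfolding eq using assms by auto
  show "(LINT r|lborel. w r * electron_density U r) = (\<Sum>i\<in>UNIV. 2 * l2_inner (\<lambda>r. w r * U i r) (U i))"
    unfolding eq l2_inner_weight using assms by (subst Bochner_Integration.integral_sum) auto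
qed

text \<open>The Kohn-Sham Hamiltonian as a form, including the factor 4 of the gradient. The density
  is frozen at U, so the form is bilinear in u and v although the gradient is nonlinear in
  U.\<close>

definition ham :: "'n::finite orbitals \<Rightarrow> (real^3 \<Rightarrow> real) \<Rightarrow> (real^3 \<Rightarrow> real) \<Rightarrow> real" where
  "ham U u v = 4 * (1/2 * l2_inner (weak_grad u) (weak_grad v)
     + l2_inner (\<lambda>r. Vext r * u r) v
     + l2_inner (\<lambda>r. hartree_potential (electron_density U) r * u r) v
     + l2_inner (\<lambda>r. vxc (electron_density U) r * u r) v)"

lemma vxc_integrable:
  "has_xc_potential V exc vxc U \<Longrightarrow> u \<in> V \<Longrightarrow> v \<in> V \<Longrightarrow> integrable lborel (\<lambda>r. vxc (electron_density U) r * u r * v r)"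
  by (auto simp: has_xc_potential_def)

lemma bilinear_ham:
  assumes "U \<in> tuples V" "has_xc_potential V exc vxc U"
  shows "bilinear_on_V (ham U)"
  unfolding ham_def[abs_def]
  by (intro bilinear_scale bilinear_add bilinear_weak_grad bilinear_weight ext_integrable
      hartree_potential_l2(1) vxc_integrable assms)

lemma ham_commute: "ham U u v = ham U v u"
  unfolding ham_def l2_inner_weight
  by (simp add: l2_inner_commute[of "weak_grad u"] mult.commute mult.left_commute)

lemma energy_eq:
  assumes "U \<in> tuples V"
  shows "energy Vext exc U = (\<Sum>i\<in>UNIV. l2_inner (weak_grad (U i)) (weak_grad (U i)))
    + (\<Sum>i\<in>UNIV. 2 * l2_inner (\<lambda>r. Vext r * U i r) (U i))
    + (\<Sum>i\<in>UNIV. \<Sum>j\<in>UNIV. 2 * hart4 (U i) (U i) (U j) (U j))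
    + xc_energy exc (electron_density U)"
proof -
  have "(LINT r|lborel. Vext r * electron_density U r) = (\<Sum>i\<in>UNIV. 2 * l2_inner (\<lambda>r. Vext r * U i r) (U i))"
    using assms by (intro density_weight ext_integrable) (auto simp: tuples_def)
  then show ?thesis
    unfolding energy_def hartree_energy[OF assms]
    by (simp add: l2_inner_def power2_norm_eq_inner sum_distrib_left mult.assoc[symmetric])
qed

text \<open>\<open>has_xc_potential\<close> linearizes in the density, whose variation is still
  quadratic in the orbitals. So the energy minus the quadratic form weighted by the potential at U
  has derivative 0, and the derivative of that form is the answer.\<close>

lemma frechet_xc:
  assumes U: "U \<in> tuples V" and xc: "has_xc_potential V exc vxc U"
  shows "frechet (\<lambda>U. xc_energy exc (electron_density U))
    (\<lambda>W. \<Sum>i\<in>UNIV. 4 * l2_inner (\<lambda>r. vxc (electron_density U) r * U i r) (W i)) U"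
proof -
  let ?w = "vxc (electron_density U)"
  let ?B = "\<lambda>u v. l2_inner (\<lambda>r. ?w r * u r) v"
  have B: "bilinear_on_V ?B" by (intro bilinear_weight vxc_integrable xc)
  have sym: "?B u v = ?B v u" for u v
    unfolding l2_inner_weight by (simp add: mult.commute mult.left_commute)
  let ?q = "\<lambda>X. \<Sum>i\<in>UNIV. 2 * ?B (X i) (X i)"
  have V: "W \<in> tuples V \<Longrightarrow> W k \<in> V" for W :: "'a orbitals" and k by (simp add: tuples_def)
  have q: "(LINT r|lborel. ?w r * electron_density X r) = ?q X"
    "integrable lborel (\<lambda>r. ?w r * electron_density X r)" if "X \<in> tuples V" for X :: "'a orbitals"
    using V[OF that] by (intro density_weight vxc_integrable xc; blast)+
  have 1: "frechet ?q (\<lambda>W. \<Sum>i\<in>UNIV. 2 * (?B (U i) (W i) + ?B (W i) (U i))) U"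
    by (intro frechet_sum frechet_scale frechet_bilinear[OF B U]) auto
  have 2: "frechet (\<lambda>X. xc_energy exc (electron_density X) - ?q X) (\<lambda>W. 0) U"
    unfolding frechet_def
  proof (intro conjI allI impI ballI)
    fix \<epsilon> :: real assume "\<epsilon> > 0"
    with xc obtain \<delta> where \<delta>: "\<delta> > 0" and r: "\<And>W. W \<in> tuples V \<Longrightarrow> tnorm W < \<delta> \<Longrightarrow>
        \<bar>xc_energy exc (electron_density (U + W)) - xc_energy exc (electron_density U)
          - (LINT r|lborel. ?w r * (electron_density (U + W) r - electron_density U r))\<bar> \<le> \<epsilon> * tnorm W"
      unfolding has_xc_potential_def by blast
    have qq: "(LINT r|lborel. ?w r * (electron_density (U + W) r - electron_density U r)) = ?q (U + W) - ?q U"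
      if "W \<in> tuples V" for W
    proof -
      have "(LINT r|lborel. ?w r * (electron_density (U + W) r - electron_density U r))
          = (LINT r|lborel. ?w r * electron_density (U + W) r - ?w r * electron_density U r)"
        by (simp add: right_diff_distrib)
      also have "\<dots> = ?q (U + W) - ?q U"
        using q[OF U] q[OF tuples_add[OF U that]] by (subst Bochner_Integration.integral_diff) auto
      finally show ?thesis .
    qed
    have "\<bar>(xc_energy exc (electron_density (U + W)) - ?q (U + W)) - (xc_energy exc (electron_density U) - ?q U) - 0\<bar> \<le> \<epsilon> * tnorm W"
      if "W \<in> tuples V" "tnorm W < \<delta>" for W
      using r[OF that] unfolding qq[OF that(1)] by linarith
    with \<delta> show "\<exists>\<delta>>0. \<forall>W\<in>tuples V. tnorm W < \<delta> \<longrightarrow>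
       \<bar>(xc_energy exc (electron_density (U + W)) - ?q (U + W)) - (xc_energy exc (electron_density U) - ?q U) - 0\<bar> \<le> \<epsilon> * tnorm W"
      by blast
  qed (auto intro: exI[of _ 0])
  show ?thesis
    by (rule frechet_cong[OF frechet_add[OF 2 1] U]) (simp_all add: sym[of _ "U _"])
qed

lemma is_energy_gradient_ham:
  "is_energy_gradient V Vext vxc U G \<longleftrightarrow> G \<in> tuples V \<and> (\<forall>i. \<forall>v\<in>V. l2_inner (G i) v = ham U (U i) v)"
  by (simp add: is_energy_gradient_def ham_def)

lemma tuples_eqI:
  assumes "G \<in> tuples V" "G' \<in> tuples V" "\<And>i v. v \<in> V \<Longrightarrow> l2_inner (G i) v = l2_inner (G' i) v"
  shows "G = G'"
proof
  fix i
  have V: "G i \<in> V" "G' i \<in> V" using assms by (auto simp: tuples_def)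
  show "G i = G' i"
    using expand[OF V(1)] expand[OF V(2)] assms(3) e_in by simp
qed

text \<open>Riesz representation in coordinates: the coefficients are the values of the form
  \<open>ham U\<close> at the basis functions. Existence and uniqueness make the definite
  description in \<open>energy_gradient\<close> meaningful.\<close>

lemma energy_gradient:
  assumes U: "U \<in> tuples V" and xc: "has_xc_potential V exc vxc U"
  shows "is_energy_gradient V Vext vxc U (energy_gradient V Vext vxc U)"
  unfolding energy_gradient_def
proof (rule theI'[where P="is_energy_gradient V Vext vxc U"])
  note B = bilinear_ham[OF U xc]
  have V: "U i \<in> V" for i using U by (simp add: tuples_def)
  define G where "G = (\<lambda>i x. \<Sum>k<m. ham U (U i) (e k) * e k x)"
  have G: "G \<in> tuples V" unfolding G_def tuples_def using e_in by (auto intro!: V_sum)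
  have "l2_inner (G i) v = ham U (U i) v" if v: "v \<in> V" for i v
  proof -
    have "l2_inner (G i) v = (\<Sum>k<m. ham U (U i) (e k) * l2_inner (e k) v)"
      unfolding G_def using e_in V_L2 v by (intro l2_inner_sum_left) auto
    also have "\<dots> = (\<Sum>k<m. l2_inner v (e k) * ham U (U i) (e k))"
      by (simp add: l2_inner_commute mult.commute)
    also have "\<dots> = ham U (U i) (\<lambda>x. \<Sum>k<m. l2_inner v (e k) * e k x)"
      using e_in V by (intro bilinear_sum_right[OF B, symmetric]) auto
    also have "\<dots> = ham U (U i) v" using expand[OF v] by simp
    finally show ?thesis .
  qed
  with G have "is_energy_gradient V Vext vxc U G" by (simp add: is_energy_gradient_ham)
  moreover have "G' = G''" if "is_energy_gradient V Vext vxc U G'" "is_energy_gradient V Vext vxc U G''" for G' G''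
    using that by (intro tuples_eqI) (auto simp: is_energy_gradient_ham)
  ultimately show "\<exists>!G. is_energy_gradient V Vext vxc U G" by blast
qed

lemma
  assumes "U \<in> tuples V" "has_xc_potential V exc vxc U"
  shows energy_gradient_tuples: "energy_gradient V Vext vxc U \<in> tuples V"
    and energy_gradient_l2: "v \<in> V \<Longrightarrow> l2_inner (energy_gradient V Vext vxc U i) v = ham U (U i) v"
  using energy_gradient[OF assms] by (auto simp: is_energy_gradient_ham)

text \<open>The factor 4 in the gradient is a 2 from the density times a 2 from differentiating a
  symmetric form; the kinetic term has no density factor, hence its 1/2. In the Hartree term the
  prefactor 1/2 cancels against the symmetry in the two space variables.\<close>

lemma frechet_energy:
  assumes U: "U \<in> tuples V" and xc: "has_xc_potential V exc vxc U"
  shows "frechet (energy Vext exc) (tinner (energy_gradient V Vext vxc U)) U"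
proof -
  have V: "W \<in> tuples V \<Longrightarrow> W k \<in> V" for W :: "'a orbitals" and k by (simp add: tuples_def)
  let ?K = "\<lambda>u v. l2_inner (weak_grad u) (weak_grad v)" and ?E = "\<lambda>u v. l2_inner (\<lambda>r. Vext r * u r) v"
  have E: "bilinear_on_V ?E" by (intro bilinear_weight ext_integrable)
  have symE: "?E u v = ?E v u" for u v
    unfolding l2_inner_weight by (simp add: mult.commute mult.left_commute)
  have "frechet (\<lambda>U. (\<Sum>i\<in>UNIV. ?K (U i) (U i)) + (\<Sum>i\<in>UNIV. 2 * ?E (U i) (U i))
      + (\<Sum>i\<in>UNIV. \<Sum>j\<in>UNIV. 2 * hart4 (U i) (U i) (U j) (U j)) + xc_energy exc (electron_density U))
    (\<lambda>W. (\<Sum>i\<in>UNIV. ?K (U i) (W i) + ?K (W i) (U i)) + (\<Sum>i\<in>UNIV. 2 * (?E (U i) (W i) + ?E (W i) (U i)))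
      + (\<Sum>i\<in>UNIV. \<Sum>j\<in>UNIV. 2 * (2 * hart4 (U i) (W i) (U j) (U j) + 2 * hart4 (U i) (U i) (U j) (W j)))
      + (\<Sum>i\<in>UNIV. 4 * l2_inner (\<lambda>r. vxc (electron_density U) r * U i r) (W i))) U"
    by (intro frechet_add frechet_sum frechet_scale frechet_bilinear[OF bilinear_weak_grad U]
        frechet_bilinear[OF E U] frechet_hart4[OF U] frechet_xc[OF U xc]) auto
  then show ?thesis
  proof (rule frechet_cong[OF _ U])
    fix W :: "'a orbitals" assume W: "W \<in> tuples V"
    let ?h = "\<lambda>i. l2_inner (\<lambda>r. hartree_potential (electron_density U) r * U i r) (W i)"
    \<comment> \<open>Exchanging the two pairs of arguments and then the summation indices shows
      that both halves of the Hartree derivative coincide.\<close>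
    have "(\<Sum>i\<in>UNIV. \<Sum>j\<in>UNIV. hart4 (U i) (U i) (U j) (W j)) = (\<Sum>i\<in>UNIV. \<Sum>j\<in>UNIV. hart4 (U j) (W j) (U i) (U i))"
      using hart4_swap V U W by (intro sum.cong refl) blast
    also have "\<dots> = (\<Sum>i\<in>UNIV. \<Sum>j\<in>UNIV. hart4 (U i) (W i) (U j) (U j))" by (rule sum.swap)
    finally have "(\<Sum>i\<in>UNIV. \<Sum>j\<in>UNIV. 2 * (2 * hart4 (U i) (W i) (U j) (U j) + 2 * hart4 (U i) (U i) (U j) (W j)))
       = 8 * (\<Sum>i\<in>UNIV. \<Sum>j\<in>UNIV. hart4 (U i) (W i) (U j) (U j))"
      by (simp add: sum.distrib sum_distrib_left[symmetric])
    also have "\<dots> = 4 * (\<Sum>i\<in>UNIV. ?h i)"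
      using hartree_potential_l2(2)[OF U V[OF U] V[OF W]] by (simp add: sum_distrib_left[symmetric])
    finally have H: "(\<Sum>i\<in>UNIV. \<Sum>j\<in>UNIV. 2 * (2 * hart4 (U i) (W i) (U j) (U j) + 2 * hart4 (U i) (U i) (U j) (W j)))
       = 4 * (\<Sum>i\<in>UNIV. ?h i)" .
    show "tinner (energy_gradient V Vext vxc U) W = (\<Sum>i\<in>UNIV. ?K (U i) (W i) + ?K (W i) (U i)) + (\<Sum>i\<in>UNIV. 2 * (?E (U i) (W i) + ?E (W i) (U i)))
      + (\<Sum>i\<in>UNIV. \<Sum>j\<in>UNIV. 2 * (2 * hart4 (U i) (W i) (U j) (U j) + 2 * hart4 (U i) (U i) (U j) (W j)))
      + (\<Sum>i\<in>UNIV. 4 * l2_inner (\<lambda>r. vxc (electron_density U) r * U i r) (W i))"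
      unfolding H tinner_eq energy_gradient_l2[OF U xc V[OF W]] ham_def
      by (simp add: l2_inner_commute[of "weak_grad (W _)"] symE[of "W _"] sum.distrib sum_distrib_left algebra_simps)
  qed (rule energy_eq)
qed

text \<open>The entries are values of the symmetric form \<open>ham U\<close> at pairs of orbitals
  of U.\<close>

lemma gram_energy_gradient_symmetric:
  assumes U: "U \<in> tuples V" and xc: "has_xc_potential V exc vxc U"
  shows "transpose (gram U (energy_gradient V Vext vxc U)) = gram U (energy_gradient V Vext vxc U)"
proof -
  have V: "U k \<in> V" for k using U by (simp add: tuples_def)
  show ?thesis
    unfolding gram_def vec_eq_iff transpose_def
    using energy_gradient_l2[OF U xc V] by (simp add: l2_inner_commute[of "U _"] ham_commute[of U "U _" "U _"])
qed

text \<open>The form \<open>ham U\<close> depends on U through the density only, so the rotation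
  leaves the form alone and acts linearly on its orbital argument.\<close>

lemma energy_gradient_tmul:
  assumes U: "U \<in> tuples V" and xc: "has_xc_potential V exc vxc U" "has_xc_potential V exc vxc (tmul U P)"
    and P: "orthogonal_matrix P"
  shows "energy_gradient V Vext vxc (tmul U P) = tmul (energy_gradient V Vext vxc U) P"
proof (rule tuples_eqI)
  let ?G = "energy_gradient V Vext vxc"
  have V: "U k \<in> V" "?G U k \<in> V" for k
    using U energy_gradient_tuples[OF U xc(1)] by (auto simp: tuples_def)
  fix i v assume v: "v \<in> V"
  have "ham (tmul U P) = ham U" by (simp add: ham_def[abs_def] electron_density_tmul[OF P])
  then have "l2_inner (?G (tmul U P) i) v = ham U (tmul U P i) v"
    using energy_gradient_l2[OF tuples_tmul[OF U] xc(2) v] by simp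
  also have "\<dots> = (\<Sum>j\<in>UNIV. P $ j $ i * ham U (U j) v)"
    unfolding tmul_def using V v by (intro bilinear_sum_left[OF bilinear_ham[OF U xc(1)]]) auto
  also have "\<dots> = (\<Sum>j\<in>UNIV. P $ j $ i * l2_inner (?G U j) v)"
    using energy_gradient_l2[OF U xc(1) v] by simp
  also have "\<dots> = l2_inner (tmul (?G U) P i) v"
    unfolding tmul_def using V V_L2 v by (intro l2_inner_sum_left[symmetric]) auto
  finally show "l2_inner (?G (tmul U P) i) v = l2_inner (tmul (?G U) P i) v" .
qed (use U xc energy_gradient_tuples tuples_tmul in auto)

lemma energy_tmul:
  assumes U: "U \<in> tuples V" and P: "orthogonal_matrix P"
  shows "energy Vext exc (tmul U P) = energy Vext exc U"
proof -
  have "(\<Sum>i\<in>UNIV. l2_inner (weak_grad (tmul U P i)) (weak_grad (tmul U P i))) =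
      (\<Sum>i\<in>UNIV. l2_inner (weak_grad (U i)) (weak_grad (U i)))"
    by (rule bilinear_orthogonal_invariant[OF bilinear_weak_grad U U P])
  then show ?thesis
    by (simp add: energy_def electron_density_tmul[OF P] l2_inner_def power2_norm_eq_inner)
qed

end

section \<open>The orbit metric and critical points\<close>

lemma tmul_assoc: "tmul (tmul U A) B = tmul U (A ** B)"
proof (intro ext)
  fix i r
  have "tmul (tmul U A) B i r = (\<Sum>j\<in>UNIV. \<Sum>k\<in>UNIV. B $ j $ i * (A $ k $ j * U k r))"
    by (simp add: tmul_def sum_distrib_left)
  also have "\<dots> = (\<Sum>k\<in>UNIV. \<Sum>j\<in>UNIV. B $ j $ i * (A $ k $ j * U k r))" by (rule sum.swap)
  also have "\<dots> = tmul U (A ** B) i r"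
    by (simp add: tmul_def matrix_matrix_mult_def sum_distrib_right mult.assoc mult.left_commute)
  finally show "tmul (tmul U A) B i r = tmul U (A ** B) i r" .
qed

lemma tmul_mat_1 [simp]: "tmul U (mat 1) = U"
  by (simp add: tmul_def mat_def fun_eq_iff if_distrib[of "\<lambda>x. x * _"] cong: if_cong)

lemma tmul_diff: "tmul (U - W) P = tmul U P - tmul W P"
  by (simp add: tmul_def fun_eq_iff right_diff_distrib sum_subtractf)

lemma transpose_gram: "transpose (gram U W) = gram W U"
  by (simp add: transpose_def gram_def vec_eq_iff l2_inner_commute)

lemma orthogonal_transpose_mult:
  assumes "orthogonal_matrix P"
  shows "P ** transpose P = mat 1" "transpose P ** P = mat 1"
  using assms by (auto simp: orthogonal_matrix_def)

lemma tmul_orthogonal_cancel: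
  assumes "orthogonal_matrix P"
  shows "tmul (tmul U P) (transpose P) = U" "tmul (tmul U (transpose P)) P = U"
  using assms by (simp_all add: tmul_assoc orthogonal_transpose_mult)

section \<open>The distance between orbits\<close>

lemma cdist_nonneg: "0 \<le> cdist U W"
  unfolding cdist_def by (rule cINF_greatest) (auto simp: tnorm_nonneg intro: orthogonal_matrix_id)

lemma cdist_le: "orthogonal_matrix P \<Longrightarrow> cdist U W \<le> tnorm (U - tmul W P)"
  unfolding cdist_def by (rule cINF_lower) (auto intro!: bdd_belowI[of _ 0] simp: tnorm_nonneg)

lemma cdist_greatest: "(\<And>P. orthogonal_matrix P \<Longrightarrow> d \<le> tnorm (U - tmul W P)) \<Longrightarrow> d \<le> cdist U W"
  unfolding cdist_def by (rule cINF_greatest) (auto intro: orthogonal_matrix_id)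

lemma cdist_lessE:
  assumes "cdist U W < d"
  obtains P where "orthogonal_matrix P" "tnorm (U - tmul W P) < d"
  using assms cdist_greatest[of d U W] by (meson not_le)

text \<open>Translation by P permutes the group over which the infimum runs. One inequality, applied
  to P and to its transpose, gives both directions.\<close>

lemma cdist_tmul_right:
  assumes P: "orthogonal_matrix P" shows "cdist U (tmul W P) = cdist U W"
proof -
  have le: "cdist U (tmul W P) \<le> cdist U W" if P: "orthogonal_matrix P" for P and W :: "'a orbitals"
  proof (rule cdist_greatest)
    fix Q :: "real^'a^'a" assume Q: "orthogonal_matrix Q"
    have "orthogonal_matrix (transpose P ** Q)"
      using P Q by (simp add: orthogonal_matrix_mul orthogonal_matrix_transpose)
    from cdist_le[OF this, of U "tmul W P"] show "cdist U (tmul W P) \<le> tnorm (U - tmul W Q)"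
      using P by (simp add: tmul_assoc matrix_mul_assoc orthogonal_transpose_mult)
  qed
  have "cdist U W \<le> cdist U (tmul W P)"
    using le[of "transpose P" "tmul W P"] P by (simp add: tmul_orthogonal_cancel orthogonal_matrix_transpose)
  with le[OF P] show ?thesis by (simp add: antisym)
qed

lemma self_in_cls: "U \<in> cls U"
  unfolding cls_def by (auto intro!: exI[of _ "mat 1"] simp: orthogonal_matrix_id)

lemma cls_eqE:
  assumes "cls W = cls U"
  obtains P where "orthogonal_matrix P" "W = tmul U P"
  using assms self_in_cls[of W] by (auto simp: cls_def)

context orthonormal_space
begin

lemma gram_tmul_right:
  assumes "U \<in> tuples V" "W \<in> tuples V"
  shows "gram U (tmul W P) = gram U W ** P"
proof -
  have V: "U k \<in> V" "W k \<in> V" for k using assms by (auto simp: tuples_def)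
  have "l2_inner (U i) (tmul W P j) = (\<Sum>k\<in>UNIV. P $ k $ j * l2_inner (U i) (W k))" for i j
    unfolding tmul_def using V by (intro bilinear_sum_right[OF bilinear_l2_inner]) auto
  then show ?thesis by (simp add: gram_def matrix_matrix_mult_def vec_eq_iff mult.commute)
qed

lemma gram_tmul_left:
  assumes "U \<in> tuples V" "W \<in> tuples V"
  shows "gram (tmul U P) W = transpose P ** gram U W"
  using arg_cong[OF gram_tmul_right[OF assms(2,1), of P], of transpose]
  by (simp add: transpose_gram matrix_transpose_mul)

lemma gram_diff_right:
  assumes "U \<in> tuples V" "W \<in> tuples V" "X \<in> tuples V"
  shows "gram U (W - X) = gram U W - gram U X"
proof -
  have V: "U k \<in> V" "W k \<in> V" "X k \<in> V" for k using assms by (auto simp: tuples_def)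
  have "l2_inner (U i) ((W - X) j) = l2_inner (U i) (W j) - l2_inner (U i) (X j)" for i j
    using bilinear_right[OF bilinear_l2_inner V(2)[of j] V(3)[of j] V(1)[of i], of 1 "-1"]
    by (simp add: fun_diff_def)
  then show ?thesis by (simp add: gram_def vec_eq_iff)
qed

lemma in_discrete_stiefel: "W \<in> tuples V \<inter> stiefel \<longleftrightarrow> W \<in> tuples V \<and> gram W W = mat 1"
  using V_H1 by (auto simp: stiefel_def tuples_def)

lemma discrete_stiefelD:
  "W \<in> tuples V \<inter> stiefel \<Longrightarrow> W \<in> tuples V"
  "W \<in> tuples V \<inter> stiefel \<Longrightarrow> gram W W = mat 1"
  by (simp_all only: in_discrete_stiefel)

lemma discrete_stiefel_tmul:
  assumes "W \<in> tuples V \<inter> stiefel" "orthogonal_matrix P"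
  shows "tmul W P \<in> tuples V \<inter> stiefel"
  using assms unfolding in_discrete_stiefel
  by (simp add: tuples_tmul gram_tmul_left gram_tmul_right orthogonal_transpose_mult)

lemma tnorm_discrete_stiefel:
  fixes W :: "'n::finite orbitals"
  assumes "W \<in> tuples V \<inter> stiefel" shows "tnorm W = sqrt (real CARD('n))"
  using discrete_stiefelD(2)[OF assms] by (simp add: tnorm_def tinner_def trace_def mat_def)

lemma cdist_commute:
  assumes "U \<in> tuples V" "W \<in> tuples V" shows "cdist U W = cdist W U"
proof -
  have le: "cdist U W \<le> cdist W U" if UW: "U \<in> tuples V" "W \<in> tuples V" for U W :: "'a orbitals"
  proof (rule cdist_greatest)
    fix P :: "real^'a^'a" assume P: "orthogonal_matrix P"
    then have P': "orthogonal_matrix (transpose P)" by (simp add: orthogonal_matrix_transpose)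
    have "tnorm (W - tmul U P) = tnorm (tmul (W - tmul U P) (transpose P))"
      using UW P' by (simp add: tnorm_tmul tuples_diff tuples_tmul)
    also have "\<dots> = tnorm (U - tmul W (transpose P))"
      using P by (simp add: tmul_diff tmul_orthogonal_cancel tnorm_minus_commute)
    finally show "cdist U W \<le> tnorm (W - tmul U P)" using cdist_le[OF P'] by simp
  qed
  from le[OF assms] le[OF assms(2,1)] show ?thesis by (rule antisym)
qed

text \<open>The mixed form, an orbit distance plus a plain norm, is the one that yields Lipschitz
  continuity along curves and sequences. The same P serves in both summands because right
  multiplication by it is an isometry.\<close>

lemma cdist_triangle:
  assumes "U \<in> tuples V" "W \<in> tuples V" "X \<in> tuples V"
  shows "cdist U X \<le> cdist U W + tnorm (W - X)"
proof -
  have "cdist U X - tnorm (W - X) \<le> cdist U W"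
  proof (rule cdist_greatest)
    fix P :: "real^'a^'a" assume P: "orthogonal_matrix P"
    have "cdist U X \<le> tnorm (U - tmul X P)" by (rule cdist_le[OF P])
    also have "\<dots> \<le> tnorm (U - tmul W P) + tnorm (tmul W P - tmul X P)"
      using assms by (intro tnorm_triangle_diff tuples_tmul)
    also have "tnorm (tmul W P - tmul X P) = tnorm (W - X)"
      using tnorm_tmul[OF tuples_diff[OF assms(2,3)] P] by (simp add: tmul_diff)
    finally show "cdist U X - tnorm (W - X) \<le> tnorm (U - tmul W P)" by linarith
  qed
  then show ?thesis by simp
qed

lemma cdist_lipschitz:
  assumes "U \<in> tuples V" "W \<in> tuples V" "X \<in> tuples V"
  shows "\<bar>cdist U W - cdist U X\<bar> \<le> tnorm (W - X)"
  using cdist_triangle[OF assms] cdist_triangle[OF assms(1,3,2)] by (simp add: tnorm_minus_commute[of X W])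

lemma cdist_le_tnorm: "cdist U W \<le> tnorm (U - W)"
  using cdist_le[OF orthogonal_matrix_id, of U W] by simp

lemma cdist_self: "cdist U U = 0"
  using cdist_le_tnorm[of U U] cdist_nonneg[of U U] by simp

lemma cdist_cls_eq: "cls W = cls U \<Longrightarrow> cdist U W = 0"
  by (erule cls_eqE) (simp add: cdist_tmul_right cdist_self)

text \<open>The ball of classes is defined through some representative; since the distance is
  constant on orbits, W itself can be tested.\<close>

lemma cls_in_class_ball:
  assumes "W \<in> tuples V \<inter> stiefel"
  shows "cls W \<in> class_ball V U d \<longleftrightarrow> cdist U W \<le> d"
proof
  assume "cls W \<in> class_ball V U d"
  then obtain X where "cls W = cls X" "cdist U X \<le> d" by (auto simp: class_ball_def)
  then show "cdist U W \<le> d" by (metis cls_eqE cdist_tmul_right)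
next
  assume "cdist U W \<le> d"
  then show "cls W \<in> class_ball V U d" using assms unfolding class_ball_def by blast
qed

lemma tlim_cdist:
  assumes "tlim W L" "U \<in> tuples V"
  shows "(\<lambda>k. cdist U (W k)) \<longlonglongrightarrow> cdist U L"
proof -
  have "(\<lambda>k. cdist U (W k) - cdist U L) \<longlonglongrightarrow> 0"
    by (rule Lim_null_comparison[where g="\<lambda>k. tnorm (W k - L)"])
       (use assms cdist_lipschitz[OF assms(2)] in \<open>simp_all add: tlim_def\<close>)
  then show ?thesis using Lim_null by blast
qed

lemma tlim_frechet:
  assumes "tlim W L" "frechet F D L" shows "(\<lambda>k. F (W k)) \<longlonglongrightarrow> F L"
  using assms by (intro frechet_continuous[OF assms(2)]) (auto simp: tlim_def)

lemma tlim_tmul: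
  assumes "tlim W L" "orthogonal_matrix P" shows "tlim (\<lambda>k. tmul (W k) P) (tmul L P)"
  using assms by (simp add: tlim_def tuples_tmul tmul_diff[symmetric] tnorm_tmul tuples_diff)

lemma tlim_l2_inner:
  assumes "tlim X Y" "tlim G H"
  shows "(\<lambda>k. l2_inner (X k i) (G k j)) \<longlonglongrightarrow> l2_inner (Y i) (H j)"
proof -
  have V: "X k i \<in> V" "Y i \<in> V" "G k j \<in> V" "H j \<in> V" for k i j
    using assms by (auto simp: tlim_def tuples_def)
  have c: "(\<lambda>k. l2_inner (Z k i) (e p)) \<longlonglongrightarrow> l2_inner (T i) (e p)" if "tlim Z T" "p < m" for Z T i p
  proof -
    have T: "Z k \<in> tuples V" "T \<in> tuples V" for k using that by (auto simp: tlim_def)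
    then have Zi: "Z k i \<in> V" "T i \<in> V" for k by (auto simp: tuples_def)
    have "\<bar>l2_inner (Z k i) (e p) - l2_inner (T i) (e p)\<bar> \<le> tnorm (Z k - T)" for k
    proof -
      have d: "(Z k - T) i \<in> V" using tuples_diff[OF T(1) T(2), of k] by (simp add: tuples_def)
      have "l2_inner ((Z k - T) i) (e p) = l2_inner (Z k i) (e p) - l2_inner (T i) (e p)"
        using bilinear_left[OF bilinear_l2_inner Zi(1)[of k] Zi(2) e_in[OF that(2)], of 1 "-1"]
        by (simp add: fun_diff_def)
      then show ?thesis
        using order_trans[OF vnorm_coord_le[OF d that(2)] vnorm_le_tnorm[of "Z k - T" i]] by simp
    qed
    then have "eventually (\<lambda>k. norm (l2_inner (Z k i) (e p) - l2_inner (T i) (e p)) \<le> tnorm (Z k - T)) sequentially"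
      by simp
    moreover have "(\<lambda>k. tnorm (Z k - T)) \<longlonglongrightarrow> 0" using that(1) by (simp only: tlim_def)
    ultimately have "(\<lambda>k. l2_inner (Z k i) (e p) - l2_inner (T i) (e p)) \<longlonglongrightarrow> 0"
      by (rule Lim_null_comparison)
    then show ?thesis using Lim_null by blast
  qed
  show ?thesis
    unfolding parseval[OF V(1,3)] parseval[OF V(2,4)]
    by (intro tendsto_sum tendsto_mult c assms) auto
qed

lemma tlim_discrete_stiefel:
  assumes "tlim W L" "\<And>k. W k \<in> tuples V \<inter> stiefel" shows "L \<in> tuples V \<inter> stiefel"
proof -
  have "l2_inner (L i) (L j) = mat 1 $ i $ j" for i j
  proof (rule LIMSEQ_unique[OF tlim_l2_inner[OF assms(1,1)]])
    have "gram (W k) (W k) = mat 1" for k using assms(2) by (rule discrete_stiefelD)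
    then have "gram (W k) (W k) $ i $ j = mat 1 $ i $ j" for k by simp
    then have "l2_inner (W k i) (W k j) = mat 1 $ i $ j" for k by (simp add: gram_def)
    then show "(\<lambda>k. l2_inner (W k i) (W k j)) \<longlonglongrightarrow> mat 1 $ i $ j" by simp
  qed
  then have "gram L L = mat 1" by (simp add: gram_def vec_eq_iff)
  then show ?thesis unfolding in_discrete_stiefel using assms(1) by (simp add: tlim_def)
qed

text \<open>Orthonormal tuples all have the same norm, and orthonormality survives limits.\<close>

lemma discrete_stiefel_compact:
  fixes W :: "nat \<Rightarrow> 'n::finite orbitals"
  assumes "\<And>k. W k \<in> tuples V \<inter> stiefel"
  obtains r L where "strict_mono r" "tlim (W \<circ> r) L" "L \<in> tuples V \<inter> stiefel"
proof -
  have "W k \<in> tuples V" "tnorm (W k) \<le> sqrt (real CARD('n))" for k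
    using assms tnorm_discrete_stiefel[OF assms] by auto
  then obtain r L where "strict_mono r" "tlim (W \<circ> r) L"
    by (rule bounded_tuples_convergent_subseq)
  then show thesis using that tlim_discrete_stiefel[of "W \<circ> r" L] assms by simp
qed

lemma tnorm_tcomb_le:
  assumes "U \<in> tuples V" "W \<in> tuples V"
  shows "tnorm (tcomb a U b W) \<le> \<bar>a\<bar> * tnorm U + \<bar>b\<bar> * tnorm W"
proof -
  have t: "(\<lambda>i x. a * U i x) \<in> tuples V" "(\<lambda>i x. b * W i x) \<in> tuples V"
    using tuples_tcomb[OF assms(1,1), of a 0] tuples_tcomb[OF assms(2,2), of b 0] by simp_all
  have "tcomb a U b W = (\<lambda>i x. a * U i x) + (\<lambda>i x. b * W i x)" by (simp add: fun_eq_iff)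
  then show ?thesis using tnorm_triangle[OF t] assms by (simp add: tnorm_scale)
qed

end

section \<open>The Grassmann gradient and critical points\<close>

context energy_space
begin

abbreviation eg :: "'n::finite orbitals \<Rightarrow> 'n orbitals" where
  "eg \<equiv> energy_gradient V Vext vxc"

abbreviation gg :: "'n::finite orbitals \<Rightarrow> 'n orbitals" where
  "gg \<equiv> grassmann_gradient V Vext vxc"

context
  fixes W :: "'n::finite orbitals"
  assumes W: "W \<in> tuples V" and xc: "has_xc_potential V exc vxc W"
begin

lemma grassmann_gradient_tuples: "gg W \<in> tuples V"
  unfolding grassmann_gradient_def
  using W energy_gradient_tuples[OF W xc] by (intro tuples_diff tuples_tmul)

lemma gram_grassmann_gradient:
  "gram W (gg W) = gram W (eg W) ** gram W W - gram W W ** gram W (eg W)"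
  unfolding grassmann_gradient_def
  using W energy_gradient_tuples[OF W xc] by (simp add: gram_diff_right gram_tmul_right tuples_tmul)

text \<open>W is not assumed orthonormal here: the factor \<open>gram U U\<close> in the extended
  gradient makes the commutator appear off the Stiefel manifold too. This avoids circularity when
  the flow is shown to stay on it.\<close>

lemma gram_grassmann_gradient_skew:
  "gram W (gg W) + gram (gg W) W = 0"
proof -
  have G: "transpose (gram W W) = gram W W" by (rule transpose_gram)
  have "gram (gg W) W = transpose (gram W (gg W))" by (simp add: transpose_gram)
  also have "\<dots> = gram W W ** gram W (eg W) - gram W (eg W) ** gram W W"
  proof -
    have tr: "transpose (A - B) = transpose A - transpose B" for A B :: "real^'n^'n"
      by (simp add: transpose_def vec_eq_iff)
    show ?thesis unfolding gram_grassmann_gradient tr matrix_transpose_mul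
      by (simp only: G gram_energy_gradient_symmetric[OF W xc])
  qed
  finally show ?thesis by (simp add: gram_grassmann_gradient)
qed

context
  assumes stiefel: "gram W W = mat 1"
begin

lemma grassmann_gradient_stiefel: "gg W = eg W - tmul W (gram W (eg W))"
  by (simp add: grassmann_gradient_def stiefel)

lemma grassmann_gradient_orthogonal: "l2_inner (W i) (gg W j) = 0"
proof -
  have "gram W (gg W) $ i $ j = 0" unfolding gram_grassmann_gradient stiefel by simp
  then show ?thesis by (simp add: gram_def)
qed

text \<open>The two gradients differ by combinations of the orbitals of W, to which every component
  of \<open>gg W\<close> is orthogonal.\<close>

lemma l2_energy_grassmann_gradient: "l2_inner (eg W i) (gg W j) = l2_inner (gg W i) (gg W j)"
proof -
  have t: "gg W \<in> tuples V" "eg W \<in> tuples V"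
    using grassmann_gradient_tuples energy_gradient_tuples[OF W xc] by auto
  have 0: "gram (gg W) W = 0" using grassmann_gradient_orthogonal
    by (simp add: gram_def vec_eq_iff l2_inner_commute)
  have "gram (gg W) (gg W) = gram (gg W) (eg W) - gram (gg W) W ** gram W (eg W)"
    using gram_diff_right[OF t(1) t(2) tuples_tmul[OF W], of "gram W (eg W)"] gram_tmul_right[OF t(1) W, of "gram W (eg W)"]
    by (simp only: grassmann_gradient_stiefel[symmetric])
  then have "gram (gg W) (gg W) $ j $ i = gram (gg W) (eg W) $ j $ i" by (simp add: 0)
  then show ?thesis by (simp add: gram_def l2_inner_commute)
qed

lemma tinner_energy_grassmann_gradient: "tinner (eg W) (gg W) = (tnorm (gg W))\<^sup>2"
  by (simp add: tnorm_power2 tinner_eq l2_energy_grassmann_gradient)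

text \<open>Pythagoras for the projection away from the span of the orbitals. It expresses the norm
  by inner products of W and \<open>eg W\<close>, so that limits can be taken factor by
  factor.\<close>

lemma tnorm_grassmann_gradient:
  "(tnorm (gg W))\<^sup>2 = (tnorm (eg W))\<^sup>2 - (\<Sum>i\<in>UNIV. \<Sum>j\<in>UNIV. (l2_inner (W j) (eg W i))\<^sup>2)"
proof -
  have t: "eg W \<in> tuples V" by (rule energy_gradient_tuples[OF W xc])
  have "gram (eg W) (gg W) = gram (eg W) (eg W) - gram (eg W) W ** gram W (eg W)"
    using gram_diff_right[OF t t tuples_tmul[OF W]] gram_tmul_right[OF t W]
    by (simp add: grassmann_gradient_stiefel)
  then have "tinner (eg W) (gg W) = (\<Sum>i\<in>UNIV. (gram (eg W) (eg W) - gram (eg W) W ** gram W (eg W)) $ i $ i)"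
    by (simp add: tinner_def trace_def)
  also have "\<dots> = tinner (eg W) (eg W) - (\<Sum>i\<in>UNIV. \<Sum>j\<in>UNIV. (l2_inner (W j) (eg W i))\<^sup>2)"
    by (simp add: tinner_def trace_def sum_subtractf matrix_matrix_mult_def gram_def power2_eq_square
        l2_inner_commute)
  finally show ?thesis by (simp add: tinner_energy_grassmann_gradient tnorm_power2)
qed

end
end

text \<open>The matrix of inner products is conjugated to P^T M P, and its P^T cancels against the P
  of the rotated tuple, so both terms of the gradient rotate by P.\<close>

lemma grassmann_gradient_tmul:
  assumes W: "W \<in> tuples V \<inter> stiefel" and P: "orthogonal_matrix P"
    and xc: "has_xc_potential V exc vxc W" "has_xc_potential V exc vxc (tmul W P)"
  shows "gg (tmul W P) = tmul (gg W) P"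
proof -
  note t = discrete_stiefelD[OF W] energy_gradient_tuples[OF discrete_stiefelD(1)[OF W] xc(1)]
  note t' = discrete_stiefelD[OF discrete_stiefel_tmul[OF W P]]
  have "gram (tmul W P) (eg (tmul W P)) = transpose P ** gram W (eg W) ** P"
    using t by (simp add: energy_gradient_tmul[OF t(1) xc P] gram_tmul_left gram_tmul_right tuples_tmul matrix_mul_assoc)
  then have "tmul (tmul W P) (gram (tmul W P) (eg (tmul W P))) = tmul (tmul W (gram W (eg W))) P"
    using P by (simp add: tmul_assoc matrix_mul_assoc orthogonal_transpose_mult)
  then show ?thesis
    unfolding grassmann_gradient_stiefel[OF t'(1) xc(2) t'(2)] grassmann_gradient_stiefel[OF t(1) xc(1) t(2)]
    by (simp add: energy_gradient_tmul[OF t(1) xc P] tmul_diff)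
qed

text \<open>If \<open>gg W\<close> has a nonzero component \<open>i\<close>, it is orthogonal to all orbitals of \<open>W\<close>; rotating
  the orbital \<open>i\<close> towards it stays in the Stiefel manifold and changes the energy at first order.\<close>

lemma local_minimum_critical:
  fixes W :: "'n::finite orbitals"
  assumes WS: "W \<in> tuples V \<inter> stiefel" and xc: "has_xc_potential V exc vxc W"
    and \<rho>: "\<rho> > 0" and min: "\<And>X. X \<in> tuples V \<inter> stiefel \<Longrightarrow> tnorm (X - W) < \<rho> \<Longrightarrow>
      energy Vext exc W \<le> energy Vext exc X"
  shows "gg W = 0"
proof (rule ccontr)
  assume "gg W \<noteq> 0"
  then obtain i where i: "gg W i \<noteq> 0" by (auto simp: fun_eq_iff)
  note W = discrete_stiefelD[OF WS]
  have WV: "W j \<in> V" for j using W(1) by (simp add: tuples_def)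
  have gV: "gg W i \<in> V" using grassmann_gradient_tuples[OF W(1) xc] by (simp add: tuples_def)
  define c where "c = vnorm (gg W i)"
  have "l2_inner (gg W i) (gg W i) \<noteq> 0" using i V_eq_0[OF gV] by blast
  then have c: "c > 0" "c * c = l2_inner (gg W i) (gg W i)"
    using l2_inner_self_nonneg[of "gg W i"] by (auto simp: c_def vnorm_def)
  define v where "v = (\<lambda>x. 1/c * gg W i x + 0 * gg W i x)"
  have vV: "v \<in> V" unfolding v_def by (rule V_lincomb[OF gV gV])
  have iv: "l2_inner u v = 1/c * l2_inner u (gg W i)" if "u \<in> V" for u
    unfolding v_def using bilinear_right[OF bilinear_l2_inner gV gV that, of "1/c" 0] by simp
  have Wv: "l2_inner (W j) v = 0" for j
    using iv[OF WV] grassmann_gradient_orthogonal[OF W(1) xc W(2)] by simp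
  have vv: "l2_inner v v = 1"
  proof -
    have "l2_inner v (gg W i) = c"
      using iv[OF gV] c(1) unfolding c(2)[symmetric] l2_inner_commute[of v "gg W i"] by simp
    then show ?thesis using iv[OF vV] c(1) by simp
  qed
  have WW: "l2_inner (W j) (W k) = (if j = k then 1 else 0)" for j k
  proof -
    have "gram W W $ j $ k = mat 1 $ j $ k" using W by simp
    then show ?thesis by (simp add: gram_def mat_def)
  qed
  define X where "X = (\<lambda>s j x. if j = i then cos s * W i x + sin s * v x else W j x)"
  have X: "X s j = (if j = i then (\<lambda>x. cos s * W i x + sin s * v x) else W j)" for s j
    by (simp add: X_def)
  have Xt: "X s \<in> tuples V" for s
    unfolding tuples_def X using WV V_lincomb[OF WV vV] by simp
  have Xu: "l2_inner (X s i) u = cos s * l2_inner (W i) u + sin s * l2_inner v u" if "u \<in> V" for s u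
    unfolding X using bilinear_left[OF bilinear_l2_inner WV vV that] by simp
  have XS: "X s \<in> tuples V \<inter> stiefel" for s
  proof -
    have XV: "X s j \<in> V" for j using Xt by (simp add: tuples_def)
    have "l2_inner (X s i) (W j) = cos s * (if i = j then 1 else 0)" for j
      using Xu[OF WV] WW Wv by (simp add: l2_inner_commute[of v])
    moreover have "l2_inner (X s i) v = sin s" using Xu[OF vV] Wv vv by simp
    moreover have "l2_inner (X s i) (X s i) = cos s * l2_inner (X s i) (W i) + sin s * l2_inner (X s i) v"
      using Xu[OF XV[of i]] by (simp add: l2_inner_commute)
    ultimately have ii: "l2_inner (X s i) (X s i) = 1"
      and ij: "j \<noteq> i \<Longrightarrow> l2_inner (X s i) (W j) = 0" for j
      by (auto simp: power2_eq_square[symmetric])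
    have "l2_inner (X s j) (X s k) = (if j = k then 1 else 0)" for j k
      using ii ij[of j] ij[of k] WW X[of s j] X[of s k]
      by (cases "j = i"; cases "k = i") (auto simp: l2_inner_commute)
    then show ?thesis
      unfolding in_discrete_stiefel using Xt by (simp add: gram_def mat_def vec_eq_iff)
  qed
  define D where "D = (\<lambda>j. if j = i then v else (\<lambda>x. 0))"
  \<comment> \<open>The error of the difference quotient is \<open>(cos h - 1) / h\<close> times Z
    plus \<open>sin h / h - 1\<close> times D, and both coefficients tend to 0.\<close>
  define Z where "Z = (\<lambda>j. if j = i then W i else (\<lambda>x. 0))"
  have D: "D \<in> tuples V" and Z: "Z \<in> tuples V"
    using vV WV V_zero by (auto simp: D_def Z_def tuples_def)
  have X0: "X 0 = W" by (simp add: X_def fun_eq_iff)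
  have "tderiv X D 0"
    unfolding tderiv_def
  proof (intro conjI)
    have "(\<lambda>j r. (X (0 + h) j r - X 0 j r) / h) - D = tcomb ((cos h - 1) / h) Z (sin h / h - 1) D" for h
      by (simp add: X_def D_def Z_def fun_eq_iff algebra_simps diff_divide_distrib add_divide_distrib)
    note quot = this
    have bound: "norm (tnorm ((\<lambda>j r. (X (0 + h) j r - X 0 j r) / h) - D))
        \<le> \<bar>(cos h - 1) / h\<bar> * tnorm Z + \<bar>sin h / h - 1\<bar> * tnorm D" for h
      unfolding quot using tnorm_tcomb_le[OF Z D, of "(cos h - 1) / h" "sin h / h - 1"]
      by (simp only: real_norm_def abs_of_nonneg[OF tnorm_nonneg])
    have "((\<lambda>h. (cos h - 1) / h) \<longlongrightarrow> 0) (at (0::real))" "((\<lambda>h. sin h / h) \<longlongrightarrow> 1) (at (0::real))"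
      using DERIV_cos[of "0::real"] DERIV_sin[of "0::real"] by (simp_all add: DERIV_def)
    then have lim: "((\<lambda>h. \<bar>(cos h - 1) / h\<bar> * tnorm Z + \<bar>sin h / h - 1\<bar> * tnorm D) \<longlongrightarrow> \<bar>0\<bar> * tnorm Z + \<bar>1 - 1\<bar> * tnorm D) (at 0)"
      by (intro tendsto_intros)
    show "((\<lambda>h. tnorm ((\<lambda>j r. (X (0 + h) j r - X 0 j r) / h) - D)) \<longlongrightarrow> 0) (at 0)"
    proof (rule Lim_null_comparison[OF always_eventually[OF allI[OF bound]]])
      show "((\<lambda>h. \<bar>(cos h - 1) / h\<bar> * tnorm Z + \<bar>sin h / h - 1\<bar> * tnorm D) \<longlongrightarrow> 0) (at 0)"
        using lim by simp
    qed
  qed (use D Xt in auto)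
  note d = this
  have "((\<lambda>s. energy Vext exc (X s)) has_real_derivative tinner (eg W) D) (at 0)"
    using frechet_chain[OF _ d] frechet_energy[OF W(1) xc] X0 by simp
  moreover have "tinner (eg W) D = c"
  proof -
    have egV: "eg W i \<in> V" using energy_gradient_tuples[OF W(1) xc] by (simp add: tuples_def)
    have "l2_inner (eg W j) (D j) = (if j = i then l2_inner (eg W i) v else 0)" for j
      by (simp add: D_def l2_inner_def)
    then have "tinner (eg W) D = l2_inner (eg W i) v" by (simp add: tinner_eq)
    also have "\<dots> = c"
      using iv[OF egV] c(1)
      unfolding l2_energy_grassmann_gradient[OF W(1) xc W(2), of i i] c(2)[symmetric] by simp
    finally show ?thesis .
  qed
  moreover have "eventually (\<lambda>s. energy Vext exc (X 0) \<le> energy Vext exc (X s)) (at 0)"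
  proof -
    have "eventually (\<lambda>s. tnorm (X (0 + s) - X 0) < \<rho>) (at 0)"
      using tderiv_increment(2)[OF d] \<rho> by (rule order_tendstoD)
    then show ?thesis by eventually_elim (use min XS X0 in auto)
  qed
  then obtain \<delta> where "\<delta> > 0" "\<forall>s. \<bar>0 - s\<bar> < \<delta> \<longrightarrow> energy Vext exc (X 0) \<le> energy Vext exc (X s)"
    by (auto simp: eventually_at dist_real_def) (metis order_refl)
  ultimately have "c = 0" using DERIV_local_min by blast
  with c show False by simp
qed

end

section \<open>The gradient flow near the minimizer\<close>

text \<open>If the limit failed, there would be times t k beyond k with values at least some fixed
  \<epsilon>, and then no choice of indices from them could give limit 0. Convergence in time is
  thus reduced to compactness of sequences.\<close>

lemma tendsto_zero_by_sequences:
  fixes f :: "real \<Rightarrow> real"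
  assumes nonneg: "\<And>t. 0 \<le> f t"
    and sub: "\<And>t. filterlim t at_top sequentially \<Longrightarrow> (\<And>k. t k \<ge> 0) \<Longrightarrow> \<exists>r :: nat \<Rightarrow> nat. (\<lambda>k. f (t (r k))) \<longlonglongrightarrow> 0"
  shows "(f \<longlongrightarrow> 0) at_top"
proof (rule ccontr)
  assume "\<not> ?thesis"
  then obtain \<epsilon> where \<epsilon>: "\<epsilon> > 0" "\<not> eventually (\<lambda>t. dist (f t) 0 < \<epsilon>) at_top"
    by (auto simp: tendsto_iff)
  then have "\<forall>k. \<exists>t\<ge>real k. \<epsilon> \<le> f t"
    using nonneg by (fastforce simp: eventually_at_top_linorder not_less)
  then obtain t where t: "\<And>k. t k \<ge> real k" "\<And>k. \<epsilon> \<le> f (t k)" by metis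
  have "filterlim t at_top sequentially"
    by (rule filterlim_at_top_mono[OF filterlim_real_sequentially]) (use t in auto)
  moreover have "t k \<ge> 0" for k using t(1)[of k] by linarith
  ultimately obtain r :: "nat \<Rightarrow> nat" where "(\<lambda>k. f (t (r k))) \<longlonglongrightarrow> 0" using sub by blast
  then have "\<epsilon> \<le> 0" by (rule LIMSEQ_le_const) (use t in auto)
  with \<epsilon> show False by simp
qed

section \<open>The energy on the closed ball around the minimizer\<close>

locale minimizer_setting = energy_space V e m Vext exc vxc
  for V :: "(real^3 \<Rightarrow> real) set" and e :: "nat \<Rightarrow> real^3 \<Rightarrow> real" and m :: nat
    and Vext :: "real^3 \<Rightarrow> real" and exc vxc :: density_map +
  fixes Ustar :: "'n::finite orbitals" and \<delta>\<^sub>1 \<delta>\<^sub>2 E0 :: real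
  assumes bounded_below: "\<exists>c. \<forall>W \<in> (stiefel :: 'n orbitals set). c \<le> energy Vext exc W"
    and xc_potential: "\<And>W :: 'n orbitals. W \<in> tuples V \<Longrightarrow> has_xc_potential V exc vxc W"
    and \<delta>\<^sub>2: "0 < \<delta>\<^sub>2" "\<delta>\<^sub>2 \<le> \<delta>\<^sub>1"
    and Ustar: "Ustar \<in> tuples V \<inter> stiefel"
    and unique_critical: "\<And>W. W \<in> tuples V \<inter> stiefel \<Longrightarrow> cls W \<in> class_ball V Ustar \<delta>\<^sub>1 \<Longrightarrow>
          critical_point V Vext vxc W \<longleftrightarrow> cls W = cls Ustar"
    and continuity: "tcontinuous_on (tuple_ball V Ustar \<delta>\<^sub>1) (energy_gradient V Vext vxc)"
    and E0_attained: "\<exists>W \<in> tuples V \<inter> stiefel.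
          cls W \<in> class_closure V (class_ball V Ustar \<delta>\<^sub>1 - class_ball V Ustar \<delta>\<^sub>2) \<and>
          E0 = energy Vext exc W"
    and E0_minimal: "\<And>W. W \<in> tuples V \<inter> stiefel \<Longrightarrow>
          cls W \<in> class_closure V (class_ball V Ustar \<delta>\<^sub>1 - class_ball V Ustar \<delta>\<^sub>2) \<Longrightarrow>
          E0 \<le> energy Vext exc W"
    and E0_ge: "energy Vext exc Ustar \<le> E0"
begin

abbreviation En :: "'n orbitals \<Rightarrow> real" where
  "En \<equiv> energy Vext exc"

abbreviation dstar :: "'n orbitals \<Rightarrow> real" where
  "dstar \<equiv> cdist Ustar"

lemma Ustar_tuples: "Ustar \<in> tuples V"
  using Ustar by simp

lemma energy_frechet: "W \<in> tuples V \<Longrightarrow> frechet En (tinner (eg W)) W"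
  by (rule frechet_energy[OF _ xc_potential])

lemma tlim_energy: "tlim W L \<Longrightarrow> (\<lambda>k. En (W k)) \<longlonglongrightarrow> En L"
  by (rule tlim_frechet[OF _ energy_frechet]) (auto simp: tlim_def)

text \<open>Translates the minimality of \<open>E0\<close>, stated for orbits in a closure, into a
  condition on tuples: W is a norm limit of points whose distance exceeds
  \<open>\<delta>\<^sub>2\<close> and is at most \<open>\<delta>\<^sub>1\<close>.\<close>

lemma in_annulus_closure:
  assumes "W \<in> tuples V \<inter> stiefel"
    and "\<And>\<epsilon>. \<epsilon> > 0 \<Longrightarrow> \<exists>X \<in> tuples V \<inter> stiefel. \<delta>\<^sub>2 < dstar X \<and> dstar X \<le> \<delta>\<^sub>1 \<and> tnorm (W - X) < \<epsilon>"
  shows "E0 \<le> En W"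
proof (rule E0_minimal[OF assms(1)])
  have "\<exists>X \<in> tuples V \<inter> stiefel. cls X \<in> class_ball V Ustar \<delta>\<^sub>1 - class_ball V Ustar \<delta>\<^sub>2 \<and> cdist W X < \<epsilon>"
    if \<epsilon>: "\<epsilon> > 0" for \<epsilon>
  proof -
    from assms(2)[OF \<epsilon>] obtain X where X: "X \<in> tuples V \<inter> stiefel" "\<delta>\<^sub>2 < dstar X" "dstar X \<le> \<delta>\<^sub>1" "tnorm (W - X) < \<epsilon>"
      by blast
    have "cls X \<in> class_ball V Ustar \<delta>\<^sub>1 - class_ball V Ustar \<delta>\<^sub>2"
      using X(2,3) unfolding Diff_iff cls_in_class_ball[OF X(1)] by simp
    moreover have "cdist W X < \<epsilon>" using cdist_le_tnorm[of W X] X(4) by linarith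
    ultimately show ?thesis using X(1) by blast
  qed
  then show "cls W \<in> class_closure V (class_ball V Ustar \<delta>\<^sub>1 - class_ball V Ustar \<delta>\<^sub>2)"
    unfolding class_closure_def using assms(1) by blast
qed

text \<open>An attained minimum over the closure presupposes a point of the annulus, and its
  distance lies between the two radii.\<close>

lemma \<delta>\<^sub>2_less: "\<delta>\<^sub>2 < \<delta>\<^sub>1"
proof -
  from E0_attained obtain W where
    "cls W \<in> class_closure V (class_ball V Ustar \<delta>\<^sub>1 - class_ball V Ustar \<delta>\<^sub>2)" by blast
  then obtain W' where W': "\<forall>\<epsilon>>0. \<exists>X \<in> tuples V \<inter> stiefel.
      cls X \<in> class_ball V Ustar \<delta>\<^sub>1 - class_ball V Ustar \<delta>\<^sub>2 \<and> cdist W' X < \<epsilon>"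
    unfolding class_closure_def by blast
  obtain X where X: "X \<in> tuples V \<inter> stiefel" "cls X \<in> class_ball V Ustar \<delta>\<^sub>1 - class_ball V Ustar \<delta>\<^sub>2"
    using W'[rule_format, OF zero_less_one] by blast
  then show ?thesis unfolding Diff_iff cls_in_class_ball[OF X(1)] by simp
qed

text \<open>The distance is Lipschitz, so tuples closer to W than
  \<open>\<delta>\<^sub>1 - dstar W\<close> stay in the ball. Hence W is an unconstrained local
  minimum on the Stiefel manifold.\<close>

lemma interior_minimum:
  assumes W: "W \<in> tuples V \<inter> stiefel" "dstar W < \<delta>\<^sub>1"
    and min: "\<And>X. X \<in> tuples V \<inter> stiefel \<Longrightarrow> dstar X \<le> \<delta>\<^sub>1 \<Longrightarrow> En W \<le> En X"
  shows "gg W = 0" "cls W = cls Ustar"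
proof -
  have Wt: "W \<in> tuples V" using W by simp
  show gg: "gg W = 0"
  proof (rule local_minimum_critical[OF W(1) xc_potential[OF Wt], of "\<delta>\<^sub>1 - dstar W"])
    fix X assume X: "X \<in> tuples V \<inter> stiefel" "tnorm (X - W) < \<delta>\<^sub>1 - dstar W"
    have "\<bar>dstar X - dstar W\<bar> \<le> tnorm (X - W)"
      using X(1) by (intro cdist_lipschitz Ustar_tuples Wt) simp
    with X show "En W \<le> En X" by (intro min) auto
  qed (use W in simp)
  have "cls W \<in> class_ball V Ustar \<delta>\<^sub>1" using cls_in_class_ball[OF W(1)] W(2) by simp
  moreover have "critical_point V Vext vxc W" using W gg unfolding critical_point_def by blast
  ultimately show "cls W = cls Ustar" using unique_critical[OF W(1)] by blast
qed

lemma energy_cls_eq: "cls W = cls Ustar \<Longrightarrow> En W = En Ustar"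
  by (erule cls_eqE) (simp add: energy_tmul[OF Ustar_tuples])

text \<open>A minimizer over the closed ball of radius \<open>\<delta>\<^sub>1\<close> is either interior, hence critical and in the
  class of \<open>Ustar\<close>, or on the boundary, where \<open>E0\<close> bounds the energy from below.\<close>

lemma Ustar_minimal:
  assumes X: "X \<in> tuples V \<inter> stiefel" "dstar X \<le> \<delta>\<^sub>1"
  shows "En Ustar \<le> En X"
proof -
  define B where "B = {X \<in> tuples V \<inter> stiefel. dstar X \<le> \<delta>\<^sub>1}"
  have ne: "B \<noteq> {}" using X by (auto simp: B_def)
  have bdd: "bdd_below (En ` B)"
    using bounded_below by (auto simp: B_def bdd_below_def)
  define \<mu> where "\<mu> = (INF X\<in>B. En X)"
  have lower: "\<mu> \<le> En X" if "X \<in> B" for X unfolding \<mu>_def using bdd that by (rule cINF_lower)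
  have "\<exists>X\<in>B. En X < \<mu> + 1 / real (Suc k)" for k
    using cINF_less_iff[OF ne bdd, of "\<mu> + 1 / real (Suc k)"] by (simp add: \<mu>_def)
  then obtain W where W: "\<And>k. W k \<in> B" "\<And>k. En (W k) < \<mu> + 1 / real (Suc k)" by metis
  then have WS: "W k \<in> tuples V \<inter> stiefel" for k by (simp add: B_def)
  obtain r L where r: "strict_mono r" "tlim (W \<circ> r) L" and L: "L \<in> tuples V \<inter> stiefel"
    by (rule discrete_stiefel_compact[OF WS])
  have Ld: "dstar L \<le> \<delta>\<^sub>1"
    using tlim_cdist[OF r(2) Ustar_tuples] by (rule LIMSEQ_le_const2) (use W in \<open>auto simp: B_def\<close>)
  have "(\<lambda>k. \<mu> + inverse (real (Suc k))) \<longlonglongrightarrow> \<mu>" by (rule LIMSEQ_inverse_real_of_nat_add)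
  from LIMSEQ_subseq_LIMSEQ[OF this r(1)]
  have lim: "(\<lambda>k. \<mu> + 1 / real (Suc (r k))) \<longlonglongrightarrow> \<mu>" by (simp add: o_def divide_inverse)
  have "En L \<le> \<mu>"
    by (rule LIMSEQ_le[OF tlim_energy[OF r(2)] lim]) (use W(2) in \<open>auto intro: less_imp_le\<close>)
  then have Lmin: "En L \<le> En X" if "X \<in> tuples V \<inter> stiefel" "dstar X \<le> \<delta>\<^sub>1" for X
    by (rule order_trans[OF _ lower]) (use that in \<open>simp_all only: B_def mem_Collect_eq simp_thms\<close>)
  have "En Ustar \<le> En L"
  proof (cases "dstar L < \<delta>\<^sub>1")
    case True
    then show ?thesis using energy_cls_eq[OF interior_minimum(2)[OF L True Lmin]] by linarith
  next
    case False
    \<comment> \<open>A point at distance exactly \<open>\<delta>\<^sub>1\<close> belongs to the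
      annulus, so the constant approximation by L itself suffices.\<close>
    have "E0 \<le> En L"
      using False Ld \<delta>\<^sub>2_less L by (intro in_annulus_closure bexI[of _ L]) auto
    with E0_ge show ?thesis by simp
  qed
  also have "\<dots> \<le> En X" using X by (rule Lmin)
  finally show ?thesis .
qed

lemma tlim_grassmann_gradient:
  assumes W: "\<And>k. W k \<in> tuples V \<inter> stiefel" and lim: "tlim W L" and L: "dstar L < \<delta>\<^sub>1"
  shows "(\<lambda>k. tnorm (gg (W k))) \<longlonglongrightarrow> tnorm (gg L)"
proof -
  have LS: "L \<in> tuples V \<inter> stiefel" using tlim_discrete_stiefel[OF lim W] .
  from L obtain P where P: "orthogonal_matrix P" and PL: "tnorm (Ustar - tmul L P) < \<delta>\<^sub>1"
    by (rule cdist_lessE)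
  let ?X = "\<lambda>k. tmul (W k) P" and ?Y = "tmul L P"
  have XS: "?X k \<in> tuples V \<inter> stiefel" for k using discrete_stiefel_tmul[OF W P] .
  have YS: "?Y \<in> tuples V \<inter> stiefel" using discrete_stiefel_tmul[OF LS P] .
  note X = discrete_stiefelD[OF XS] and Y = discrete_stiefelD[OF YS]
  have limX: "tlim ?X ?Y" using tlim_tmul[OF lim P] .
  then have limX0: "(\<lambda>k. tnorm (?X k - ?Y)) \<longlonglongrightarrow> 0" by (simp only: tlim_def)
  have Yb: "?Y \<in> tuple_ball V Ustar \<delta>\<^sub>1" using Y PL by (simp add: tuple_ball_def)
  have "(\<lambda>k. tnorm (eg (?X k) - eg ?Y)) \<longlonglongrightarrow> 0"
  proof (rule LIMSEQ_I)
    fix \<epsilon> :: real assume "\<epsilon> > 0"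
    with continuity Yb obtain \<eta> where \<eta>: "\<eta> > 0"
      "\<And>Z. Z \<in> tuple_ball V Ustar \<delta>\<^sub>1 \<Longrightarrow> tnorm (Z - ?Y) < \<eta> \<Longrightarrow> tnorm (eg Z - eg ?Y) < \<epsilon>"
      unfolding tcontinuous_on_def by blast
    \<comment> \<open>The rotated limit lies strictly inside the ball around \<open>Ustar\<close>.
      This margin brings the rotated sequence eventually into the set on which continuity is
      assumed.\<close>
    have "0 < min \<eta> (\<delta>\<^sub>1 - tnorm (Ustar - ?Y))" using \<eta>(1) PL by simp
    from order_tendstoD(2)[OF limX0 this]
    have "eventually (\<lambda>k. tnorm (eg (?X k) - eg ?Y) < \<epsilon>) sequentially"
    proof eventually_elim
      case (elim k)
      have "tnorm (Ustar - ?X k) \<le> tnorm (Ustar - ?Y) + tnorm (?Y - ?X k)"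
        by (intro tnorm_triangle_diff Ustar_tuples X Y)
      also have "tnorm (?Y - ?X k) = tnorm (?X k - ?Y)" by (rule tnorm_minus_commute)
      finally have "tnorm (Ustar - ?X k) \<le> \<delta>\<^sub>1" using elim by linarith
      then have "?X k \<in> tuple_ball V Ustar \<delta>\<^sub>1" using X by (simp add: tuple_ball_def)
      then show ?case using \<eta>(2) elim by simp
    qed
    then show "\<exists>no. \<forall>n\<ge>no. norm (tnorm (eg (?X n) - eg ?Y) - 0) < \<epsilon>"
      by (simp add: tnorm_nonneg eventually_sequentially)
  qed
  then have limG: "tlim (\<lambda>k. eg (?X k)) (eg ?Y)"
    unfolding tlim_def using X Y energy_gradient_tuples[OF _ xc_potential] by simp
  have "(\<lambda>k. tinner (eg (?X k)) (eg (?X k)) - (\<Sum>i\<in>UNIV. \<Sum>j\<in>UNIV. (l2_inner (?X k j) (eg (?X k) i))\<^sup>2))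
     \<longlonglongrightarrow> tinner (eg ?Y) (eg ?Y) - (\<Sum>i\<in>UNIV. \<Sum>j\<in>UNIV. (l2_inner (?Y j) (eg ?Y i))\<^sup>2)"
    unfolding tinner_eq by (intro tendsto_intros tlim_l2_inner limX limG)
  then have "(\<lambda>k. (tnorm (gg (?X k)))\<^sup>2) \<longlonglongrightarrow> (tnorm (gg ?Y))\<^sup>2"
    using tnorm_grassmann_gradient[OF X(1) xc_potential[OF X(1)] X(2)]
      tnorm_grassmann_gradient[OF Y(1) xc_potential[OF Y(1)] Y(2)] by (simp add: tnorm_power2)
  then have "(\<lambda>k. sqrt ((tnorm (gg (?X k)))\<^sup>2)) \<longlonglongrightarrow> sqrt ((tnorm (gg ?Y))\<^sup>2)" by (rule tendsto_real_sqrt)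
  then have "(\<lambda>k. tnorm (gg (?X k))) \<longlonglongrightarrow> tnorm (gg ?Y)" by (simp add: tnorm_nonneg)
  moreover have "tnorm (gg (tmul Z P)) = tnorm (gg Z)" if Z: "Z \<in> tuples V \<inter> stiefel" for Z
  proof -
    note z = discrete_stiefelD(1)[OF Z] discrete_stiefelD(1)[OF discrete_stiefel_tmul[OF Z P]]
    show ?thesis
      using grassmann_gradient_tmul[OF Z P xc_potential[OF z(1)] xc_potential[OF z(2)]]
        tnorm_tmul[OF grassmann_gradient_tuples[OF z(1) xc_potential[OF z(1)]] P] by simp
  qed
  ultimately show ?thesis using W LS by simp
qed

end

section \<open>The flow: conservation, decay, confinement and limits\<close>

locale flow_setting = minimizer_setting V e m Vext exc vxc Ustar \<delta>\<^sub>1 \<delta>\<^sub>2 E0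
  for V :: "(real^3 \<Rightarrow> real) set" and e :: "nat \<Rightarrow> real^3 \<Rightarrow> real" and m :: nat
    and Vext :: "real^3 \<Rightarrow> real" and exc vxc :: density_map
    and Ustar :: "'n::finite orbitals" and \<delta>\<^sub>1 \<delta>\<^sub>2 E0 :: real +
  fixes U0 :: "'n orbitals" and U :: "real \<Rightarrow> 'n orbitals"
  assumes U0: "U0 \<in> tuples V \<inter> stiefel"
    and flow: "gradient_flow V Vext vxc U0 U"
    and U0_energy: "energy Vext exc U0 \<le> (E0 + energy Vext exc Ustar) / 2"
    and U0_near: "cls U0 \<in> class_ball V Ustar \<delta>\<^sub>2"
begin

lemma U_tuples: "t \<ge> 0 \<Longrightarrow> U t \<in> tuples V"
  and U_0: "U 0 = U0"
  using flow by (auto simp: gradient_flow_def)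

lemma flow_tderiv:
  assumes t: "t > 0" shows "tderiv U (- gg (U t)) t"
  unfolding tderiv_def
proof (intro conjI)
  have Ut: "U t \<in> tuples V" using t by (intro U_tuples) simp
  show "U t \<in> tuples V" by (rule Ut)
  show "- gg (U t) \<in> tuples V"
    using grassmann_gradient_tuples[OF Ut xc_potential[OF Ut]] by (rule tuples_uminus)
  have "eventually (\<lambda>h. dist h 0 < t) (at (0::real))" using t by (auto simp: eventually_at)
  then show "eventually (\<lambda>h. U (t + h) \<in> tuples V) (at 0)"
    by eventually_elim (auto simp: dist_real_def intro!: U_tuples)
  show "((\<lambda>h. tnorm ((\<lambda>i r. (U (t + h) i r - U t i r) / h) - (- gg (U t)))) \<longlongrightarrow> 0) (at 0)"
    using flow t unfolding gradient_flow_def by blast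
qed

text \<open>At time 0 this is a clause of \<open>gradient_flow\<close>; at positive times it follows
  from differentiability.\<close>

lemma flow_continuous:
  assumes "t \<ge> 0" shows "((\<lambda>s. tnorm (U s - U t)) \<longlongrightarrow> 0) (at t within {0..})"
proof (cases "t = 0")
  case True
  then show ?thesis using flow by (simp add: gradient_flow_def at_within_Ici_at_right)
next
  case False
  then have "((\<lambda>h. tnorm (U (t + h) - U t)) \<longlongrightarrow> 0) (at 0)"
    using assms by (intro tderiv_increment(2)[OF flow_tderiv]) simp
  then have "((\<lambda>s. tnorm (U s - U t)) \<longlongrightarrow> 0) (at t)"
    by (rule LIM_offset_zero_cancel)
  then show ?thesis by (rule tendsto_within_subset) simp
qed

lemma flow_frechet_continuous:
  assumes "\<And>t. t \<ge> 0 \<Longrightarrow> frechet F (L t) (U t)"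
  shows "continuous_on {0..} (\<lambda>t. F (U t))"
  unfolding continuous_on_def
proof
  fix t :: real assume t: "t \<in> {0..}"
  show "((\<lambda>s. F (U s)) \<longlongrightarrow> F (U t)) (at t within {0..})"
  proof (rule frechet_continuous[where F=F and W=U])
    show "frechet F (L t) (U t)" using assms t by simp
    show "((\<lambda>s. tnorm (U s - U t)) \<longlongrightarrow> 0) (at t within {0..})" using flow_continuous t by simp
    show "eventually (\<lambda>s. U s \<in> tuples V) (at t within {0..})"
      by (auto simp: eventually_at_filter U_tuples)
    show "U t \<in> tuples V" using U_tuples t by simp
  qed
qed

lemma flow_dstar_continuous: "continuous_on {0..} (\<lambda>t. dstar (U t))"
  unfolding continuous_on_def
proof
  fix t :: real assume t: "t \<in> {0..}"
  have "((\<lambda>s. dstar (U s) - dstar (U t)) \<longlongrightarrow> 0) (at t within {0..})"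
  proof (rule Lim_null_comparison)
    show "((\<lambda>s. tnorm (U s - U t)) \<longlongrightarrow> 0) (at t within {0..})" using flow_continuous t by simp
    show "eventually (\<lambda>s. norm (dstar (U s) - dstar (U t)) \<le> tnorm (U s - U t)) (at t within {0..})"
      using cdist_lipschitz[OF Ustar_tuples U_tuples U_tuples] t by (auto simp: eventually_at_filter)
  qed
  then show "((\<lambda>s. dstar (U s)) \<longlongrightarrow> dstar (U t)) (at t within {0..})" using Lim_null by blast
qed

lemma flow_stiefel:
  assumes "t \<ge> 0" shows "U t \<in> tuples V \<inter> stiefel"
proof -
  have "l2_inner (U t i) (U t j) = l2_inner (U 0 i) (U 0 j)" for i j
  proof (cases "t = 0")
    case False
    let ?F = "\<lambda>W :: 'n orbitals. l2_inner (W i) (W j)"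
    have fr: "frechet ?F (\<lambda>W. l2_inner (U t i) (W j) + l2_inner (W i) (U t j)) (U t)" if "t \<ge> 0" for t
      using frechet_bilinear[OF bilinear_l2_inner U_tuples[OF that]] .
    show ?thesis
    proof (rule DERIV_isconst_end[where f="\<lambda>t. ?F (U t)"])
      show "0 < t" using False assms by simp
      show "continuous_on {0..t} (\<lambda>t. ?F (U t))"
        by (rule continuous_on_subset[OF flow_frechet_continuous[OF fr]]) auto
      fix s assume s: "0 < s" "s < t"
      then have Us: "U s \<in> tuples V" using U_tuples by simp
      have "((\<lambda>t. ?F (U t)) has_real_derivative
          l2_inner (U s i) ((- gg (U s)) j) + l2_inner ((- gg (U s)) i) (U s j)) (at s)"
        using s by (intro frechet_chain[OF fr flow_tderiv]) auto
      moreover have "(gram (U s) (gg (U s)) + gram (gg (U s)) (U s)) $ i $ j = 0"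
        unfolding gram_grassmann_gradient_skew[OF Us xc_potential[OF Us]] by simp
      then have "l2_inner (U s i) ((- gg (U s)) j) + l2_inner ((- gg (U s)) i) (U s j) = 0"
        by (simp add: gram_def l2_inner_def)
      ultimately show "((\<lambda>t. ?F (U t)) has_real_derivative 0) (at s)" by simp
    qed
  qed simp
  then have "gram (U t) (U t) = gram U0 U0" by (simp add: gram_def U_0)
  then show ?thesis
    unfolding in_discrete_stiefel using discrete_stiefelD(2)[OF U0] U_tuples[OF assms] by simp
qed

lemma flow_energy_derivative:
  assumes "t > 0" shows "((\<lambda>t. En (U t)) has_real_derivative - (tnorm (gg (U t)))\<^sup>2) (at t)"
proof -
  have S: "U t \<in> tuples V \<inter> stiefel" using flow_stiefel assms by simp
  note W = discrete_stiefelD[OF S]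
  have "tinner (eg (U t)) (- gg (U t)) = - tinner (eg (U t)) (gg (U t))"
    by (simp add: tinner_eq l2_inner_def sum_negf)
  also have "\<dots> = - (tnorm (gg (U t)))\<^sup>2"
    using tinner_energy_grassmann_gradient[OF W(1) xc_potential[OF W(1)] W(2)] by simp
  finally show ?thesis
    using frechet_chain[OF energy_frechet[OF W(1)] flow_tderiv[OF assms]] by simp
qed

lemma flow_energy_continuous: "continuous_on {0..} (\<lambda>t. En (U t))"
  by (rule flow_frechet_continuous[OF energy_frechet[OF U_tuples]])

text \<open>With c = 0 this is monotonicity; with c the square of a lower bound on the gradient it
  says that the energy drops at least linearly in time.\<close>

lemma flow_energy_decrease:
  assumes "0 \<le> s" "s \<le> t" and c: "\<And>x. s < x \<Longrightarrow> x < t \<Longrightarrow> c \<le> (tnorm (gg (U x)))\<^sup>2"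
  shows "En (U t) + c * t \<le> En (U s) + c * s"
proof (rule DERIV_nonpos_imp_decreasing_open[where f="\<lambda>t. En (U t) + c * t"])
  fix x assume x: "s < x" "x < t"
  have "((\<lambda>t. En (U t) + c * t) has_real_derivative - (tnorm (gg (U x)))\<^sup>2 + c * 1) (at x)"
    using x assms by (intro DERIV_add flow_energy_derivative DERIV_cmult DERIV_ident) simp
  then show "\<exists>y. ((\<lambda>t. En (U t) + c * t) has_real_derivative y) (at x) \<and> y \<le> 0"
    using c[OF x] by (intro exI conjI) auto
next
  show "continuous_on {s..t} (\<lambda>t. En (U t) + c * t)"
    using assms by (intro continuous_intros continuous_on_subset[OF flow_energy_continuous]) auto
qed (rule assms)

lemma flow_energy_antimono: "0 \<le> s \<Longrightarrow> s \<le> t \<Longrightarrow> En (U t) \<le> En (U s)"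
  using flow_energy_decrease[of s t 0] by simp

text \<open>At the last time before leaving the ball of radius \<open>\<delta>\<^sub>2\<close> the energy is at least \<open>E0\<close>. This
  forces \<open>E0 = En Ustar\<close>, so the flow is then at an interior minimum, i.e. in the class of \<open>Ustar\<close>.\<close>

lemma flow_near:
  assumes t: "t \<ge> 0" shows "dstar (U t) \<le> \<delta>\<^sub>2"
proof (rule ccontr)
  assume far: "\<not> dstar (U t) \<le> \<delta>\<^sub>2"
  define A where "A = {s \<in> {0..t}. dstar (U s) \<le> \<delta>\<^sub>2}"
  have cont: "continuous_on {0..t} (\<lambda>t. dstar (U t))"
    by (rule continuous_on_subset[OF flow_dstar_continuous]) auto
  have "closed A" unfolding A_def
    using continuous_on_closed_Collect_le[OF cont continuous_on_const closed_atLeastAtMost] .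
  then have "compact A"
    by (rule compact_eq_bounded_closed[THEN iffD2, OF conjI, rotated]) (rule bounded_subset[OF bounded_closed_interval], auto simp: A_def)
  moreover have "0 \<in> A"
    using U0_near cls_in_class_ball[OF U0] t by (simp add: A_def U_0)
  ultimately obtain s where s: "s \<in> A" and sup: "\<And>x. x \<in> A \<Longrightarrow> x \<le> s"
    using compact_attains_sup[of A] by blast
  have s0: "0 \<le> s" "s < t" and sd: "dstar (U s) \<le> \<delta>\<^sub>2"
    using s far by (auto simp: A_def less_le)
  have after: "\<delta>\<^sub>2 < dstar (U x)" if "s < x" "x \<le> t" for x
    using sup[of x] that s0 by (force simp: A_def)
  have US: "U s \<in> tuples V \<inter> stiefel" using flow_stiefel s0 by simp
  have close: "\<exists>x. s < x \<and> x \<le> t \<and> tnorm (U x - U s) < \<epsilon>" if \<epsilon>: "\<epsilon> > 0" for \<epsilon>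
  proof -
    have "eventually (\<lambda>x. tnorm (U x - U s) < \<epsilon>) (at s within {0..})"
      using order_tendstoD(2)[OF flow_continuous[OF s0(1)] \<epsilon>] .
    then obtain d where d: "d > 0" "\<And>x. x \<in> {0..} \<Longrightarrow> x \<noteq> s \<Longrightarrow> dist x s < d \<Longrightarrow> tnorm (U x - U s) < \<epsilon>"
      unfolding eventually_at by blast
    show ?thesis
      using d s0 by (intro exI[of _ "min t (s + d / 2)"]) (auto simp: dist_real_def min_def)
  qed
  have "E0 \<le> En (U s)"
  proof (rule in_annulus_closure[OF US])
    fix \<epsilon> :: real assume "\<epsilon> > 0"
    \<comment> \<open>The second bound keeps a slightly later point of the flow within the outer
      radius, so that it lies in the annulus.\<close>
    then have "min \<epsilon> (\<delta>\<^sub>1 - \<delta>\<^sub>2) > 0" using \<delta>\<^sub>2_less by simp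
    from close[OF this] obtain x where x: "s < x" "x \<le> t" "tnorm (U x - U s) < \<epsilon>" "tnorm (U x - U s) < \<delta>\<^sub>1 - \<delta>\<^sub>2"
      by auto
    have "\<bar>dstar (U x) - dstar (U s)\<bar> \<le> tnorm (U x - U s)"
      using x s0 by (intro cdist_lipschitz Ustar_tuples U_tuples) auto
    then have "dstar (U x) \<le> \<delta>\<^sub>1" using x sd by linarith
    then show "\<exists>X\<in>tuples V \<inter> stiefel. \<delta>\<^sub>2 < dstar X \<and> dstar X \<le> \<delta>\<^sub>1 \<and> tnorm (U s - X) < \<epsilon>"
      using x after s0 flow_stiefel[of x] by (intro bexI[of _ "U x"]) (auto simp: tnorm_minus_commute[of "U s"])
  qed
  moreover have "En (U s) \<le> En U0" using flow_energy_antimono[of 0 s] s0 by (simp add: U_0)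
  ultimately have "En (U s) \<le> En Ustar" using U0_energy E0_ge by simp
  then have "En (U s) \<le> En X" if "X \<in> tuples V \<inter> stiefel" "dstar X \<le> \<delta>\<^sub>1" for X
    using Ustar_minimal[OF that] by simp
  from interior_minimum(2)[OF US _ this] have "cls (U s) = cls Ustar" using sd \<delta>\<^sub>2_less by simp
  then have "dstar (U s) = 0" by (rule cdist_cls_eq)
  \<comment> \<open>Points of the flow just after s are farther away than
    \<open>\<delta>\<^sub>2\<close>, and the distance is continuous; this contradicts distance
    0.\<close>
  moreover have "\<delta>\<^sub>2 \<le> dstar (U s)"
  proof (rule field_le_epsilon)
    fix \<epsilon> :: real assume "\<epsilon> > 0"
    from close[OF this] obtain x where x: "s < x" "x \<le> t" "tnorm (U x - U s) < \<epsilon>" by blast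
    have "\<bar>dstar (U x) - dstar (U s)\<bar> \<le> tnorm (U x - U s)"
      using x s0 by (intro cdist_lipschitz Ustar_tuples U_tuples) auto
    then show "\<delta>\<^sub>2 \<le> dstar (U s) + \<epsilon>" using after[OF x(1,2)] x(3) by linarith
  qed
  ultimately show False using \<delta>\<^sub>2(1) by simp
qed

lemma flow_energy_ge: "t \<ge> 0 \<Longrightarrow> En Ustar \<le> En (U t)"
  using Ustar_minimal[OF flow_stiefel] flow_near \<delta>\<^sub>2(2) by (meson order_trans)

lemma flow_sequence_compact:
  fixes t :: "nat \<Rightarrow> real"
  assumes "\<And>k. t k \<ge> 0"
  obtains r L where "strict_mono r" "tlim (\<lambda>k. U (t (r k))) L" "L \<in> tuples V \<inter> stiefel" "dstar L < \<delta>\<^sub>1"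
    "(\<lambda>k. tnorm (gg (U (t (r k))))) \<longlonglongrightarrow> tnorm (gg L)"
proof -
  have S: "U (t k) \<in> tuples V \<inter> stiefel" for k using flow_stiefel assms by blast
  obtain r L where r: "strict_mono r" "tlim ((\<lambda>k. U (t k)) \<circ> r) L" "L \<in> tuples V \<inter> stiefel"
    by (rule discrete_stiefel_compact[where W="\<lambda>k. U (t k)", OF S])
  have lim: "tlim (\<lambda>k. U (t (r k))) L" using r(2) by (simp add: o_def)
  have "dstar L \<le> \<delta>\<^sub>2"
    using tlim_cdist[OF lim Ustar_tuples] by (rule LIMSEQ_le_const2) (use flow_near assms in auto)
  then have "dstar L < \<delta>\<^sub>1" using \<delta>\<^sub>2_less by simp
  with tlim_grassmann_gradient[OF S lim] show thesis using that[OF r(1) lim r(3)] by blast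
qed

lemma gradient_small_somewhere: "\<exists>t\<ge>T. tnorm (gg (U t)) < \<epsilon>" if "\<epsilon> > 0" "T \<ge> 0"
proof (rule ccontr)
  assume "\<not> ?thesis"
  then have big: "\<epsilon> \<le> tnorm (gg (U t))" if "t \<ge> T" for t using that by force
  \<comment> \<open>If the gradient stayed at least \<epsilon>, the energy at this time would have
    fallen to 1 below \<open>En Ustar\<close> or lower.\<close>
  define t where "t = T + (En (U T) - En Ustar + 1) / \<epsilon>\<^sup>2"
  define c where "c = En (U T) - En Ustar + 1"
  have "En Ustar \<le> En (U T)" using flow_energy_ge \<open>T \<ge> 0\<close> .
  then have t: "T \<le> t" using \<open>\<epsilon> > 0\<close> by (simp add: t_def)
  have "En (U t) + \<epsilon>\<^sup>2 * t \<le> En (U T) + \<epsilon>\<^sup>2 * T"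
    using \<open>T \<ge> 0\<close> t big \<open>\<epsilon> > 0\<close> by (intro flow_energy_decrease power_mono) auto
  moreover have "\<epsilon>\<^sup>2 * t = \<epsilon>\<^sup>2 * T + (En (U T) - En Ustar + 1)"
    unfolding t_def c_def[symmetric] using \<open>\<epsilon> > 0\<close> by (simp add: distrib_left)
  ultimately show False using flow_energy_ge[of t] t \<open>T \<ge> 0\<close> by simp
qed

text \<open>Since the energy decreases along the flow and is bounded below by
  \<open>En Ustar\<close>, a single sequence of times with the right energy limit decides the whole
  limit.\<close>

lemma flow_energy_tendsto: "((\<lambda>t. En (U t)) \<longlongrightarrow> En Ustar) at_top"
proof (rule decreasing_tendsto)
  show "eventually (\<lambda>t. En Ustar \<le> En (U t)) at_top"
    using flow_energy_ge by (auto simp: eventually_at_top_linorder)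
  have "\<forall>k. \<exists>t\<ge>real k. tnorm (gg (U t)) < 1 / real (Suc k)"
    using gradient_small_somewhere by simp
  then obtain t where t: "\<And>k. t k \<ge> real k" "\<And>k. tnorm (gg (U (t k))) < 1 / real (Suc k)" by metis
  have t0: "t k \<ge> 0" for k using t(1)[of k] by linarith
  obtain r L where r: "strict_mono r" "tlim (\<lambda>k. U (t (r k))) L" and L: "L \<in> tuples V \<inter> stiefel" "dstar L < \<delta>\<^sub>1"
    and g: "(\<lambda>k. tnorm (gg (U (t (r k))))) \<longlonglongrightarrow> tnorm (gg L)"
    by (rule flow_sequence_compact[OF t0])
  have "(\<lambda>k. tnorm (gg (U (t k)))) \<longlonglongrightarrow> 0"
    by (rule Lim_null_comparison[OF always_eventually LIMSEQ_inverse_real_of_nat])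
       (use t(2) in \<open>simp add: divide_inverse abs_of_nonneg[OF tnorm_nonneg] less_imp_le\<close>)
  from LIMSEQ_unique[OF g LIMSEQ_subseq_LIMSEQ[OF this r(1), unfolded o_def]]
  have "gg L = 0"
    using grassmann_gradient_tuples[OF _ xc_potential] discrete_stiefelD(1)[OF L(1)] tnorm_eq_0 by blast
  then have "critical_point V Vext vxc L" using L(1) unfolding critical_point_def by blast
  moreover have "cls L \<in> class_ball V Ustar \<delta>\<^sub>1" using cls_in_class_ball[OF L(1)] L(2) by simp
  ultimately have "En L = En Ustar" using unique_critical[OF L(1)] energy_cls_eq by blast
  with tlim_energy[OF r(2)] have lim: "(\<lambda>k. En (U (t (r k)))) \<longlonglongrightarrow> En Ustar" by simp
  fix x assume "En Ustar < x"
  from order_tendstoD(2)[OF lim this] obtain k where k: "En (U (t (r k))) < x"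
    by (auto simp: eventually_sequentially)
  show "eventually (\<lambda>t. En (U t) < x) at_top"
    unfolding eventually_at_top_linorder
    using flow_energy_antimono[OF t0[of "r k"]] k by (intro exI[of _ "t (r k)"]) (auto intro: le_less_trans)
qed

text \<open>Now that the energy limit is known for all times, a limit point along any sequence of
  times has energy \<open>En Ustar\<close>. It is therefore an interior minimum, and criticality no
  longer depends on selecting times with small gradient.\<close>

lemma flow_sequence_limit:
  assumes t: "filterlim t at_top sequentially" "\<And>k. t k \<ge> (0::real)"
  obtains r where "strict_mono r" "(\<lambda>k. tnorm (gg (U (t (r k))))) \<longlonglongrightarrow> 0" "(\<lambda>k. dstar (U (t (r k)))) \<longlonglongrightarrow> 0"
proof -
  obtain r L where r: "strict_mono r" "tlim (\<lambda>k. U (t (r k))) L" and L: "L \<in> tuples V \<inter> stiefel" "dstar L < \<delta>\<^sub>1"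
    and g: "(\<lambda>k. tnorm (gg (U (t (r k))))) \<longlonglongrightarrow> tnorm (gg L)"
    by (rule flow_sequence_compact[OF t(2)])
  have "filterlim (\<lambda>k. t (r k)) at_top sequentially"
    using filterlim_compose[OF t(1) filterlim_subseq[OF r(1)]] .
  from LIMSEQ_unique[OF tlim_energy[OF r(2)] filterlim_compose[OF flow_energy_tendsto this]]
  have "En L \<le> En X" if "X \<in> tuples V \<inter> stiefel" "dstar X \<le> \<delta>\<^sub>1" for X
    using Ustar_minimal[OF that] by simp
  note crit = interior_minimum[OF L this]
  have "(\<lambda>k. dstar (U (t (r k)))) \<longlonglongrightarrow> dstar L" by (rule tlim_cdist[OF r(2) Ustar_tuples])
  then show thesis using that[OF r(1)] g crit(1) cdist_cls_eq[OF crit(2)] by simp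
qed

lemma flow_converges:
  "((\<lambda>t. tnorm (gg (U t))) \<longlongrightarrow> 0) at_top" "((\<lambda>t. cdist (U t) Ustar) \<longlongrightarrow> 0) at_top"
proof -
  show "((\<lambda>t. tnorm (gg (U t))) \<longlongrightarrow> 0) at_top"
    by (rule tendsto_zero_by_sequences) (blast intro: tnorm_nonneg elim: flow_sequence_limit)+
  have "((\<lambda>t. dstar (U t)) \<longlongrightarrow> 0) at_top"
    by (rule tendsto_zero_by_sequences) (blast intro: cdist_nonneg elim: flow_sequence_limit)+
  moreover have "eventually (\<lambda>t. dstar (U t) = cdist (U t) Ustar) at_top"
    using cdist_commute[OF Ustar_tuples U_tuples] by (auto simp: eventually_at_top_linorder)
  ultimately show "((\<lambda>t. cdist (U t) Ustar) \<longlongrightarrow> 0) at_top"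
    by (rule Lim_transform_eventually)
qed

end

theorem theorem3p4:
  fixes V :: "(real^3 \<Rightarrow> real) set" and Ng :: nat
    and Vext :: "real^3 \<Rightarrow> real" and exc vxc :: density_map
    and Ustar U0 :: "'n::finite orbitals" and U :: "real \<Rightarrow> 'n orbitals"
    and \<delta>\<^sub>1 \<delta>\<^sub>2 E0 E1 :: real
  assumes V: "discrete_space V Ng"
    \<comment> \<open>the terms of the energy are well defined on \<open>(H\<^sup>1)\<^sup>N\<close>\<close>
    and ext_defined: "\<And>u. u \<in> H1 \<Longrightarrow> integrable lborel (\<lambda>r. Vext r * (u r)\<^sup>2)"
    and hartree_defined: "\<And>u v. u \<in> H1 \<Longrightarrow> v \<in> H1 \<Longrightarrow>
          integrable (lborel \<Otimes>\<^sub>M lborel) (\<lambda>(r, r'). (u r)\<^sup>2 * (v r')\<^sup>2 / dist r r')"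
    and xc_defined: "\<And>W :: 'n orbitals. W \<in> tuples H1 \<Longrightarrow>
          integrable lborel (\<lambda>r. exc (electron_density W) r * electron_density W r)"
    and bounded_below: "\<exists>c. \<forall>W \<in> (stiefel :: 'n orbitals set). c \<le> energy Vext exc W"
    and xc_potential: "\<And>W :: 'n orbitals. W \<in> tuples V \<Longrightarrow> has_xc_potential V exc vxc W"
    and \<delta>\<^sub>1: "\<delta>\<^sub>1 > 0" and \<delta>\<^sub>2: "0 < \<delta>\<^sub>2" "\<delta>\<^sub>2 \<le> \<delta>\<^sub>1"
    and Ustar: "Ustar \<in> tuples V \<inter> stiefel"
    and local_min: "local_minimizer V Vext exc Ustar"
    and unique_critical: "\<And>W. W \<in> tuples V \<inter> stiefel \<Longrightarrow> cls W \<in> class_ball V Ustar \<delta>\<^sub>1 \<Longrightarrow>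
          critical_point V Vext vxc W \<longleftrightarrow> cls W = cls Ustar"
    and continuity: "tcontinuous_on (tuple_ball V Ustar \<delta>\<^sub>1) (energy_gradient V Vext vxc)"
    and E0_attained: "\<exists>W \<in> tuples V \<inter> stiefel.
          cls W \<in> class_closure V (class_ball V Ustar \<delta>\<^sub>1 - class_ball V Ustar \<delta>\<^sub>2) \<and>
          E0 = energy Vext exc W"
    and E0_minimal: "\<And>W. W \<in> tuples V \<inter> stiefel \<Longrightarrow>
          cls W \<in> class_closure V (class_ball V Ustar \<delta>\<^sub>1 - class_ball V Ustar \<delta>\<^sub>2) \<Longrightarrow>
          E0 \<le> energy Vext exc W"
    and E1: "E1 = (E0 + energy Vext exc Ustar) / 2"
    and U0: "U0 \<in> tuples V \<inter> stiefel"
    and flow: "gradient_flow V Vext vxc U0 U"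
    and U0_energy: "energy Vext exc U0 \<le> E1"
    \<comment> \<open>implicit in the source, and indispensable: the threshold does not lie below the energy
        of \<open>Ustar\<close>, and the initial orbit is near that of \<open>Ustar\<close>\<close>
    and E0_ge: "energy Vext exc Ustar \<le> E0"
    and U0_near: "cls U0 \<in> class_ball V Ustar \<delta>\<^sub>2"
  shows "((\<lambda>t. tnorm (grassmann_gradient V Vext vxc (U t))) \<longlongrightarrow> 0) at_top
    \<and> ((\<lambda>t. energy Vext exc (U t)) \<longlongrightarrow> energy Vext exc Ustar) at_top
    \<and> ((\<lambda>t. cdist (U t) Ustar) \<longlongrightarrow> 0) at_top"
proof -
  from discrete_space_orthonormal[OF V] obtain e where "orthonormal_space V e Ng" .
  then interpret orthonormal_space V e Ng .
  interpret flow_setting V e Ng Vext exc vxc Ustar \<delta>\<^sub>1 \<delta>\<^sub>2 E0 U0 U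
  proof unfold_locales
    show "energy Vext exc U0 \<le> (E0 + energy Vext exc Ustar) / 2" using U0_energy E1 by simp
  qed (fact ext_defined hartree_defined bounded_below xc_potential \<delta>\<^sub>2 Ustar unique_critical continuity
      E0_attained E0_minimal E0_ge U0 flow U0_near)+
  show ?thesis using flow_converges flow_energy_tendsto by blast
qed

end
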